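(* Let $y=\gamma\otimes\hat\gamma$ be a torus of tensor product (notation in the context) which is a Willmore surface in $S^{(n+1)(m+1)-1}$. Then \[W(y)\geq 2\pi^2\sqrt{3},\] and equality holds if and only if $y$ coincides, up to an isometry of the ambient sphere and a reparametrization, with the Ejiri torus $E$ (lying in a totally geodesic $S^5$).
   Context: Let $\gamma:\mathbb{R}\to S^n\subset\mathbb{R}^{n+1}$ and $\hat\gamma:\mathbb{R}\to S^m\subset\mathbb{R}^{m+1}$ be smooth closed curves parametrized by arc length $s$, $\hat s$, with periods $L$, $\hat L$ equal to their lengths. Their Frenet curvatures in the sphere are $k_1,k_2,\dots$ (resp. $\hat k_1,\hat k_2,\dots$), defined through an orthonormal frame $\{\gamma,\beta_0,\beta_1,\dots\}$ by $\gamma'=\beta_0$, $\beta_0'=k_1\beta_1-\gamma$, $\beta_1'=k_2\beta_2-k_1\beta_0$, $\dots$ (and similarly for $\hat\gamma$); thus $k_1$ is the geodesic curvature of $\gamma$ in $S^n$. For $x\in\mathbb{R}^{n+1}$, $\hat x\in\mathbb{R}^{m+1}$ the tensor product is $x\otimes\hat x=(x_1\hat x_1,\dots,x_1\hat x_{m+1},x_2\hat x_1,\dots,x_{n+1}\hat x_{m+1})\in\mathbb{R}^{(n+1)(m+1)}$. The torus of tensor product is $y=\gamma\otimes\hat\gamma:(s,\hat s)\mapsto\gamma(s)\otimes\hat\gamma(\hat s)$, a conformal flat immersion of $\mathbb{R}^2/(L\mathbb{Z}\times\hat L\mathbb{Z})$ into $S^{(n+1)(m+1)-1}$. For a closed immersed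 surface $x:M\to S^N$ with mean curvature vector $\vec H$ and Gauss curvature $K$, the Willmore functional is $W(x)=\int_M(|\vec H|^2-K+1)\,dM$; $x$ is a Willmore surface if it is a critical point of $W$ under all variations. The Ejiri torus is $E:(s,\hat s)\mapsto\frac{1}{\sqrt3}\big(\cos\hat s\cos\sqrt3 s,\ \sin\hat s\cos\sqrt3 s,\ \cos\hat s\sin\sqrt3 s,\ \sin\hat s\sin\sqrt3 s,\ \sqrt2\cos\hat s,\ \sqrt2\sin\hat s\big)\in S^5$, i.e. the tensor product of the circle $\big(\tfrac{1}{\sqrt3}\cos\sqrt3 s,\tfrac{1}{\sqrt3}\sin\sqrt3 s,\sqrt{2/3}\big)$ with the great circle $(\cos\hat s,\sin\hat s)$. *)

theory Defs
  imports "HOL-Analysis.Analysis"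
begin

fun Ck :: "nat \<Rightarrow> ('a::euclidean_space \<Rightarrow> 'b::real_normed_vector) \<Rightarrow> bool" where
  "Ck 0 f = continuous_on UNIV f"
| "Ck (Suc k) f = ((\<forall>x. f differentiable (at x)) \<and>
                   (\<forall>i\<in>Basis. Ck k (\<lambda>x. frechet_derivative f (at x) i)))"

definition smooth :: "('a::euclidean_space \<Rightarrow> 'b::real_normed_vector) \<Rightarrow> bool" where
  "smooth f \<longleftrightarrow> (\<forall>k. Ck k f)"

text \<open>gamma : R -> S^n in R^(n+1) (index type 'n with CARD('n) = n+1), smooth,
  parametrized by arc length, closed with period L (= its length).\<close>
definition closed_sphere_curve :: "(real \<Rightarrow> real^'n) \<Rightarrow> real \<Rightarrow> bool" where
  "closed_sphere_curve g L \<longleftrightarrow>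
     smooth g \<and> L > 0 \<and>
     (\<forall>s. norm (g s) = 1) \<and>
     (\<forall>s. norm (vector_derivative g (at s)) = 1) \<and>
     (\<forall>s. g (s + L) = g s)"

definition tensor :: "real^'n \<Rightarrow> real^'m \<Rightarrow> real^('n \<times> 'm)" where
  "tensor x xh = (\<chi> ij. x $ fst ij * xh $ snd ij)"

definition tensor_torus :: "(real \<Rightarrow> real^'n) \<Rightarrow> (real \<Rightarrow> real^'m) \<Rightarrow> real \<times> real \<Rightarrow> real^('n \<times> 'm)" where
  "tensor_torus g gh = (\<lambda>(s, sh). tensor (g s) (gh sh))"

definition pd :: "(real \<times> real \<Rightarrow> 'b::real_normed_vector) \<Rightarrow> real \<times> real \<Rightarrow> real \<times> real \<Rightarrow> 'b" where
  "pd f i p = frechet_derivative f (at p) i"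

abbreviation "e1 \<equiv> ((1::real), (0::real))"
abbreviation "e2 \<equiv> ((0::real), (1::real))"

definition fE :: "(real \<times> real \<Rightarrow> 'b::real_inner) \<Rightarrow> real \<times> real \<Rightarrow> real" where
  "fE x p = pd x e1 p \<bullet> pd x e1 p"
definition fF :: "(real \<times> real \<Rightarrow> 'b::real_inner) \<Rightarrow> real \<times> real \<Rightarrow> real" where
  "fF x p = pd x e1 p \<bullet> pd x e2 p"
definition fG :: "(real \<times> real \<Rightarrow> 'b::real_inner) \<Rightarrow> real \<times> real \<Rightarrow> real" where
  "fG x p = pd x e2 p \<bullet> pd x e2 p"

definition gdet :: "(real \<times> real \<Rightarrow> 'b::real_inner) \<Rightarrow> real \<times> real \<Rightarrow> real" where
  "gdet x p = fE x p * fG x p - (fF x p)\<^sup>2"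

text \<open>Component of a vector v normal to the surface inside the tangent space of the
  sphere at x(p): remove the tangential part (projection on span of x_u, x_v) and the
  radial part (along x(p)).\<close>
definition nproj :: "(real \<times> real \<Rightarrow> 'b::real_inner) \<Rightarrow> real \<times> real \<Rightarrow> 'b \<Rightarrow> 'b" where
  "nproj x p v =
     (let xu = pd x e1 p; xv = pd x e2 p; d = gdet x p;
          a = v \<bullet> xu; b = v \<bullet> xv;
          tang = ((fG x p * a - fF x p * b) / d) *\<^sub>R xu + ((fE x p * b - fF x p * a) / d) *\<^sub>R xv
      in v - tang - (v \<bullet> x p) *\<^sub>R x p)"

text \<open>Mean curvature vector in S^N: H = 1/2 trace of the second fundamental form.\<close>
definition mean_curv :: "(real \<times> real \<Rightarrow> 'b::real_inner) \<Rightarrow> real \<times> real \<Rightarrow> 'b" where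
  "mean_curv x p =
     (let d = gdet x p;
          x11 = pd (pd x e1) e1 p; x12 = pd (pd x e1) e2 p; x22 = pd (pd x e2) e2 p
      in (1/2) *\<^sub>R ((fG x p / d) *\<^sub>R nproj x p x11 - (2 * fF x p / d) *\<^sub>R nproj x p x12
                   + (fE x p / d) *\<^sub>R nproj x p x22))"

definition det3 :: "real \<Rightarrow> real \<Rightarrow> real \<Rightarrow> real \<Rightarrow> real \<Rightarrow> real \<Rightarrow> real \<Rightarrow> real \<Rightarrow> real \<Rightarrow> real" where
  "det3 a b c d e f g h i = a * (e * i - f * h) - b * (d * i - f * g) + c * (d * h - e * g)"

text \<open>Gauss curvature of the induced metric (Brioschi formula).\<close>
definition gauss_curv :: "(real \<times> real \<Rightarrow> 'b::real_inner) \<Rightarrow> real \<times> real \<Rightarrow> real" where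
  "gauss_curv x p =
     (let E = fE x p; F = fF x p; G = fG x p;
          Eu = pd (fE x) e1 p; Ev = pd (fE x) e2 p;
          Fu = pd (fF x) e1 p; Fv = pd (fF x) e2 p;
          Gu = pd (fG x) e1 p; Gv = pd (fG x) e2 p;
          Evv = pd (pd (fE x) e2) e2 p; Fuv = pd (pd (fF x) e1) e2 p;
          Guu = pd (pd (fG x) e1) e1 p
      in (det3 (- Evv/2 + Fuv - Guu/2) (Eu/2) (Fu - Ev/2)
               (Fv - Gu/2) E F
               (Gv/2) F G
          - det3 0 (Ev/2) (Gu/2)
                 (Ev/2) E F
                 (Gu/2) F G) / (E * G - F\<^sup>2)\<^sup>2)"

text \<open>Willmore functional of a closed surface given as a map on R^2 periodic with
  respect to the lattice L Z x Lh Z: integral over a fundamental domain of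
  (|H|^2 - K + 1) dM.\<close>
definition willmore :: "real \<Rightarrow> real \<Rightarrow> (real \<times> real \<Rightarrow> 'b::real_inner) \<Rightarrow> real" where
  "willmore L Lh x =
     integral (cbox (0, 0) (L, Lh))
       (\<lambda>p. ((norm (mean_curv x p))\<^sup>2 - gauss_curv x p + 1) * sqrt (gdet x p))"

definition lattice :: "real \<Rightarrow> real \<Rightarrow> (real \<times> real) set" where
  "lattice L Lh = {(of_int i * L, of_int j * Lh) | i j. True}"

definition variation :: "real \<Rightarrow> real \<Rightarrow> (real \<times> real \<Rightarrow> real^'k) \<Rightarrow> (real \<Rightarrow> real \<times> real \<Rightarrow> real^'k) \<Rightarrow> bool" where
  "variation L Lh x F \<longleftrightarrow>
     smooth (\<lambda>(t, p). F t p) \<and> F 0 = x \<and>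
     (\<forall>t p. norm (F t p) = 1) \<and>
     (\<forall>t p. \<forall>l\<in>lattice L Lh. F t (p + l) = F t p)"

definition willmore_surface :: "real \<Rightarrow> real \<Rightarrow> (real \<times> real \<Rightarrow> real^'k) \<Rightarrow> bool" where
  "willmore_surface L Lh x \<longleftrightarrow>
     (\<forall>F. variation L Lh x F \<longrightarrow>
          ((\<lambda>t. willmore L Lh (F t)) has_real_derivative 0) (at 0))"

definition ejiri :: "real \<times> real \<Rightarrow> real^6" where
  "ejiri = (\<lambda>(s, sh). (1 / sqrt 3) *\<^sub>R vector
     [cos sh * cos (sqrt 3 * s), sin sh * cos (sqrt 3 * s),
      cos sh * sin (sqrt 3 * s), sin sh * sin (sqrt 3 * s),
      sqrt 2 * cos sh, sqrt 2 * sin sh])"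

definition ejiri_lattice :: "(real \<times> real) set" where
  "ejiri_lattice = lattice (2 * pi / sqrt 3) (2 * pi)"

text \<open>phi : R^2 -> R^2 is the lift of a diffeomorphism
  R^2/Lam1 -> R^2/Lam2: smooth local diffeomorphism inducing a bijection of the quotients.\<close>
definition torus_reparam :: "(real \<times> real) set \<Rightarrow> (real \<times> real) set \<Rightarrow> (real \<times> real \<Rightarrow> real \<times> real) \<Rightarrow> bool" where
  "torus_reparam Lam1 Lam2 phi \<longleftrightarrow>
     smooth phi \<and>
     (\<forall>p. bij (frechet_derivative phi (at p))) \<and>
     (\<forall>p q. phi p - phi q \<in> Lam2 \<longleftrightarrow> p - q \<in> Lam1)"

text \<open>y is congruent to the Ejiri torus: up to an isometry of the ambient sphere (with
  the Ejiri torus placed in a totally geodesic S^5, i.e. composed with a linear isometric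
  embedding R^6 -> R^(N+1)) and a reparametrization of the torus.\<close>
definition congruent_to_ejiri :: "real \<Rightarrow> real \<Rightarrow> (real \<times> real \<Rightarrow> real^'k) \<Rightarrow> bool" where
  "congruent_to_ejiri L Lh y \<longleftrightarrow>
     (\<exists>(T :: real^6 \<Rightarrow> real^'k) phi.
        linear T \<and> (\<forall>v. norm (T v) = norm v) \<and>
        torus_reparam (lattice L Lh) ejiri_lattice phi \<and>
        (\<forall>p. y p = T (ejiri (phi p))))"

end

theory Submission
  imports Defs
begin

text \<open>
  Write \<open>w = \<gamma>'' + \<gamma>\<close> for the curvature vector of a spherical unit speed curve, so \<open>k\<^sub>1\<^sup>2 = |w|\<^sup>2\<close>.
  The torus \<open>\<gamma> \<otimes> \<gamma>h\<close> is flat and isometrically parametrised, with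
  \<open>W = \<integral>\<integral> 1 + (k\<^sub>1\<^sup>2 + kh\<^sub>1\<^sup>2) / 4\<close>.
  Testing the Willmore condition with the normal fields \<open>\<psi>(sh) w \<otimes> \<gamma>h\<close>, for \<open>\<psi> = 1\<close> and
  \<open>\<psi> = kh\<^sub>1\<^sup>2\<close>, and with their mirror images shows that if neither curve is a geodesic, then the mean values
  \<open>a, b\<close> of \<open>k\<^sub>1\<^sup>2, kh\<^sub>1\<^sup>2\<close> satisfy \<open>a \<ge> 2 + b\<close> and \<open>b \<ge> 2 + a\<close>, which is absurd.
  So one factor, say \<open>\<gamma>h\<close>, is a great circle and \<open>W = Lh (L + (\<integral>k\<^sub>1\<^sup>2) / 4)\<close>.
  Wirtinger's inequality for \<open>\<gamma>'\<close> gives \<open>L (L + \<integral>k\<^sub>1\<^sup>2) \<ge> 4\<pi>\<^sup>2\<close>, and the bound follows from the AM-GM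
  inequality. Equality forces equality in Wirtinger's inequality, hence \<open>\<gamma>''' = - 3 \<gamma>'\<close>, which integrates to the
  circle of the Ejiri torus. Conversely, a reparametrisation carrying the torus to the Ejiri
  torus is an isometry of the plane, hence affine, so that both tori have the same area and the same \<open>|H|\<close>.
\<close>

section \<open>Smooth functions\<close>

text \<open>The test fields are the two summands of twice the mean curvature vector, w \<otimes>
  \<gamma>h and \<gamma> \<otimes> wh, weighted by a function of the other variable. They keep the
  coordinates orthogonal to first order, so no mixed term enters the first variation, and every
  integral over the torus splits into products of one-variable integrals. The tests with 1 and with
  the squared curvature of the other curve share one elastic integral; eliminating it shows that
  each squared curvature has equality in Cauchy-Schwarz with its mean. This evaluates the
  fourth-power integral in the estimate of the elastic term, and the gaps of 2 follow without an
  Euler-Lagrange equation. The technical obstacle is that criticality concerns W along genuine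
  variations inside the sphere, where the integrand contains quotients, a square root and second
  derivatives of the metric. Expansions in t with an error that is quadratic uniformly on the period
  box replace differentiation under the integral. In the final constant, 2\<pi> bounds the length of
  the great circle from below, and \<pi> \<open>sqrt 3\<close> bounds the factor that belongs to the
  other curve.\<close>

lemma Ck_SucI:
  assumes "\<And>x. (f has_derivative f' x) (at x)" "\<And>i. i \<in> Basis \<Longrightarrow> Ck k (\<lambda>x. f' x i)"
  shows "Ck (Suc k) f"
proof -
  have "frechet_derivative f (at x) = f' x" for x
    using frechet_derivative_at[OF assms(1)] by simp
  then show ?thesis
    using assms by (auto simp: differentiable_def)
qed

lemma Ck_Suc_has_derivative:
  "Ck (Suc k) f \<Longrightarrow> (f has_derivative frechet_derivative f (at x)) (at x)"
  by (simp add: frechet_derivative_works)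

lemma Ck_Suc_partial:
  "Ck (Suc k) f \<Longrightarrow> i \<in> Basis \<Longrightarrow> Ck k (\<lambda>x. frechet_derivative f (at x) i)"
  by simp

lemma Ck_SucD: "Ck (Suc k) f \<Longrightarrow> Ck k f"
proof (induction k arbitrary: f)
  case 0
  then show ?case
    by (auto intro!: differentiable_imp_continuous_on simp: differentiable_on_def differentiable_at_withinI)
next
  case (Suc k)
  then show ?case by (metis Ck.simps(2))
qed

lemma smooth_has_derivative:
  "smooth f \<Longrightarrow> (f has_derivative frechet_derivative f (at x)) (at x)"
  unfolding smooth_def using Ck_Suc_has_derivative by blast

lemma smooth_partial: "smooth f \<Longrightarrow> i \<in> Basis \<Longrightarrow> smooth (\<lambda>x. frechet_derivative f (at x) i)"
  unfolding smooth_def using Ck_Suc_partial by blast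

lemma smooth_continuous_on: "smooth f \<Longrightarrow> continuous_on S f"
  unfolding smooth_def by (metis Ck.simps(1) continuous_on_subset top_greatest)

lemma smoothI:
  assumes "\<And>x. (f has_derivative f' x) (at x)" "\<And>i. i \<in> Basis \<Longrightarrow> smooth (\<lambda>x. f' x i)"
  shows "smooth f"
  unfolding smooth_def
proof
  fix k show "Ck k f"
    using Ck_SucD Ck_SucI[OF assms(1)] assms(2) unfolding smooth_def by blast
qed

lemma Ck_const: "Ck k (\<lambda>x. c)"
proof (induction k arbitrary: c)
  case (Suc k)
  show ?case by (rule Ck_SucI[where f'="\<lambda>_ _. 0"]) (auto simp: Suc)
qed auto

lemma smooth_const [simp]: "smooth (\<lambda>x. c)"
  by (simp add: smooth_def Ck_const)

lemma Ck_add: "Ck k f \<Longrightarrow> Ck k g \<Longrightarrow> Ck k (\<lambda>x. f x + g x)"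
proof (induction k arbitrary: f g)
  case (Suc k)
  show ?case
    by (rule Ck_SucI[OF has_derivative_add[OF Ck_Suc_has_derivative[OF Suc.prems(1)]
            Ck_Suc_has_derivative[OF Suc.prems(2)]]])
       (intro Suc.IH Ck_Suc_partial Suc.prems)
qed (auto intro: continuous_intros)

lemma smooth_add: "smooth f \<Longrightarrow> smooth g \<Longrightarrow> smooth (\<lambda>x. f x + g x)"
  by (simp add: smooth_def Ck_add)

lemma (in bounded_bilinear) Ck_prod: "Ck k f \<Longrightarrow> Ck k g \<Longrightarrow> Ck k (\<lambda>x. prod (f x) (g x))"
proof (induction k arbitrary: f g)
  case 0
  then show ?case by (auto intro: continuous_on)
next
  case (Suc k)
  show ?case
    by (rule Ck_SucI[OF FDERIV[OF Ck_Suc_has_derivative[OF Suc.prems(1)]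
            Ck_Suc_has_derivative[OF Suc.prems(2)]]])
       (intro Ck_add Suc.IH Ck_Suc_partial Suc.prems Ck_SucD[OF Suc.prems(1)] Ck_SucD[OF Suc.prems(2)])
qed

lemma (in bounded_bilinear) smooth_prod: "smooth f \<Longrightarrow> smooth g \<Longrightarrow> smooth (\<lambda>x. prod (f x) (g x))"
  by (simp add: smooth_def Ck_prod)

lemmas smooth_scaleR = bounded_bilinear.smooth_prod[OF bounded_bilinear_scaleR]
lemmas smooth_mult = bounded_bilinear.smooth_prod[OF bounded_bilinear_mult]
lemmas smooth_inner = bounded_bilinear.smooth_prod[OF bounded_bilinear_inner]

lemma smooth_diff:
  assumes "smooth f" "smooth g" shows "smooth (\<lambda>x. f x - g x)"
  using smooth_add[OF assms(1) smooth_scaleR[OF smooth_const[of "-1"] assms(2)]] by simp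

lemma (in bounded_linear) Ck_image: "Ck k g \<Longrightarrow> Ck k (\<lambda>x. f (g x))"
proof (induction k arbitrary: g)
  case 0
  then show ?case by (auto intro: continuous_on)
next
  case (Suc k)
  show ?case
    by (rule Ck_SucI[OF has_derivative[OF Ck_Suc_has_derivative[OF Suc.prems]]])
       (intro Suc.IH Ck_Suc_partial Suc.prems)
qed

lemma (in bounded_linear) smooth_image: "smooth g \<Longrightarrow> smooth (\<lambda>x. f (g x))"
  by (simp add: smooth_def Ck_image)

text \<open>A map that only permutes or deletes coordinates sends each partial derivative of the
  composite to a partial derivative of \<open>f\<close> composed with \<open>l\<close>, or to zero.
  The induction therefore closes without a chain rule for general inner maps; projections and the
  exchange of the two variables are covered.\<close>

lemma Ck_compose_coordinate:
  assumes l: "bounded_linear l" and b: "l ` Basis \<subseteq> insert 0 Basis"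
  shows "Ck k f \<Longrightarrow> Ck k (\<lambda>x. f (l x))"
proof (induction k arbitrary: f)
  case 0
  then show ?case
    using continuous_on_compose2[of UNIV f UNIV l] linear_continuous_on[OF l] by auto
next
  case (Suc k)
  have d: "((\<lambda>x. f (l x)) has_derivative (\<lambda>v. frechet_derivative f (at (l x)) (l v))) (at x)" for x
    using diff_chain_at[OF bounded_linear_imp_has_derivative[OF l] Ck_Suc_has_derivative[OF Suc.prems]]
    by (simp add: o_def)
  show ?case
  proof (rule Ck_SucI[OF d])
    fix i :: 'a assume "i \<in> Basis"
    then consider "l i = 0" | "l i \<in> Basis" using b by blast
    then show "Ck k (\<lambda>x. frechet_derivative f (at (l x)) (l i))"
    proof cases
      case 1
      have "frechet_derivative f (at (l x)) 0 = 0" for x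
        using has_derivative_bounded_linear[OF Ck_Suc_has_derivative[OF Suc.prems]] linear_simps(3) by blast
      then show ?thesis by (simp add: 1 Ck_const)
    next
      case 2
      then show ?thesis using Suc.IH[OF Ck_Suc_partial[OF Suc.prems]] by blast
    qed
  qed
qed

lemma smooth_compose_coordinate:
  assumes "bounded_linear l" "l ` Basis \<subseteq> insert 0 Basis" "smooth f"
  shows "smooth (\<lambda>x. f (l x))"
  using assms(3) unfolding smooth_def by (auto intro: Ck_compose_coordinate[OF assms(1,2)])

lemma smooth_compose_fst: "smooth f \<Longrightarrow> smooth (\<lambda>x::'a::euclidean_space \<times> 'b::euclidean_space. f (fst x))"
  by (rule smooth_compose_coordinate) (auto simp: Basis_prod_def bounded_linear_fst)

lemma smooth_compose_snd: "smooth f \<Longrightarrow> smooth (\<lambda>x::'a::euclidean_space \<times> 'b::euclidean_space. f (snd x))"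
  by (rule smooth_compose_coordinate) (auto simp: Basis_prod_def bounded_linear_snd)

lemma smooth_id [simp]: "smooth (\<lambda>x. x)"
  by (rule smoothI[where f'="\<lambda>x v. v"]) auto

text \<open>The derivative of \<open>inverse f\<close> contains only \<open>inverse f\<close> and
  the derivative of \<open>f\<close>, so the induction hypothesis on \<open>inverse f\<close>
  supplies the next order.\<close>

lemma Ck_inverse:
  fixes f :: "'a::euclidean_space \<Rightarrow> real"
  assumes "\<And>x. f x \<noteq> 0"
  shows "Ck k f \<Longrightarrow> Ck k (\<lambda>x. inverse (f x))"
proof (induction k)
  case 0
  then show ?case using assms by (auto intro!: continuous_intros)
next
  case (Suc k)
  have d: "((\<lambda>x. inverse (f x)) has_derivative
      (\<lambda>v. (- 1) * (inverse (f x) * frechet_derivative f (at x) v * inverse (f x)))) (at x)" for x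
    using Deriv.has_derivative_inverse[OF assms Ck_Suc_has_derivative[OF Suc.prems]] by simp
  show ?case
    by (rule Ck_SucI[OF d])
       (intro bounded_bilinear.Ck_prod[OF bounded_bilinear_mult] Ck_const Suc.IH Ck_SucD[OF Suc.prems]
         Ck_Suc_partial[OF Suc.prems])
qed

lemma smooth_divide:
  fixes f h :: "'a::euclidean_space \<Rightarrow> real"
  assumes "smooth f" "smooth h" "\<And>x. h x \<noteq> 0"
  shows "smooth (\<lambda>x. f x / h x)"
  unfolding divide_inverse
  using assms by (intro smooth_mult) (simp_all add: smooth_def Ck_inverse)

lemma smooth_swap: "smooth (\<lambda>p::real \<times> real. (snd p, fst p))"
  by (rule smooth_compose_coordinate[where f="\<lambda>x. x"])
     (auto simp: Basis_prod_def intro!: bounded_linear_Pair bounded_linear_fst bounded_linear_snd)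

lemmas smooth_intros = smooth_const smooth_id smooth_add smooth_diff smooth_mult smooth_scaleR smooth_inner
  smooth_divide

section \<open>Expansions to first order\<close>

lemma e1_in_Basis [simp]: "e1 \<in> Basis" and e2_in_Basis [simp]: "e2 \<in> Basis"
  by (simp_all add: Basis_prod_def)

lemma pd_eqI: "(f has_derivative f') (at p) \<Longrightarrow> pd f e p = f' e"
  unfolding pd_def by (simp add: frechet_derivative_at[symmetric])

lemma smooth_pd: "smooth f \<Longrightarrow> e \<in> Basis \<Longrightarrow> smooth (pd f e)"
  using smooth_partial[of f e] unfolding pd_def[abs_def] by simp

lemma (in bounded_bilinear) pd_prod:
  assumes "smooth f" "smooth g"
  shows "pd (\<lambda>p. prod (f p) (g p)) e p = prod (f p) (pd g e p) + prod (pd f e p) (g p)"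
  by (rule pd_eqI[OF FDERIV[OF smooth_has_derivative[OF assms(1)] smooth_has_derivative[OF assms(2)]],
      folded pd_def])

text \<open>The remainder is smooth jointly in \<open>(t, p)\<close>, so the expansion may be
  differentiated in \<open>p\<close>, which a mere bound on the error would not allow. All
  derivatives of the variation and of its metric coefficients are taken at this level.\<close>

definition smooth_jet ::
  "(real \<Rightarrow> real \<times> real \<Rightarrow> 'b::real_normed_vector) \<Rightarrow> (real \<times> real \<Rightarrow> 'b) \<Rightarrow> (real \<times> real \<Rightarrow> 'b) \<Rightarrow> bool"
  where "smooth_jet f f0 f1 \<longleftrightarrow> smooth f0 \<and> smooth f1 \<and>
     (\<exists>R. smooth R \<and> (\<forall>t p. f t p = f0 p + t *\<^sub>R f1 p + t\<^sup>2 *\<^sub>R R (t, p)))"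

lemma smooth_jet_pd:
  assumes "smooth_jet f f0 f1" "e \<in> Basis"
  shows "smooth_jet (\<lambda>t. pd (f t) e) (pd f0 e) (pd f1 e)"
proof -
  obtain R where R: "smooth R" and f: "\<And>t p. f t p = f0 p + t *\<^sub>R f1 p + t\<^sup>2 *\<^sub>R R (t, p)"
    and s: "smooth f0" "smooth f1"
    using assms unfolding smooth_jet_def by auto
  let ?DR = "\<lambda>q. frechet_derivative R (at q) (0, e)"
  have "smooth ?DR"
    using smooth_partial[OF R] assms(2) by (simp add: Basis_prod_def)
  moreover have "pd (f t) e p = pd f0 e p + t *\<^sub>R pd f1 e p + t\<^sup>2 *\<^sub>R ?DR (t, p)" for t p
  proof -
    have "((\<lambda>p. (t, p)) has_derivative (\<lambda>v. (0, v))) (at p)"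
      by (auto intro!: derivative_eq_intros)
    from diff_chain_at[OF this smooth_has_derivative[OF R]]
    have "((\<lambda>p. R (t, p)) has_derivative (\<lambda>v. frechet_derivative R (at (t, p)) (0, v))) (at p)"
      by (simp add: o_def)
    then have "((\<lambda>p. f0 p + t *\<^sub>R f1 p + t\<^sup>2 *\<^sub>R R (t, p)) has_derivative
      (\<lambda>v. frechet_derivative f0 (at p) v + t *\<^sub>R frechet_derivative f1 (at p) v
           + t\<^sup>2 *\<^sub>R frechet_derivative R (at (t, p)) (0, v))) (at p)"
      by (intro has_derivative_add has_derivative_scaleR_right smooth_has_derivative s)
    moreover have "f t = (\<lambda>p. f0 p + t *\<^sub>R f1 p + t\<^sup>2 *\<^sub>R R (t, p))"
      by (auto simp: f)
    ultimately show ?thesis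
      by (simp add: pd_eqI) (simp add: pd_def)
  qed
  ultimately show ?thesis
    unfolding smooth_jet_def using smooth_pd s assms(2) by blast
qed

lemma smooth_jet_inner:
  fixes f h :: "real \<Rightarrow> real \<times> real \<Rightarrow> 'b::real_inner"
  assumes "smooth_jet f f0 f1" "smooth_jet h h0 h1"
  shows "smooth_jet (\<lambda>t p. f t p \<bullet> h t p) (\<lambda>p. f0 p \<bullet> h0 p) (\<lambda>p. f0 p \<bullet> h1 p + f1 p \<bullet> h0 p)"
proof -
  obtain R where R: "smooth R" and f: "\<And>t p. f t p = f0 p + t *\<^sub>R f1 p + t\<^sup>2 *\<^sub>R R (t, p)"
    and s: "smooth f0" "smooth f1"
    using assms unfolding smooth_jet_def by auto
  obtain R' where R': "smooth R'" and h: "\<And>t p. h t p = h0 p + t *\<^sub>R h1 p + t\<^sup>2 *\<^sub>R R' (t, p)"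
    and s': "smooth h0" "smooth h1"
    using assms unfolding smooth_jet_def by auto
  let ?Q = "\<lambda>q. f0 (snd q) \<bullet> R' q + f1 (snd q) \<bullet> h1 (snd q) + R q \<bullet> h0 (snd q)
     + fst q * (f1 (snd q) \<bullet> R' q + R q \<bullet> h1 (snd q)) + fst q * fst q * (R q \<bullet> R' q)"
  have "smooth ?Q"
    by (intro smooth_intros R R' smooth_compose_snd s s' smooth_compose_fst)
  moreover have "f t p \<bullet> h t p = f0 p \<bullet> h0 p + t *\<^sub>R (f0 p \<bullet> h1 p + f1 p \<bullet> h0 p) + t\<^sup>2 *\<^sub>R ?Q (t, p)" for t p
    by (simp add: f h inner_add_left inner_add_right algebra_simps power2_eq_square)
  moreover have "smooth (\<lambda>p. f0 p \<bullet> h0 p)" "smooth (\<lambda>p. f0 p \<bullet> h1 p + f1 p \<bullet> h0 p)"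
    by (intro smooth_inner smooth_add s s')+
  ultimately show ?thesis
    unfolding smooth_jet_def by (intro conjI exI[of _ ?Q]) blast+
qed

text \<open>The weaker notion for use once no derivative in \<open>p\<close> is needed any more: it
  survives quotients and roots, which are controlled only for small \<open>t\<close>. The filter
  \<open>nhds 0\<close> includes \<open>t = 0\<close>, so \<open>f 0 = f0\<close> on
  \<open>S\<close>.\<close>

definition first_order ::
  "(real \<times> real) set \<Rightarrow> (real \<Rightarrow> real \<times> real \<Rightarrow> 'b::real_normed_vector) \<Rightarrow> (real \<times> real \<Rightarrow> 'b) \<Rightarrow> (real \<times> real \<Rightarrow> 'b) \<Rightarrow> bool"
  where "first_order S f f0 f1 \<longleftrightarrow> compact S \<and> continuous_on S f0 \<and> continuous_on S f1 \<and>
     (\<exists>C. \<forall>\<^sub>F t in nhds 0. continuous_on S (f t) \<and> (\<forall>p\<in>S. norm (f t p - f0 p - t *\<^sub>R f1 p) \<le> C * t\<^sup>2))"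

lemma compact_bound:
  assumes "compact S" "continuous_on S (f :: _ \<Rightarrow> 'b::real_normed_vector)"
  obtains M where "M > 0" "\<And>p. p \<in> S \<Longrightarrow> norm (f p) \<le> M"
  using compact_imp_bounded[OF compact_continuous_image[OF assms(2,1)]]
  by (auto simp: bounded_pos)

lemma eventually_abs_less: "e > 0 \<Longrightarrow> \<forall>\<^sub>F t in nhds (0::real). \<bar>t\<bar> < e"
  unfolding eventually_nhds_metric by auto

lemma first_order_cong:
  assumes "first_order S f f0 f1" "\<And>p. p \<in> S \<Longrightarrow> f0 p = g0 p" "\<And>p. p \<in> S \<Longrightarrow> f1 p = g1 p"
    and "\<And>t p. g t p = f t p"
  shows "first_order S g g0 g1"
proof -
  have "g = f" using assms(4) by blast
  moreover have "continuous_on S f0 = continuous_on S g0" "continuous_on S f1 = continuous_on S g1"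
    using assms(2,3) by (auto intro: continuous_on_cong)
  ultimately show ?thesis
    using assms(1-3) unfolding first_order_def by simp
qed

lemma smooth_jet_first_order:
  assumes "smooth_jet f f0 f1" "compact S"
  shows "first_order S f f0 f1"
proof -
  obtain R where R: "smooth R" and f: "\<And>t p. f t p = f0 p + t *\<^sub>R f1 p + t\<^sup>2 *\<^sub>R R (t, p)"
    and s: "smooth f0" "smooth f1"
    using assms unfolding smooth_jet_def by auto
  have f': "f t = (\<lambda>p. f0 p + t *\<^sub>R f1 p + t\<^sup>2 *\<^sub>R R (t, p))" for t
    by (auto simp: f)
  have c: "continuous_on S (f t)" for t
    unfolding f'
    by (intro continuous_intros smooth_continuous_on[OF s(1)] smooth_continuous_on[OF s(2)]
        continuous_on_compose2[OF smooth_continuous_on[OF R, of UNIV]] subset_UNIV)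
  obtain M where M: "\<And>q. q \<in> {-1..1} \<times> S \<Longrightarrow> norm (R q) \<le> M"
    using compact_bound[OF compact_Times[OF compact_Icc assms(2)] smooth_continuous_on[OF R]] by metis
  have "\<forall>\<^sub>F t in nhds 0. continuous_on S (f t) \<and> (\<forall>p\<in>S. norm (f t p - f0 p - t *\<^sub>R f1 p) \<le> M * t\<^sup>2)"
    using eventually_abs_less[of 1, simplified]
  proof eventually_elim
    case (elim t)
    then have "norm (R (t, p)) * t\<^sup>2 \<le> M * t\<^sup>2" if "p \<in> S" for p
      using M[of "(t, p)"] that by (intro mult_right_mono) (auto simp: abs_less_iff)
    with c show ?case by (auto simp: f mult.commute)
  qed
  then show ?thesis
    unfolding first_order_def using assms(2) s by (auto intro: smooth_continuous_on)
qed

lemma first_order_const: "compact S \<Longrightarrow> first_order S (\<lambda>t p. c) (\<lambda>p. c) (\<lambda>p. 0)"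
  unfolding first_order_def by (auto intro!: exI[of _ 0])

lemma first_order_add:
  assumes "first_order S f f0 f1" "first_order S h h0 h1"
  shows "first_order S (\<lambda>t p. f t p + h t p) (\<lambda>p. f0 p + h0 p) (\<lambda>p. f1 p + h1 p)"
proof -
  obtain C C' where
    1: "\<forall>\<^sub>F t in nhds 0. continuous_on S (f t) \<and> (\<forall>p\<in>S. norm (f t p - f0 p - t *\<^sub>R f1 p) \<le> C * t\<^sup>2)" and
    2: "\<forall>\<^sub>F t in nhds 0. continuous_on S (h t) \<and> (\<forall>p\<in>S. norm (h t p - h0 p - t *\<^sub>R h1 p) \<le> C' * t\<^sup>2)"
    using assms unfolding first_order_def by blast
  have "\<forall>\<^sub>F t in nhds 0. continuous_on S (\<lambda>p. f t p + h t p) \<and>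
     (\<forall>p\<in>S. norm (f t p + h t p - (f0 p + h0 p) - t *\<^sub>R (f1 p + h1 p)) \<le> (C + C') * t\<^sup>2)"
    using 1 2
  proof eventually_elim
    case (elim t)
    have "norm (f t p + h t p - (f0 p + h0 p) - t *\<^sub>R (f1 p + h1 p)) \<le> (C + C') * t\<^sup>2" if "p \<in> S" for p
    proof -
      have "f t p + h t p - (f0 p + h0 p) - t *\<^sub>R (f1 p + h1 p)
        = (f t p - f0 p - t *\<^sub>R f1 p) + (h t p - h0 p - t *\<^sub>R h1 p)" by (simp add: algebra_simps)
      then show ?thesis
        unfolding distrib_right[of C] using elim that by (metis norm_triangle_mono)
    qed
    with elim show ?case by (auto intro: continuous_on_add)
  qed
  with assms show ?thesis unfolding first_order_def by (auto intro!: continuous_on_add)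
qed

lemma (in bounded_bilinear) first_order_prod:
  assumes "first_order S f f0 f1" "first_order S h h0 h1"
  shows "first_order S (\<lambda>t p. prod (f t p) (h t p)) (\<lambda>p. prod (f0 p) (h0 p))
    (\<lambda>p. prod (f0 p) (h1 p) + prod (f1 p) (h0 p))"
proof -
  have S: "compact S" and cf: "continuous_on S f0" "continuous_on S f1"
    and ch: "continuous_on S h0" "continuous_on S h1"
    using assms unfolding first_order_def by blast+
  obtain C C' where
    1: "\<forall>\<^sub>F t in nhds 0. continuous_on S (f t) \<and> (\<forall>p\<in>S. norm (f t p - f0 p - t *\<^sub>R f1 p) \<le> C * t\<^sup>2)" and
    2: "\<forall>\<^sub>F t in nhds 0. continuous_on S (h t) \<and> (\<forall>p\<in>S. norm (h t p - h0 p - t *\<^sub>R h1 p) \<le> C' * t\<^sup>2)"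
    using assms unfolding first_order_def by blast
  obtain K where K: "K > 0" "\<And>a b. norm (prod a b) \<le> norm a * norm b * K" using pos_bounded by blast
  obtain A0 where A0: "A0 > 0" "\<And>p. p \<in> S \<Longrightarrow> norm (f0 p) \<le> A0" using compact_bound[OF S cf(1)] by blast
  obtain A1 where A1: "A1 > 0" "\<And>p. p \<in> S \<Longrightarrow> norm (f1 p) \<le> A1" using compact_bound[OF S cf(2)] by blast
  obtain B0 where B0: "B0 > 0" "\<And>p. p \<in> S \<Longrightarrow> norm (h0 p) \<le> B0" using compact_bound[OF S ch(1)] by blast
  obtain B1 where B1: "B1 > 0" "\<And>p. p \<in> S \<Longrightarrow> norm (h1 p) \<le> B1" using compact_bound[OF S ch(2)] by blast
  \<comment> \<open>The error of the product consists of three pieces: the first-order part of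
    \<open>f\<close> times the error of \<open>h\<close>, the quadratic term in \<open>f1\<close>
    and \<open>h1\<close>, and the error of \<open>f\<close> times all of \<open>h\<close>. Since
    \<open>\<bar>t\<bar> < 1\<close>, the remaining factors have bounds independent of
    \<open>t\<close>.\<close>
  let ?D = "(A0 + A1) * \<bar>C'\<bar> * K + A1 * B1 * K + \<bar>C\<bar> * (B0 + B1 + \<bar>C'\<bar>) * K"
  have "\<forall>\<^sub>F t in nhds 0. continuous_on S (\<lambda>p. prod (f t p) (h t p)) \<and>
     (\<forall>p\<in>S. norm (prod (f t p) (h t p) - prod (f0 p) (h0 p) - t *\<^sub>R (prod (f0 p) (h1 p) + prod (f1 p) (h0 p))) \<le> ?D * t\<^sup>2)"
    using 1 2 eventually_abs_less[of 1, simplified]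
  proof eventually_elim
    case (elim t)
    have "norm (prod (f t p) (h t p) - prod (f0 p) (h0 p) - t *\<^sub>R (prod (f0 p) (h1 p) + prod (f1 p) (h0 p))) \<le> ?D * t\<^sup>2"
      if p: "p \<in> S" for p
    proof -
      define r where "r = f t p - f0 p - t *\<^sub>R f1 p"
      define r' where "r' = h t p - h0 p - t *\<^sub>R h1 p"
      have t: "\<bar>t\<bar> \<le> 1" "t\<^sup>2 \<le> 1" using elim(3) by (simp_all add: abs_square_le_1)
      have "norm r \<le> C * t\<^sup>2" "norm r' \<le> C' * t\<^sup>2" using elim p by (auto simp: r_def r'_def)
      then have r: "norm r \<le> \<bar>C\<bar> * t\<^sup>2" and r': "norm r' \<le> \<bar>C'\<bar> * t\<^sup>2"
        by (meson abs_ge_self mult_right_mono order_trans zero_le_power2)+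
      have f: "f t p = f0 p + t *\<^sub>R f1 p + r" and h: "h t p = h0 p + t *\<^sub>R h1 p + r'"
        by (simp_all add: r_def r'_def)
      have r'1: "norm r' \<le> \<bar>C'\<bar>"
        using r' t(2) by (meson abs_ge_zero mult_left_le order_trans)
      have a: "norm (f0 p + t *\<^sub>R f1 p) \<le> A0 + A1"
      proof -
        have "\<bar>t\<bar> * norm (f1 p) \<le> 1 * A1" using t A1(2)[OF p] by (intro mult_mono) auto
        then show ?thesis using norm_triangle_mono[OF A0(2)[OF p], of "t *\<^sub>R f1 p" A1] by simp
      qed
      have b: "norm (h t p) \<le> B0 + B1 + \<bar>C'\<bar>"
      proof -
        have "\<bar>t\<bar> * norm (h1 p) \<le> 1 * B1" using t B1(2)[OF p] by (intro mult_mono) auto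
        then show ?thesis
          using norm_triangle_mono[OF norm_triangle_mono[OF B0(2)[OF p], of "t *\<^sub>R h1 p" B1] r'1] by (simp add: h)
      qed
      have e: "prod (f t p) (h t p) - prod (f0 p) (h0 p) - t *\<^sub>R (prod (f0 p) (h1 p) + prod (f1 p) (h0 p))
        = prod (f0 p + t *\<^sub>R f1 p) r' + t\<^sup>2 *\<^sub>R prod (f1 p) (h1 p) + prod r (h t p)"
        unfolding f h
        by (simp add: add_left add_right scaleR_left scaleR_right algebra_simps power2_eq_square)
      have "norm (prod (f0 p + t *\<^sub>R f1 p) r') \<le> (A0 + A1) * (\<bar>C'\<bar> * t\<^sup>2) * K"
        using order_trans[OF K(2) mult_right_mono[OF mult_mono[OF a r']]] A0(1) A1(1) K(1) by simp
      moreover have "norm (t\<^sup>2 *\<^sub>R prod (f1 p) (h1 p)) \<le> t\<^sup>2 * (A1 * B1 * K)"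
        using order_trans[OF K(2) mult_right_mono[OF mult_mono[OF A1(2)[OF p] B1(2)[OF p]]]] A1(1) K(1)
        by (simp add: mult_left_mono)
      moreover have "norm (prod r (h t p)) \<le> (\<bar>C\<bar> * t\<^sup>2) * (B0 + B1 + \<bar>C'\<bar>) * K"
        using order_trans[OF K(2) mult_right_mono[OF mult_mono[OF r b]]] K(1) by simp
      ultimately have "norm (prod (f0 p + t *\<^sub>R f1 p) r' + t\<^sup>2 *\<^sub>R prod (f1 p) (h1 p) + prod r (h t p))
        \<le> (A0 + A1) * (\<bar>C'\<bar> * t\<^sup>2) * K + t\<^sup>2 * (A1 * B1 * K) + (\<bar>C\<bar> * t\<^sup>2) * (B0 + B1 + \<bar>C'\<bar>) * K"
        by (intro norm_triangle_mono)
      then show ?thesis unfolding e by (simp add: algebra_simps)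
    qed
    with elim show ?case by (auto intro: continuous_on)
  qed
  with S cf ch show ?thesis
    unfolding first_order_def by (auto intro!: continuous_on_add continuous_on)
qed

lemmas first_order_scaleR = bounded_bilinear.first_order_prod[OF bounded_bilinear_scaleR]
lemmas first_order_mult = bounded_bilinear.first_order_prod[OF bounded_bilinear_mult]
lemmas first_order_inner = bounded_bilinear.first_order_prod[OF bounded_bilinear_inner]

lemma first_order_cmult:
  assumes "first_order S f f0 f1" shows "first_order S (\<lambda>t p. c *\<^sub>R f t p) (\<lambda>p. c *\<^sub>R f0 p) (\<lambda>p. c *\<^sub>R f1 p)"
proof -
  have "compact S" using assms unfolding first_order_def by blast
  from first_order_scaleR[OF first_order_const[OF this, of c] assms] show ?thesis by simp
qed

lemma first_order_diff:
  assumes "first_order S f f0 f1" "first_order S h h0 h1"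
  shows "first_order S (\<lambda>t p. f t p - h t p) (\<lambda>p. f0 p - h0 p) (\<lambda>p. f1 p - h1 p)"
  using first_order_add[OF assms(1) first_order_cmult[OF assms(2), of "-1"]] by simp

lemma first_order_inverse:
  fixes d :: "real \<Rightarrow> real \<times> real \<Rightarrow> real"
  assumes "first_order S d (\<lambda>p. 1) d1"
  shows "first_order S (\<lambda>t p. inverse (d t p)) (\<lambda>p. 1) (\<lambda>p. - d1 p)"
proof -
  have S: "compact S" and c1: "continuous_on S d1" using assms unfolding first_order_def by blast+
  obtain C where
    1: "\<forall>\<^sub>F t in nhds 0. continuous_on S (d t) \<and> (\<forall>p\<in>S. norm (d t p - 1 - t *\<^sub>R d1 p) \<le> C * t\<^sup>2)"
    using assms unfolding first_order_def by blast
  obtain M where M: "M > 0" "\<And>p. p \<in> S \<Longrightarrow> norm (d1 p) \<le> M" using compact_bound[OF S c1] by blast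
  \<comment> \<open>Below this threshold \<open>d t p\<close> differs from 1 by at most 1/2, so the
    denominators stay at least 1/2.\<close>
  have pos: "1 / (2 * (M + \<bar>C\<bar> + 1)) > 0" using M(1) by simp
  have "\<forall>\<^sub>F t in nhds 0. continuous_on S (\<lambda>p. inverse (d t p)) \<and>
      (\<forall>p\<in>S. norm (inverse (d t p) - 1 - t *\<^sub>R (- d1 p)) \<le> (2 * (M * M + \<bar>C\<bar> * (1 + M))) * t\<^sup>2)"
    using 1 eventually_abs_less[of 1, simplified] eventually_abs_less[OF pos]
  proof eventually_elim
    case (elim t)
    have *: "d t p \<ge> 1 / 2 \<and> norm (inverse (d t p) - 1 - t *\<^sub>R (- d1 p)) \<le> (2 * (M * M + \<bar>C\<bar> * (1 + M))) * t\<^sup>2"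
      if p: "p \<in> S" for p
    proof -
      define r where "r = d t p - 1 - t * d1 p"
      have d: "d t p = 1 + t * d1 p + r" by (simp add: r_def)
      have "\<bar>r\<bar> \<le> C * t\<^sup>2" using elim(1) p by (auto simp: r_def)
      then have r: "\<bar>r\<bar> \<le> \<bar>C\<bar> * t\<^sup>2" by (meson abs_ge_self mult_right_mono order_trans zero_le_power2)
      have tt: "t\<^sup>2 \<le> \<bar>t\<bar>" using elim(2) by (metis abs_ge_zero abs_mult_self_eq less_eq_real_def mult_left_le power2_eq_square)
      have td: "\<bar>t * d1 p\<bar> \<le> \<bar>t\<bar> * M" using M(2)[OF p] by (simp add: abs_mult mult_left_mono)
      have "\<bar>C\<bar> * t\<^sup>2 \<le> \<bar>C\<bar> * \<bar>t\<bar>" using tt by (intro mult_left_mono) auto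
      moreover have "\<bar>t\<bar> * M + \<bar>C\<bar> * \<bar>t\<bar> + \<bar>t\<bar> \<le> 1/2" using elim(3) M(1) by (simp add: field_simps)
      ultimately have "\<bar>t * d1 p + r\<bar> \<le> 1/2" using r td by linarith
      then have dh: "d t p \<ge> 1/2" using d by linarith
      have e: "inverse (d t p) - 1 - t *\<^sub>R (- d1 p) = (t\<^sup>2 * (d1 p * d1 p) - r * (1 - t * d1 p)) / d t p"
        using dh unfolding d by (simp add: field_simps power2_eq_square)
      have tdM: "\<bar>t * d1 p\<bar> \<le> M" using td elim(2) M(1) by (meson less_eq_real_def mult_left_le_one_le order_trans abs_ge_zero)
      have "\<bar>t\<^sup>2 * (d1 p * d1 p) - r * (1 - t * d1 p)\<bar> \<le> \<bar>t\<^sup>2 * (d1 p * d1 p)\<bar> + \<bar>r\<bar> * \<bar>1 - t * d1 p\<bar>"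
        by (metis abs_mult abs_triangle_ineq4)
      also have "\<dots> \<le> t\<^sup>2 * (M * M) + (\<bar>C\<bar> * t\<^sup>2) * (1 + M)"
      proof (intro add_mono)
        show "\<bar>t\<^sup>2 * (d1 p * d1 p)\<bar> \<le> t\<^sup>2 * (M * M)"
          using mult_mono[OF M(2)[OF p] M(2)[OF p]] M(1) by (simp add: abs_mult mult_left_mono)
        show "\<bar>r\<bar> * \<bar>1 - t * d1 p\<bar> \<le> \<bar>C\<bar> * t\<^sup>2 * (1 + M)"
          using r tdM by (intro mult_mono) auto
      qed
      finally have n: "\<bar>t\<^sup>2 * (d1 p * d1 p) - r * (1 - t * d1 p)\<bar> \<le> t\<^sup>2 * (M * M) + (\<bar>C\<bar> * t\<^sup>2) * (1 + M)" .
      have "norm (inverse (d t p) - 1 - t *\<^sub>R (- d1 p)) = \<bar>t\<^sup>2 * (d1 p * d1 p) - r * (1 - t * d1 p)\<bar> / d t p"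
        unfolding e using dh by (simp add: abs_divide)
      also have "\<dots> \<le> (t\<^sup>2 * (M * M) + (\<bar>C\<bar> * t\<^sup>2) * (1 + M)) / (1/2)"
        using n dh by (intro frac_le) auto
      finally show ?thesis using dh by (simp add: algebra_simps)
    qed
    then have "continuous_on S (\<lambda>p. inverse (d t p))"
      using elim(1) by (intro continuous_on_inverse) force+
    with * show ?case by auto
  qed
  with S c1 show ?thesis
    unfolding first_order_def by (auto intro!: continuous_on_minus)
qed

lemma first_order_sqrt:
  fixes d :: "real \<Rightarrow> real \<times> real \<Rightarrow> real"
  assumes "first_order S d (\<lambda>p. 1) d1"
  shows "first_order S (\<lambda>t p. sqrt (d t p)) (\<lambda>p. 1) (\<lambda>p. d1 p / 2)"
proof -
  have S: "compact S" and c1: "continuous_on S d1" using assms unfolding first_order_def by blast+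
  obtain C where
    1: "\<forall>\<^sub>F t in nhds 0. continuous_on S (d t) \<and> (\<forall>p\<in>S. norm (d t p - 1 - t *\<^sub>R d1 p) \<le> C * t\<^sup>2)"
    using assms unfolding first_order_def by blast
  obtain M where M: "M > 0" "\<And>p. p \<in> S \<Longrightarrow> norm (d1 p) \<le> M" using compact_bound[OF S c1] by blast
  have pos: "1 / (2 * (M + \<bar>C\<bar> + 1)) > 0" using M(1) by simp
  have "\<forall>\<^sub>F t in nhds 0. continuous_on S (\<lambda>p. sqrt (d t p)) \<and>
      (\<forall>p\<in>S. norm (sqrt (d t p) - 1 - t *\<^sub>R (d1 p / 2)) \<le> (2 * (\<bar>C\<bar> + M * M)) * t\<^sup>2)"
    using 1 eventually_abs_less[of 1, simplified] eventually_abs_less[OF pos]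
  proof eventually_elim
    case (elim t)
    have *: "norm (sqrt (d t p) - 1 - t *\<^sub>R (d1 p / 2)) \<le> (2 * (\<bar>C\<bar> + M * M)) * t\<^sup>2"
      if p: "p \<in> S" for p
    proof -
      define r where "r = d t p - 1 - t * d1 p"
      define a where "a = t * d1 p / 2"
      have d: "d t p = 1 + t * d1 p + r" by (simp add: r_def)
      have "\<bar>r\<bar> \<le> C * t\<^sup>2" using elim(1) p by (auto simp: r_def)
      then have r: "\<bar>r\<bar> \<le> \<bar>C\<bar> * t\<^sup>2" by (meson abs_ge_self mult_right_mono order_trans zero_le_power2)
      have tt: "t\<^sup>2 \<le> \<bar>t\<bar>" using elim(2) by (metis abs_ge_zero abs_mult_self_eq less_eq_real_def mult_left_le power2_eq_square)
      have td: "\<bar>t * d1 p\<bar> \<le> \<bar>t\<bar> * M" using M(2)[OF p] by (simp add: abs_mult mult_left_mono)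
      have "\<bar>C\<bar> * t\<^sup>2 \<le> \<bar>C\<bar> * \<bar>t\<bar>" using tt by (intro mult_left_mono) auto
      moreover have "\<bar>t\<bar> * M + \<bar>C\<bar> * \<bar>t\<bar> + \<bar>t\<bar> \<le> 1/2" using elim(3) M(1) by (simp add: field_simps)
      moreover have "0 \<le> \<bar>C\<bar> * \<bar>t\<bar>" by simp
      ultimately have "\<bar>t * d1 p + r\<bar> \<le> 1/2" "\<bar>t * d1 p\<bar> \<le> 1/2"
        using r td by linarith+
      then have dh: "d t p \<ge> 1/2" and ah: "1 + a \<ge> 1/2" using d unfolding a_def by linarith+
      define u where "u = sqrt (d t p)"
      have u: "u \<ge> 0" "u * u = d t p" using dh by (auto simp: u_def)
      \<comment> \<open>Multiplying by the conjugate turns the error of the root into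
        \<open>r - a * a\<close>, which is quadratic in \<open>t\<close>; the conjugate factor is at
        least 1/2.\<close>
      have "(u - (1 + a)) * (u + (1 + a)) = u * u - (1 + a) * (1 + a)"
        by (simp add: algebra_simps)
      also have "\<dots> = r - a * a"
        by (simp add: u(2) d a_def algebra_simps)
      finally have "\<bar>u - (1 + a)\<bar> * (u + (1 + a)) = \<bar>r - a * a\<bar>"
        using u(1) ah by (metis abs_mult abs_of_nonneg add_nonneg_nonneg order_trans zero_le_divide_1_iff zero_le_numeral)
      moreover have "\<bar>u - (1 + a)\<bar> * (1/2) \<le> \<bar>u - (1 + a)\<bar> * (u + (1 + a))"
        using u(1) ah by (intro mult_left_mono) auto
      moreover have "\<bar>r - a * a\<bar> \<le> \<bar>C\<bar> * t\<^sup>2 + M * M * t\<^sup>2"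
      proof -
        have "\<bar>a\<bar> \<le> \<bar>t\<bar> * M" using td by (simp add: a_def)
        then have "\<bar>a * a\<bar> \<le> (\<bar>t\<bar> * M) * (\<bar>t\<bar> * M)" unfolding abs_mult by (intro mult_mono) auto
        also have "\<dots> = M * M * t\<^sup>2" by (simp add: power2_eq_square)
        finally show ?thesis using r by linarith
      qed
      ultimately show ?thesis by (simp add: u_def a_def algebra_simps)
    qed
    have "continuous_on S (\<lambda>p. sqrt (d t p))"
      using elim(1) by (intro continuous_on_real_sqrt) auto
    with * show ?case by auto
  qed
  with S c1 show ?thesis
    unfolding first_order_def by (auto intro!: continuous_intros)
qed

text \<open>The difference quotient misses the integral of \<open>J1\<close> by at most
  \<open>\<bar>t\<bar>\<close> times a constant times the area of the box, because the error of the
  expansion is uniform.\<close>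

lemma first_order_integral:
  fixes J :: "real \<Rightarrow> real \<times> real \<Rightarrow> real"
  assumes "first_order (cbox a b) J J0 J1"
  shows "((\<lambda>t. integral (cbox a b) (J t)) has_real_derivative integral (cbox a b) J1) (at 0)"
proof -
  let ?S = "cbox a b"
  have c: "continuous_on ?S J0" "continuous_on ?S J1" using assms unfolding first_order_def by blast+
  obtain C where C: "\<forall>\<^sub>F t in nhds 0. continuous_on ?S (J t) \<and> (\<forall>p\<in>?S. norm (J t p - J0 p - t *\<^sub>R J1 p) \<le> C * t\<^sup>2)"
    using assms unfolding first_order_def by blast
  \<comment> \<open>At \<open>t = 0\<close> the error bound is zero, which identifies
    \<open>J 0\<close> with \<open>J0\<close>.\<close>
  from eventually_nhds_x_imp_x[OF C] have "J 0 p = J0 p" if "p \<in> ?S" for p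
    using that by auto
  then have J0: "integral ?S (J 0) = integral ?S J0"
    by (intro integral_cong) auto
  have key: "norm ((integral ?S (J t) - integral ?S (J 0)) / t - integral ?S J1) \<le> norm t * (\<bar>C\<bar> * measure lborel ?S)"
    if t: "t \<noteq> 0" and ct: "continuous_on ?S (J t)" and *: "\<forall>p\<in>?S. norm (J t p - J0 p - t *\<^sub>R J1 p) \<le> C * t\<^sup>2"
    for t
  proof -
    note int = integrable_continuous[OF ct] integrable_continuous[OF c(1)] integrable_continuous[OF c(2)]
    have "integral ?S (\<lambda>p. J t p - J0 p - t *\<^sub>R J1 p) = integral ?S (J t) - integral ?S (J 0) - t * integral ?S J1"
      using int by (simp add: integral_diff integrable_diff integrable_on_mult_right J0)
    moreover have "norm (integral ?S (\<lambda>p. J t p - J0 p - t *\<^sub>R J1 p)) \<le> (\<bar>C\<bar> * t\<^sup>2) * measure lborel ?S"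
    proof (rule has_integral_bound)
      show "((\<lambda>p. J t p - J0 p - t *\<^sub>R J1 p) has_integral integral ?S (\<lambda>p. J t p - J0 p - t *\<^sub>R J1 p)) ?S"
        using int by (intro integrable_integral integrable_diff integrable_cmul)
      show "norm (J t p - J0 p - t *\<^sub>R J1 p) \<le> \<bar>C\<bar> * t\<^sup>2" if "p \<in> ?S" for p
        using * t that by (meson abs_ge_self mult_right_mono order_trans zero_le_power2)
    qed simp
    ultimately have "\<bar>integral ?S (J t) - integral ?S (J 0) - t * integral ?S J1\<bar> \<le> (\<bar>C\<bar> * (\<bar>t\<bar> * \<bar>t\<bar>)) * measure lborel ?S"
      by (simp add: power2_eq_square)
    moreover have "(integral ?S (J t) - integral ?S (J 0)) / t - integral ?S J1
      = (integral ?S (J t) - integral ?S (J 0) - t * integral ?S J1) / t"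
      using t by (simp add: field_simps)
    ultimately show ?thesis
      using t by (simp add: pos_divide_le_eq abs_divide mult_ac del: abs_mult_self_eq)
  qed
  have "\<forall>\<^sub>F t in at 0. norm ((integral ?S (J t) - integral ?S (J 0)) / t - integral ?S J1) \<le> norm t * (\<bar>C\<bar> * measure lborel ?S)"
    unfolding eventually_at_filter using C by eventually_elim (use key in blast)
  then have "((\<lambda>t. (integral ?S (J t) - integral ?S (J 0)) / t - integral ?S J1) \<longlongrightarrow> 0) (at 0)"
    by (rule tendsto_0_le[where f="\<lambda>t. t" and F="at 0", rotated]) (auto intro: tendsto_eq_intros)
  then show ?thesis
    unfolding has_field_derivative_iff by (simp add: LIM_zero_iff)
qed

section \<open>First variation of the Willmore functional\<close>

lemma pd_const [simp]: "pd (\<lambda>p. c) e = (\<lambda>p. 0)"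
  by (rule ext) (rule pd_eqI[OF has_derivative_const])

text \<open>The variation is inverse stereographic projection from \<open>- x p\<close>, applied to
  the point \<open>x p + t V p\<close> of the tangent space at \<open>x p\<close>. It has unit norm
  since \<open>(1 - a)^2 + 4 a = (1 + a)^2\<close>, and being rational with positive denominator it
  is visibly smooth, without normalising by a root.\<close>

lemma normal_variation:
  fixes x V :: "real \<times> real \<Rightarrow> real^'k"
  assumes x: "smooth x" and V: "smooth V" and unit: "\<And>p. norm (x p) = 1" and perp: "\<And>p. V p \<bullet> x p = 0"
    and px: "\<And>p l. l \<in> lattice L Lh \<Longrightarrow> x (p + l) = x p"
    and pV: "\<And>p l. l \<in> lattice L Lh \<Longrightarrow> V (p + l) = V p"
  obtains F where "variation L Lh x F" "smooth_jet F x V"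
proof
  define a where "a = (\<lambda>t p. t\<^sup>2 * (V p \<bullet> V p) / 4)"
  define F where "F = (\<lambda>t p. ((1 - a t p) / (1 + a t p)) *\<^sub>R x p + (t / (1 + a t p)) *\<^sub>R V p)"
  have a: "1 + a t p > 0" for t p
    using inner_ge_zero[of "V p"] unfolding a_def by (smt (verit) divide_nonneg_nonneg mult_nonneg_nonneg zero_le_power2)
  have sa: "smooth (\<lambda>z. a (fst z) (snd z))"
    unfolding a_def power2_eq_square
    by (intro smooth_divide smooth_mult smooth_inner smooth_const smooth_compose_fst[OF smooth_id]
        smooth_compose_snd[OF V]) auto
  have nz: "1 + a (fst z) (snd z) \<noteq> 0" for z using a by (metis less_irrefl)
  have "smooth (\<lambda>z. F (fst z) (snd z))"
    unfolding F_def
    by (intro smooth_add smooth_scaleR smooth_divide smooth_diff smooth_const sa nz smooth_compose_fst[OF smooth_id]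
        smooth_compose_snd[OF V] smooth_compose_snd[OF x])
  moreover have "F 0 = x" by (auto simp: F_def a_def)
  moreover have "norm (F t p) = 1" for t p
  proof -
    have xx: "x p \<bullet> x p = 1" using unit[of p] by (simp add: norm_eq_sqrt_inner)
    have xV: "x p \<bullet> V p = 0" using perp by (simp add: inner_commute)
    define b where "b = 1 + a t p"
    have b: "b \<noteq> 0" using a[of t p] by (simp add: b_def)
    have "F t p \<bullet> F t p = ((1 - a t p) / b)\<^sup>2 + (t / b)\<^sup>2 * (V p \<bullet> V p)"
      unfolding F_def b_def[symmetric] by (simp add: inner_add_left inner_add_right xx perp xV power2_eq_square)
    also have "\<dots> = ((1 - a t p)\<^sup>2 + t\<^sup>2 * (V p \<bullet> V p)) / b\<^sup>2"
      using b by (simp add: power_divide add_divide_distrib)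
    also have "t\<^sup>2 * (V p \<bullet> V p) = 4 * a t p" by (simp add: a_def)
    also have "(1 - a t p)\<^sup>2 + 4 * a t p = b\<^sup>2"
      by (simp add: b_def power2_eq_square algebra_simps)
    finally show ?thesis using b by (simp add: norm_eq_sqrt_inner)
  qed
  moreover have "F t (p + l) = F t p" if "l \<in> lattice L Lh" for t p l
    using px[OF that] pV[OF that] by (simp add: F_def a_def)
  ultimately show "variation L Lh x F"
    unfolding variation_def by (auto simp: case_prod_beta')
  \<comment> \<open>Obtained from \<open>(1 - a) / (1 + a) = 1 - 2 a / (1 + a)\<close> and
    \<open>t / (1 + a) = t - t a / (1 + a)\<close>, where \<open>a\<close> carries a factor
    \<open>t^2\<close>.\<close>
  let ?R = "\<lambda>z. (- (V (snd z) \<bullet> V (snd z)) / 4 / (1 + a (fst z) (snd z))) *\<^sub>R (2 *\<^sub>R x (snd z) + fst z *\<^sub>R V (snd z))"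
  have "smooth (\<lambda>z. (0 - (V (snd z) \<bullet> V (snd z))) / 4 / (1 + a (fst z) (snd z)))"
    by (intro smooth_divide smooth_diff smooth_inner smooth_add smooth_const sa nz smooth_compose_snd[OF V]) auto
  then have "smooth ?R"
    by (intro smooth_add smooth_scaleR smooth_const smooth_compose_fst[OF smooth_id]
        smooth_compose_snd[OF V] smooth_compose_snd[OF x]) auto
  moreover have "F t p = x p + t *\<^sub>R V p + t\<^sup>2 *\<^sub>R ?R (t, p)" for t p
  proof -
    define b where "b = 1 + a t p"
    have b: "b \<noteq> 0" using a[of t p] by (simp add: b_def)
    have ab: "a t p = b - 1" by (simp add: b_def)
    have q: "t\<^sup>2 * (- (V p \<bullet> V p) / 4 / b) = - (a t p) / b" by (simp add: a_def)
    have 1: "(1 - a t p) / b = 1 + 2 * (- (a t p) / b)" using b by (simp add: ab field_simps)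
    have 2: "t / b = t + t * (- (a t p) / b)" using b by (simp add: ab field_simps)
    show ?thesis
      unfolding F_def b_def[symmetric] 1 2 fst_conv snd_conv scaleR_add_right scaleR_scaleR q[symmetric] 
      by (simp add: algebra_simps)
  qed
  ultimately show "smooth_jet F x V"
    unfolding smooth_jet_def using x V by blast
qed

text \<open>At \<open>t = 0\<close> the Gram matrix is the identity, and its off-diagonal entry has
  no first-order term, so every product with \<open>fF\<close> drops out. The terms
  \<open>G1 - d1\<close> and \<open>E1 - d1\<close> come from the quotients of \<open>fG\<close> and
  \<open>fE\<close> by the determinant.\<close>

lemma first_order_nproj:
  fixes F :: "real \<Rightarrow> real \<times> real \<Rightarrow> 'b::real_inner"
  assumes x: "first_order S F x0 V" and x1: "first_order S (\<lambda>t. pd (F t) e1) x1 V1"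
    and x2: "first_order S (\<lambda>t. pd (F t) e2) x2 V2"
    and E: "first_order S (\<lambda>t. fE (F t)) (\<lambda>p. 1) E1" and G: "first_order S (\<lambda>t. fG (F t)) (\<lambda>p. 1) G1"
    and F: "first_order S (\<lambda>t. fF (F t)) (\<lambda>p. 0) (\<lambda>p. 0)" and d: "first_order S (\<lambda>t. gdet (F t)) (\<lambda>p. 1) d1"
    and v: "first_order S v v0 v1"
  shows "first_order S (\<lambda>t p. nproj (F t) p (v t p))
    (\<lambda>p. v0 p - ((v0 p \<bullet> x1 p) *\<^sub>R x1 p + (v0 p \<bullet> x2 p) *\<^sub>R x2 p) - (v0 p \<bullet> x0 p) *\<^sub>R x0 p)
    (\<lambda>p. v1 p - ((v0 p \<bullet> x1 p) *\<^sub>R V1 p + (v0 p \<bullet> V1 p + v1 p \<bullet> x1 p + (G1 p - d1 p) * (v0 p \<bullet> x1 p)) *\<^sub>R x1 p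
        + ((v0 p \<bullet> x2 p) *\<^sub>R V2 p + (v0 p \<bullet> V2 p + v1 p \<bullet> x2 p + (E1 p - d1 p) * (v0 p \<bullet> x2 p)) *\<^sub>R x2 p))
        - ((v0 p \<bullet> x0 p) *\<^sub>R V p + (v0 p \<bullet> V p + v1 p \<bullet> x0 p) *\<^sub>R x0 p))"
proof -
  note a = first_order_inner[OF v x1] and b = first_order_inner[OF v x2]
  note i = first_order_inverse[OF d]
  note ca = first_order_mult[OF first_order_diff[OF first_order_mult[OF G a] first_order_mult[OF F b]] i]
  note cb = first_order_mult[OF first_order_diff[OF first_order_mult[OF E b] first_order_mult[OF F a]] i]
  note all = first_order_diff[OF first_order_diff[OF v first_order_add[OF first_order_scaleR[OF ca x1] first_order_scaleR[OF cb x2]]]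
     first_order_scaleR[OF first_order_inner[OF v x] x]]
  show ?thesis
    by (rule first_order_cong[OF all]) (simp_all add: nproj_def Let_def divide_inverse algebra_simps)
qed

text \<open>The mixed second derivatives disappear because their coefficient vanishes to first
  order. The conditions \<open>o11\<close> and \<open>o22\<close> make the normal parts of the pure
  second derivatives equal to \<open>x11 + x0\<close> and \<open>x22 + x0\<close>. The last three
  lines of the result are tangential or radial, hence orthogonal to the mean curvature
  vector.\<close>

lemma first_order_mean_curv:
  fixes F :: "real \<Rightarrow> real \<times> real \<Rightarrow> 'b::real_inner"
  assumes x: "first_order S F x0 V" and x1: "first_order S (\<lambda>t. pd (F t) e1) x1 V1"
    and x2: "first_order S (\<lambda>t. pd (F t) e2) x2 V2"
    and E: "first_order S (\<lambda>t. fE (F t)) (\<lambda>p. 1) E1" and G: "first_order S (\<lambda>t. fG (F t)) (\<lambda>p. 1) G1"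
    and F: "first_order S (\<lambda>t. fF (F t)) (\<lambda>p. 0) (\<lambda>p. 0)" and d: "first_order S (\<lambda>t. gdet (F t)) (\<lambda>p. 1) d1"
    and d1: "\<And>p. d1 p = E1 p + G1 p"
    and x11: "first_order S (\<lambda>t. pd (pd (F t) e1) e1) x11 V11"
    and x12: "first_order S (\<lambda>t. pd (pd (F t) e1) e2) x12 V12"
    and x22: "first_order S (\<lambda>t. pd (pd (F t) e2) e2) x22 V22"
    and o11: "\<And>p. x11 p \<bullet> x1 p = 0" "\<And>p. x11 p \<bullet> x2 p = 0" "\<And>p. x11 p \<bullet> x0 p = -1"
    and o22: "\<And>p. x22 p \<bullet> x1 p = 0" "\<And>p. x22 p \<bullet> x2 p = 0" "\<And>p. x22 p \<bullet> x0 p = -1"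
  shows "first_order S (\<lambda>t. mean_curv (F t)) (\<lambda>p. (1/2) *\<^sub>R (x11 p + x22 p + 2 *\<^sub>R x0 p))
    (\<lambda>p. (1/2) *\<^sub>R (V11 p + V22 p + 2 *\<^sub>R V p - E1 p *\<^sub>R (x11 p + x0 p) - G1 p *\<^sub>R (x22 p + x0 p)
       - (x11 p \<bullet> V1 p + V11 p \<bullet> x1 p + x22 p \<bullet> V1 p + V22 p \<bullet> x1 p) *\<^sub>R x1 p
       - (x11 p \<bullet> V2 p + V11 p \<bullet> x2 p + x22 p \<bullet> V2 p + V22 p \<bullet> x2 p) *\<^sub>R x2 p
       - (x11 p \<bullet> V p + V11 p \<bullet> x0 p + x22 p \<bullet> V p + V22 p \<bullet> x0 p) *\<^sub>R x0 p))"
proof -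
  have n11: "first_order S (\<lambda>t p. nproj (F t) p (pd (pd (F t) e1) e1 p)) (\<lambda>p. x11 p + x0 p)
    (\<lambda>p. V11 p + V p - (x11 p \<bullet> V1 p + V11 p \<bullet> x1 p) *\<^sub>R x1 p - (x11 p \<bullet> V2 p + V11 p \<bullet> x2 p) *\<^sub>R x2 p
       - (x11 p \<bullet> V p + V11 p \<bullet> x0 p) *\<^sub>R x0 p)"
    by (rule first_order_cong[OF first_order_nproj[OF x x1 x2 E G F d x11]]) (simp_all add: o11)
  have n22: "first_order S (\<lambda>t p. nproj (F t) p (pd (pd (F t) e2) e2 p)) (\<lambda>p. x22 p + x0 p)
    (\<lambda>p. V22 p + V p - (x22 p \<bullet> V1 p + V22 p \<bullet> x1 p) *\<^sub>R x1 p - (x22 p \<bullet> V2 p + V22 p \<bullet> x2 p) *\<^sub>R x2 p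
       - (x22 p \<bullet> V p + V22 p \<bullet> x0 p) *\<^sub>R x0 p)"
    by (rule first_order_cong[OF first_order_nproj[OF x x1 x2 E G F d x22]]) (simp_all add: o22)
  note n12 = first_order_nproj[OF x x1 x2 E G F d x12]
  note i = first_order_inverse[OF d]
  have G': "first_order S (\<lambda>t p. fG (F t) p / gdet (F t) p) (\<lambda>p. 1) (\<lambda>p. - E1 p)"
    by (rule first_order_cong[OF first_order_mult[OF G i]]) (simp_all add: d1 divide_inverse)
  have E': "first_order S (\<lambda>t p. fE (F t) p / gdet (F t) p) (\<lambda>p. 1) (\<lambda>p. - G1 p)"
    by (rule first_order_cong[OF first_order_mult[OF E i]]) (simp_all add: d1 divide_inverse)
  have F': "first_order S (\<lambda>t p. 2 * fF (F t) p / gdet (F t) p) (\<lambda>p. 0) (\<lambda>p. 0)"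
    by (rule first_order_cong[OF first_order_cmult[OF first_order_mult[OF F i], where c=2]]) (simp_all add: divide_inverse)
  show ?thesis
    by (rule first_order_cong[OF first_order_cmult[OF first_order_add[OF first_order_diff[OF
          first_order_scaleR[OF G' n11] first_order_scaleR[OF F' n12]] first_order_scaleR[OF E' n22]], where c="1/2"]])
       (simp_all add: mean_curv_def Let_def algebra_simps scaleR_2)
qed

text \<open>Linearising the Brioschi formula at the flat metric: a product of two derivatives of
  metric coefficients is of second order, so only the pure second derivatives survive.\<close>

lemma first_order_gauss_curv:
  fixes F :: "real \<Rightarrow> real \<times> real \<Rightarrow> 'b::real_inner"
  assumes E: "smooth_jet (\<lambda>t. fE (F t)) (\<lambda>p. 1) E1" and G: "smooth_jet (\<lambda>t. fG (F t)) (\<lambda>p. 1) G1"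
    and F: "smooth_jet (\<lambda>t. fF (F t)) (\<lambda>p. 0) (\<lambda>p. 0)" and S: "compact S"
  shows "first_order S (\<lambda>t. gauss_curv (F t)) (\<lambda>p. 0)
    (\<lambda>p. - (1/2) * pd (pd E1 e2) e2 p - (1/2) * pd (pd G1 e1) e1 p)"
proof -
  note fo = smooth_jet_first_order[OF _ S]
  note E0 = fo[OF E] and G0 = fo[OF G] and F0 = fo[OF F]
  note Eu = first_order_cmult[OF fo[OF smooth_jet_pd[OF E e1_in_Basis]], where c="1/2", unfolded pd_const]
  note Ev = first_order_cmult[OF fo[OF smooth_jet_pd[OF E e2_in_Basis]], where c="1/2", unfolded pd_const]
  note Gu = first_order_cmult[OF fo[OF smooth_jet_pd[OF G e1_in_Basis]], where c="1/2", unfolded pd_const]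
  note Gv = first_order_cmult[OF fo[OF smooth_jet_pd[OF G e2_in_Basis]], where c="1/2", unfolded pd_const]
  note Fu = fo[OF smooth_jet_pd[OF F e1_in_Basis], unfolded pd_const]
  note Fv = fo[OF smooth_jet_pd[OF F e2_in_Basis], unfolded pd_const]
  note Evv = first_order_cmult[OF fo[OF smooth_jet_pd[OF smooth_jet_pd[OF E e2_in_Basis] e2_in_Basis]], where c="- 1/2", unfolded pd_const]
  note Guu = first_order_cmult[OF fo[OF smooth_jet_pd[OF smooth_jet_pd[OF G e1_in_Basis] e1_in_Basis]], where c="1/2", unfolded pd_const]
  note Fuv = fo[OF smooth_jet_pd[OF smooth_jet_pd[OF F e1_in_Basis] e2_in_Basis], unfolded pd_const]
  \<comment> \<open>Everything in the first row and first column vanishes at \<open>t = 0\<close>,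
    so to first order only the corner entry \<open>A\<close> contributes, multiplied by a minor
    equal to 1 at \<open>t = 0\<close>.\<close>
  have det3: "first_order S (\<lambda>t p. det3 (A t p) (B t p) (C t p) (D t p) (E t p) (F t p) (G t p) (H t p) (I t p))
    (\<lambda>p. 0) A1"
    if "first_order S A (\<lambda>p. 0) A1" "first_order S B (\<lambda>p. 0) B1" "first_order S C (\<lambda>p. 0) C1"
      "first_order S D (\<lambda>p. 0) D1" "first_order S E (\<lambda>p. 1) E1" "first_order S F (\<lambda>p. 0) (\<lambda>p. 0)"
      "first_order S G (\<lambda>p. 0) G1" "first_order S H (\<lambda>p. 0) (\<lambda>p. 0)" "first_order S I (\<lambda>p. 1) I1"
    for A B C D E F G H I A1 B1 C1 D1 E1 G1 I1
    by (rule first_order_cong[OF first_order_add[OF first_order_diff[OF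
            first_order_mult[OF that(1) first_order_diff[OF first_order_mult[OF that(5,9)] first_order_mult[OF that(6,8)]]]
            first_order_mult[OF that(2) first_order_diff[OF first_order_mult[OF that(4,9)] first_order_mult[OF that(6,7)]]]]
            first_order_mult[OF that(3) first_order_diff[OF first_order_mult[OF that(4,8)] first_order_mult[OF that(5,7)]]]]])
       (simp_all add: det3_def)
  have z: "first_order S (\<lambda>t p. 0::real) (\<lambda>p. 0) (\<lambda>p. 0)" by (rule first_order_const[OF S])
  have c0: "first_order S f (\<lambda>p. 0) f1" if "first_order S f f0 f1" "\<And>p. f0 p = 0" for f f0 f1
    by (rule first_order_cong[OF that(1)]) (simp_all add: that(2))
  have A: "first_order S (\<lambda>t p. (- 1/2) *\<^sub>R pd (pd (fE (F t)) e2) e2 p + pd (pd (fF (F t)) e1) e2 p - (1/2) *\<^sub>R pd (pd (fG (F t)) e1) e1 p)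
     (\<lambda>p. 0) (\<lambda>p. - (1/2) * pd (pd E1 e2) e2 p - (1/2) * pd (pd G1 e1) e1 p)"
    by (rule first_order_cong[OF first_order_diff[OF first_order_add[OF Evv Fuv] Guu]]) auto
  have d1: "first_order S (\<lambda>t p. det3 ((- 1/2) *\<^sub>R pd (pd (fE (F t)) e2) e2 p + pd (pd (fF (F t)) e1) e2 p - (1/2) *\<^sub>R pd (pd (fG (F t)) e1) e1 p)
     ((1/2) *\<^sub>R pd (fE (F t)) e1 p) (pd (fF (F t)) e1 p - (1/2) *\<^sub>R pd (fE (F t)) e2 p)
     (pd (fF (F t)) e2 p - (1/2) *\<^sub>R pd (fG (F t)) e1 p) (fE (F t) p) (fF (F t) p)
     ((1/2) *\<^sub>R pd (fG (F t)) e2 p) (fF (F t) p) (fG (F t) p))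
     (\<lambda>p. 0) (\<lambda>p. - (1/2) * pd (pd E1 e2) e2 p - (1/2) * pd (pd G1 e1) e1 p)"
    by (rule det3[OF A c0[OF Eu] c0[OF first_order_diff[OF Fu Ev]] c0[OF first_order_diff[OF Fv Gu]] E0 F0 c0[OF Gv] F0 G0]) auto
  have d2: "first_order S (\<lambda>t p. det3 0 ((1/2) *\<^sub>R pd (fE (F t)) e2 p) ((1/2) *\<^sub>R pd (fG (F t)) e1 p)
     ((1/2) *\<^sub>R pd (fE (F t)) e2 p) (fE (F t) p) (fF (F t) p)
     ((1/2) *\<^sub>R pd (fG (F t)) e1 p) (fF (F t) p) (fG (F t) p)) (\<lambda>p. 0) (\<lambda>p. 0)"
    by (rule det3[OF z c0[OF Ev] c0[OF Gu] c0[OF Ev] E0 F0 c0[OF Gu] F0 G0]) auto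
  have "first_order S (\<lambda>t p. fE (F t) p * fG (F t) p - fF (F t) p * fF (F t) p) (\<lambda>p. 1) (\<lambda>p. E1 p + G1 p)"
    by (rule first_order_cong[OF first_order_diff[OF first_order_mult[OF E0 G0] first_order_mult[OF F0 F0]]]) simp_all
  note d = first_order_inverse[OF this]
  have q: "a / (b * b) = a * inverse b * inverse b" for a b :: real by (simp add: divide_inverse)
  show ?thesis
    by (rule first_order_cong[OF first_order_mult[OF first_order_mult[OF first_order_diff[OF d1 d2] d] d]])
       (simp_all add: gauss_curv_def Let_def q power2_eq_square)
qed

text \<open>Here \<open>N\<close> is twice the mean curvature vector, and \<open>E1\<close>,
  \<open>G1\<close> are the first-order terms of the metric coefficients. The integrand collects the
  variations of the squared mean curvature, of minus the Gauss curvature and, in the last summand,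
  of the area element. The condition \<open>F1\<close> says that the coordinates stay orthogonal to
  first order.\<close>

lemma first_variation_willmore:
  fixes x V :: "real \<times> real \<Rightarrow> real^'k"
  assumes W: "willmore_surface L Lh x"
    and x: "smooth x" and V: "smooth V" and unit: "\<And>p. norm (x p) = 1" and perp: "\<And>p. V p \<bullet> x p = 0"
    and px: "\<And>p l. l \<in> lattice L Lh \<Longrightarrow> x (p + l) = x p"
    and pV: "\<And>p l. l \<in> lattice L Lh \<Longrightarrow> V (p + l) = V p"
    and E: "\<And>p. pd x e1 p \<bullet> pd x e1 p = 1" and F: "\<And>p. pd x e1 p \<bullet> pd x e2 p = 0" and G: "\<And>p. pd x e2 p \<bullet> pd x e2 p = 1"
    and ox: "\<And>p. pd x e1 p \<bullet> x p = 0" "\<And>p. pd x e2 p \<bullet> x p = 0"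
    and o11: "\<And>p. pd (pd x e1) e1 p \<bullet> pd x e1 p = 0" "\<And>p. pd (pd x e1) e1 p \<bullet> pd x e2 p = 0" "\<And>p. pd (pd x e1) e1 p \<bullet> x p = -1"
    and o22: "\<And>p. pd (pd x e2) e2 p \<bullet> pd x e1 p = 0" "\<And>p. pd (pd x e2) e2 p \<bullet> pd x e2 p = 0" "\<And>p. pd (pd x e2) e2 p \<bullet> x p = -1"
    and F1: "\<And>p. pd x e1 p \<bullet> pd V e2 p + pd V e1 p \<bullet> pd x e2 p = 0"
    and N_def: "\<And>p. N p = pd (pd x e1) e1 p + pd (pd x e2) e2 p + 2 *\<^sub>R x p"
    and E1_def: "\<And>p. E1 p = 2 * (pd x e1 p \<bullet> pd V e1 p)"
    and G1_def: "\<And>p. G1 p = 2 * (pd x e2 p \<bullet> pd V e2 p)"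
  shows "integral (cbox (0, 0) (L, Lh)) (\<lambda>p.
      (1/2) * (N p \<bullet> (pd (pd V e1) e1 p + pd (pd V e2) e2 p + 2 *\<^sub>R V p)
         - E1 p * (N p \<bullet> pd (pd x e1) e1 p) - G1 p * (N p \<bullet> pd (pd x e2) e2 p))
      + (1/2) * pd (pd E1 e2) e2 p + (1/2) * pd (pd G1 e1) e1 p
      + (1/2) * (E1 p + G1 p) * ((1/4) * (N p \<bullet> N p) + 1)) = 0"
    (is "integral ?S ?J = 0")
proof -
  obtain \<Phi> where var: "variation L Lh x \<Phi>" and jx: "smooth_jet \<Phi> x V"
    using normal_variation[OF x V unit perp px pV] by blast
  have S: "compact ?S" by simp
  note fo = smooth_jet_first_order[OF _ S]
  note j1 = smooth_jet_pd[OF jx e1_in_Basis] and j2 = smooth_jet_pd[OF jx e2_in_Basis]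
  note j11 = smooth_jet_pd[OF j1 e1_in_Basis] and j12 = smooth_jet_pd[OF j1 e2_in_Basis]
    and j22 = smooth_jet_pd[OF j2 e2_in_Basis]
  have jE: "smooth_jet (\<lambda>t. fE (\<Phi> t)) (\<lambda>p. 1) E1"
    using smooth_jet_inner[OF j1 j1] unfolding E by (simp add: fE_def[abs_def] E1_def[abs_def] inner_commute)
  have jG: "smooth_jet (\<lambda>t. fG (\<Phi> t)) (\<lambda>p. 1) G1"
    using smooth_jet_inner[OF j2 j2] unfolding G by (simp add: fG_def[abs_def] G1_def[abs_def] inner_commute)
  have jF: "smooth_jet (\<lambda>t. fF (\<Phi> t)) (\<lambda>p. 0) (\<lambda>p. 0)"
    using smooth_jet_inner[OF j1 j2] unfolding F F1 by (simp add: fF_def[abs_def])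
  note E' = fo[OF jE] and G' = fo[OF jG] and F' = fo[OF jF]
  have d: "first_order ?S (\<lambda>t. gdet (\<Phi> t)) (\<lambda>p. 1) (\<lambda>p. E1 p + G1 p)"
    by (rule first_order_cong[OF first_order_diff[OF first_order_mult[OF E' G'] first_order_mult[OF F' F']]])
       (simp_all add: gdet_def power2_eq_square)
  note H = first_order_mean_curv[OF fo[OF jx] fo[OF j1] fo[OF j2] E' G' F' d refl fo[OF j11] fo[OF j12] fo[OF j22] o11 o22]
  \<comment> \<open>Twice the mean curvature vector is normal to the surface and to the radial
    direction; this removes the correction terms of \<open>H\<close>.\<close>
  have No: "N p \<bullet> x p = 0" "N p \<bullet> pd x e1 p = 0" "N p \<bullet> pd x e2 p = 0" for p
    using unit[of p] ox[of p] o11[of p] o22[of p]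
    by (simp_all add: N_def inner_add_left inner_add_right norm_eq_sqrt_inner inner_commute)
  have half: "((1/2) *\<^sub>R a) \<bullet> ((1/2) *\<^sub>R b) + ((1/2) *\<^sub>R b) \<bullet> ((1/2) *\<^sub>R a) = (1/2) * (a \<bullet> b)" for a b :: "real^'k"
    by (simp add: inner_commute)
  have HH: "first_order ?S (\<lambda>t p. (norm (mean_curv (\<Phi> t) p))\<^sup>2) (\<lambda>p. (1/4) * (N p \<bullet> N p))
    (\<lambda>p. (1/2) * (N p \<bullet> (pd (pd V e1) e1 p + pd (pd V e2) e2 p + 2 *\<^sub>R V p)
         - E1 p * (N p \<bullet> pd (pd x e1) e1 p) - G1 p * (N p \<bullet> pd (pd x e2) e2 p)))"
    by (rule first_order_cong[OF first_order_inner[OF H H]], unfold N_def[symmetric] power2_norm_eq_inner half)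
       (simp_all add: inner_diff_right inner_add_right No)
  note K = first_order_gauss_curv[OF jE jG jF S]
  note J = first_order_mult[OF first_order_add[OF first_order_diff[OF HH K] first_order_const[OF S, of 1]] first_order_sqrt[OF d]]
  from first_order_integral[OF J]
  have "((\<lambda>t. willmore L Lh (\<Phi> t)) has_real_derivative integral ?S ?J) (at 0)"
    unfolding willmore_def[symmetric] by (rule back_subst) (auto intro!: arg_cong[where f="integral ?S"] simp: algebra_simps)
  moreover have "((\<lambda>t. willmore L Lh (\<Phi> t)) has_real_derivative 0) (at 0)"
    using W var unfolding willmore_surface_def by blast
  ultimately show ?thesis by (rule DERIV_unique)
qed

section \<open>Spherical curves and tensor products\<close>

definition vd :: "(real \<Rightarrow> 'b::real_normed_vector) \<Rightarrow> real \<Rightarrow> 'b"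
  where "vd f = (\<lambda>s. vector_derivative f (at s))"

lemma smooth_has_vector_derivative:
  assumes "smooth f"
  shows "(f has_vector_derivative frechet_derivative f (at s) 1) (at s)"
proof -
  note d = smooth_has_derivative[OF assms, of s]
  interpret bounded_linear "frechet_derivative f (at s)" by (rule has_derivative_bounded_linear[OF d])
  have "frechet_derivative f (at s) = (\<lambda>v. v *\<^sub>R frechet_derivative f (at s) 1)"
  proof
    fix v show "frechet_derivative f (at s) v = v *\<^sub>R frechet_derivative f (at s) 1"
      using scaleR[of v 1] by simp
  qed
  then show ?thesis using d by (metis has_vector_derivative_def)
qed

lemma smooth_vd_eq: "smooth f \<Longrightarrow> vd f = (\<lambda>s. frechet_derivative f (at s) 1)"
  unfolding vd_def using smooth_has_vector_derivative vector_derivative_at by blast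

lemma smooth_has_vd: "smooth f \<Longrightarrow> (f has_vector_derivative vd f s) (at s)"
  using smooth_has_vector_derivative[of f s] by (simp add: smooth_vd_eq)

lemma smooth_vd: "smooth (f :: real \<Rightarrow> 'b::real_normed_vector) \<Longrightarrow> smooth (vd f)"
  using smooth_partial[of f 1] by (simp add: smooth_vd_eq)

lemma vd_eqI: "(\<And>s. (f has_vector_derivative f' s) (at s)) \<Longrightarrow> vd f = f'"
  unfolding vd_def by (auto intro: vector_derivative_at)

lemma vd_add: "smooth f \<Longrightarrow> smooth h \<Longrightarrow> vd (\<lambda>s. f s + h s) = (\<lambda>s. vd f s + vd h s)"
  by (intro vd_eqI has_vector_derivative_add smooth_has_vd)

lemma (in bounded_bilinear) vd_prod:
  assumes "smooth f" "smooth h"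
  shows "vd (\<lambda>s. prod (f s) (h s)) = (\<lambda>s. prod (f s) (vd h s) + prod (vd f s) (h s))"
  by (intro vd_eqI has_vector_derivative smooth_has_vd assms)

lemmas vd_scaleR = bounded_bilinear.vd_prod[OF bounded_bilinear_scaleR]
lemmas vd_inner = bounded_bilinear.vd_prod[OF bounded_bilinear_inner]

lemma vd_const: "vd (\<lambda>s. c) = (\<lambda>s. 0)"
  by (intro vd_eqI) auto

lemma vd_periodic:
  assumes "smooth f" "\<And>s. f (s + L) = f s" shows "vd f (s + L) = vd f s"
proof -
  have "((\<lambda>s. f (s + L)) has_vector_derivative vd f (s + L)) (at s)"
    using vector_diff_chain_at[of "\<lambda>s. s + L" 1 s f "vd f (s + L)"] smooth_has_vd[OF assms(1)]
    by (simp add: o_def has_vector_derivative_add_const)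
  then show ?thesis
    using assms(2) smooth_has_vd[OF assms(1), of s] vector_derivative_unique_at by fastforce
qed

lemma (in bounded_bilinear) pd_coordinates:
  assumes "smooth f" "smooth h"
  shows "pd (\<lambda>p. prod (f (fst p)) (h (snd p))) e1 = (\<lambda>p. prod (vd f (fst p)) (h (snd p)))"
    and "pd (\<lambda>p. prod (f (fst p)) (h (snd p))) e2 = (\<lambda>p. prod (f (fst p)) (vd h (snd p)))"
proof -
  have f: "((\<lambda>p. f (fst p)) has_derivative (\<lambda>v. fst v *\<^sub>R vd f (fst p))) (at p)" for p :: "real \<times> real"
    using has_derivative_compose[OF has_derivative_fst[OF has_derivative_ident]
        smooth_has_vd[OF assms(1), of "fst p", unfolded has_vector_derivative_def]] by simp
  have h: "((\<lambda>p. h (snd p)) has_derivative (\<lambda>v. snd v *\<^sub>R vd h (snd p))) (at p)" for p :: "real \<times> real"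
    using has_derivative_compose[OF has_derivative_snd[OF has_derivative_ident]
        smooth_has_vd[OF assms(2), of "snd p", unfolded has_vector_derivative_def]] by simp
  show "pd (\<lambda>p. prod (f (fst p)) (h (snd p))) e1 = (\<lambda>p. prod (vd f (fst p)) (h (snd p)))"
    "pd (\<lambda>p. prod (f (fst p)) (h (snd p))) e2 = (\<lambda>p. prod (f (fst p)) (vd h (snd p)))"
    by (rule ext, subst pd_eqI[OF FDERIV[OF f h]], simp add: scaleR_left zero_left zero_right scaleR_right)+
qed

lemma inner_tensor [simp]: "tensor a b \<bullet> tensor c d = (a \<bullet> c) * (b \<bullet> d)"
proof -
  have "tensor a b \<bullet> tensor c d = (\<Sum>p\<in>UNIV \<times> UNIV. (a $ fst p * c $ fst p) * (b $ snd p * d $ snd p))"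
    by (simp add: tensor_def inner_vec_def mult_ac)
  also have "\<dots> = (\<Sum>i\<in>UNIV. \<Sum>j\<in>UNIV. (a $ i * c $ i) * (b $ j * d $ j))"
    by (simp only: sum.cartesian_product case_prod_beta')
  also have "\<dots> = (a \<bullet> c) * (b \<bullet> d)"
    by (simp only: sum_product inner_vec_def inner_real_def)
  finally show ?thesis .
qed

lemma norm_tensor: "norm (tensor a b) = norm a * norm b"
  by (simp add: norm_eq_sqrt_inner real_sqrt_mult)

lemma bounded_bilinear_tensor: "bounded_bilinear tensor"
proof (rule bounded_bilinear.intro)
  show "\<exists>K. \<forall>a b. norm (tensor a b) \<le> norm a * norm b * K"
    by (intro exI[of _ 1]) (simp add: norm_tensor)
qed (simp_all add: tensor_def vec_eq_iff algebra_simps)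

interpretation tensor: bounded_bilinear tensor by (rule bounded_bilinear_tensor)

lemma tensor_torus_eq: "tensor_torus f h = (\<lambda>p. tensor (f (fst p)) (h (snd p)))"
  by (auto simp: tensor_torus_def)

lemma tensor_torus_apply [simp]: "tensor_torus f h p = tensor (f (fst p)) (h (snd p))"
  by (simp add: tensor_torus_eq)

lemma smooth_tensor_torus: "smooth f \<Longrightarrow> smooth h \<Longrightarrow> smooth (tensor_torus f h)"
  unfolding tensor_torus_eq by (intro tensor.smooth_prod smooth_compose_fst smooth_compose_snd)

lemma pd_tensor_torus:
  assumes "smooth f" "smooth h"
  shows "pd (tensor_torus f h) e1 = tensor_torus (vd f) h" "pd (tensor_torus f h) e2 = tensor_torus f (vd h)"
  unfolding tensor_torus_eq by (rule tensor.pd_coordinates[OF assms])+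

lemma pd_add:
  assumes "smooth f" "smooth h" shows "pd (\<lambda>p. f p + h p) e = (\<lambda>p. pd f e p + pd h e p)"
  by (rule ext, subst pd_eqI[OF has_derivative_add[OF smooth_has_derivative[OF assms(1)] smooth_has_derivative[OF assms(2)]]])
     (simp add: pd_def)

lemma periodic_lattice:
  assumes "\<And>s. f (s + L) = f s" "\<And>s. h (s + Lh) = h s" "l \<in> lattice L Lh"
  shows "f (fst (p + l)) = f (fst p)" "h (snd (p + l)) = h (snd p)"
proof -
  interpret f: periodic_fun_simple f L using assms(1) by unfold_locales
  interpret h: periodic_fun_simple h Lh using assms(2) by unfold_locales
  obtain i j where l: "l = (of_int i * L, of_int j * Lh)" using assms(3) unfolding lattice_def by blast
  show "f (fst (p + l)) = f (fst p)" "h (snd (p + l)) = h (snd p)"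
    using f.plus_of_int h.plus_of_int by (simp_all add: l)
qed

text \<open>In Frenet terms this is \<open>k_1\<close> times \<beta>1. Unlike the frame itself it is
  defined and smooth also where the curvature vanishes.\<close>

definition curv_vec :: "(real \<Rightarrow> real^'n) \<Rightarrow> real \<Rightarrow> real^'n"
  where "curv_vec g = (\<lambda>s. vd (vd g) s + g s)"

definition curv_sq :: "(real \<Rightarrow> real^'n) \<Rightarrow> real \<Rightarrow> real"
  where "curv_sq g = (\<lambda>s. curv_vec g s \<bullet> curv_vec g s)"

locale sphere_curve =
  fixes g :: "real \<Rightarrow> real^'n" and L :: real
  assumes closed_curve: "closed_sphere_curve g L"
begin

abbreviation "w \<equiv> curv_vec g"
abbreviation "k2 \<equiv> curv_sq g"

lemma smooth_g: "smooth g" and L_pos: "L > 0" and periodic: "\<And>s. g (s + L) = g s"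
  and gg: "g s \<bullet> g s = 1" and g1g1: "vd g s \<bullet> vd g s = 1"
  using closed_curve unfolding closed_sphere_curve_def vd_def by (auto simp: norm_eq_sqrt_inner)

lemma ww: "w s \<bullet> w s = k2 s"
  by (simp add: curv_sq_def)

lemma smooth_g1: "smooth (vd g)" and smooth_g2: "smooth (vd (vd g))"
  by (intro smooth_vd smooth_g)+

lemma smooth_w: "smooth w"
  unfolding curv_vec_def by (intro smooth_add smooth_g2 smooth_g)

lemma smooth_w1: "smooth (vd w)" and smooth_k2: "smooth k2"
  unfolding curv_sq_def by (intro smooth_inner smooth_vd smooth_w)+

lemma inner_deriv:
  assumes "smooth f" "smooth h" "\<And>s. f s \<bullet> h s = c"
  shows "f s \<bullet> vd h s = - (vd f s \<bullet> h s)"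
proof -
  have "vd (\<lambda>s. f s \<bullet> h s) s = f s \<bullet> vd h s + vd f s \<bullet> h s"
    using vd_inner[OF assms(1,2)] by metis
  then show ?thesis by (simp add: assms(3) vd_const)
qed

lemma gg1: "g s \<bullet> vd g s = 0"
  using inner_deriv[OF smooth_g smooth_g gg] by (simp add: inner_commute)

lemma gg2: "g s \<bullet> vd (vd g) s = - 1"
  using inner_deriv[OF smooth_g smooth_g1 gg1] g1g1 by simp

lemma g1g2: "vd g s \<bullet> vd (vd g) s = 0"
  using inner_deriv[OF smooth_g1 smooth_g1 g1g1] by (simp add: inner_commute)

lemma wg: "g s \<bullet> w s = 0"
  by (simp add: curv_vec_def inner_add_right gg gg2)

lemma wg1: "vd g s \<bullet> w s = 0"
  by (simp add: curv_vec_def inner_add_right g1g2 gg1 inner_commute[of "vd g s" "g s"])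

lemma wg2: "vd (vd g) s \<bullet> w s = k2 s"
  using wg[of s] by (simp add: curv_sq_def curv_vec_def inner_add_left)

lemma k2_eq: "k2 s = vd (vd g) s \<bullet> vd (vd g) s - 1"
  by (simp add: curv_sq_def curv_vec_def inner_add_left inner_add_right gg gg2 inner_commute[of "vd (vd g) s" "g s"])

lemma gw1: "g s \<bullet> vd w s = 0"
  using inner_deriv[OF smooth_g smooth_w wg] wg1 by simp

lemma g1w1: "vd g s \<bullet> vd w s = - k2 s"
  using inner_deriv[OF smooth_g1 smooth_w wg1] wg2 by simp

lemma gw2: "g s \<bullet> vd (vd w) s = k2 s"
  using inner_deriv[OF smooth_g smooth_w1 gw1] g1w1 by simp

lemma k2_periodic: "k2 (s + L) = k2 s"
  by (simp add: curv_sq_def curv_vec_def periodic vd_periodic[OF smooth_g1 vd_periodic[OF smooth_g periodic]])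

lemma w_periodic: "w (s + L) = w s"
  by (simp add: curv_vec_def periodic vd_periodic[OF smooth_g1 vd_periodic[OF smooth_g periodic]])

end

section \<open>First variation of a tensor product torus\<close>

lemma integral_product_box:
  fixes f h :: "real \<Rightarrow> real"
  assumes f: "continuous_on {0..L} f" and h: "continuous_on {0..Lh} h"
  shows "((\<lambda>p. f (fst p) * h (snd p)) has_integral integral {0..L} f * integral {0..Lh} h) (cbox (0, 0) (L, Lh))"
proof -
  have c: "continuous_on (cbox (0, 0) (L, Lh)) (\<lambda>p. f (fst p) * h (snd p))"
    by (intro continuous_on_mult continuous_on_compose2[OF f] continuous_on_compose2[OF h] continuous_intros)
       (auto simp: cbox_Pair_eq)
  have "integral (cbox (0, 0) (L, Lh)) (\<lambda>p. f (fst p) * h (snd p)) = integral {0..L} f * integral {0..Lh} h"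
    unfolding integral_prod_continuous[OF c] by simp
  then show ?thesis
    using integrable_integral[OF integrable_continuous[OF c]] by simp
qed

lemma integral_vd:
  fixes f :: "real \<Rightarrow> 'b::euclidean_space"
  assumes "smooth f" "a \<le> b"
  shows "integral {a..b} (vd f) = f b - f a"
  by (intro integral_unique fundamental_theorem_of_calculus assms)
     (meson assms has_vector_derivative_at_within smooth_has_vd)

locale tensor_pair = c: sphere_curve g L + ch: sphere_curve gh Lh
  for g :: "real \<Rightarrow> real^'n" and L and gh :: "real \<Rightarrow> real^'m" and Lh
begin

abbreviation "x \<equiv> tensor_torus g gh"

lemmas c_simps = c.ww ch.ww c.gg c.g1g1 c.gg1 c.gg2 c.g1g2 c.wg c.wg1 c.wg2 c.gw1 c.g1w1 c.gw2
  ch.gg ch.g1g1 ch.gg1 ch.gg2 ch.g1g2 ch.wg ch.wg1 ch.wg2 ch.gw1 ch.g1w1 ch.gw2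
lemmas orth = c_simps c_simps[THEN trans[OF inner_commute]]

lemmas smooths = c.smooth_g c.smooth_g1 c.smooth_g2 c.smooth_w c.smooth_w1
  ch.smooth_g ch.smooth_g1 ch.smooth_g2 ch.smooth_w ch.smooth_w1

lemma pd_x: "pd x e1 = tensor_torus (vd g) gh" "pd x e2 = tensor_torus g (vd gh)"
   "pd (tensor_torus (vd g) gh) e1 = tensor_torus (vd (vd g)) gh"
   "pd (tensor_torus g (vd gh)) e2 = tensor_torus g (vd (vd gh))"
  by (simp_all add: pd_tensor_torus smooths)

lemma fundamental_forms: "fE x = (\<lambda>p. 1)" "fF x = (\<lambda>p. 0)" "fG x = (\<lambda>p. 1)"
  by (auto simp: fE_def fF_def fG_def pd_x orth)

lemma gdet_x: "gdet x p = 1"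
  by (simp add: gdet_def fundamental_forms)

lemma gauss_curv_x: "gauss_curv x p = 0"
  by (simp add: gauss_curv_def fundamental_forms det3_def)

lemma mean_curv_x:
  "mean_curv x p = (1/2) *\<^sub>R (tensor (curv_vec g (fst p)) (gh (snd p)) + tensor (g (fst p)) (curv_vec gh (snd p)))"
  by (simp add: mean_curv_def nproj_def Let_def gdet_x fundamental_forms pd_tensor_torus smooths orth curv_vec_def tensor.add_left tensor.add_right)

lemma willmore_density:
  "((norm (mean_curv x p))\<^sup>2 - gauss_curv x p + 1) * sqrt (gdet x p) = (curv_sq g (fst p) + curv_sq gh (snd p)) / 4 + 1"
  unfolding mean_curv_x gdet_x gauss_curv_x power2_norm_eq_inner
  by (simp add: inner_add_left inner_add_right orth)

lemma willmore_x:
  "willmore L Lh x = (Lh * integral {0..L} (curv_sq g) + L * integral {0..Lh} (curv_sq gh)) / 4 + L * Lh"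
proof -
  have 1: "((\<lambda>p. curv_sq g (fst p) * 1) has_integral integral {0..L} (curv_sq g) * integral {0..Lh} (\<lambda>s. 1)) (cbox (0, 0) (L, Lh))"
    by (intro integral_product_box smooth_continuous_on c.smooth_k2) auto
  have 2: "((\<lambda>p. 1 * curv_sq gh (snd p)) has_integral integral {0..L} (\<lambda>s. 1) * integral {0..Lh} (curv_sq gh)) (cbox (0, 0) (L, Lh))"
    by (intro integral_product_box smooth_continuous_on ch.smooth_k2) auto
  have 3: "((\<lambda>p. 1 * 1) has_integral integral {0..L} (\<lambda>s. 1::real) * integral {0..Lh} (\<lambda>s. 1)) (cbox (0, 0) (L, Lh))"
    by (intro integral_product_box) auto
  have "((\<lambda>p. (curv_sq g (fst p) * 1 + 1 * curv_sq gh (snd p)) / 4 + 1 * 1) has_integral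
     (integral {0..L} (curv_sq g) * integral {0..Lh} (\<lambda>s. 1) + integral {0..L} (\<lambda>s. 1) * integral {0..Lh} (curv_sq gh)) / 4
     + integral {0..L} (\<lambda>s. 1::real) * integral {0..Lh} (\<lambda>s. 1)) (cbox (0, 0) (L, Lh))"
    by (intro has_integral_add has_integral_divide 1 2 3)
  then show ?thesis
    unfolding willmore_def willmore_density
    using c.L_pos ch.L_pos by (simp add: integral_unique mult_ac)
qed

text \<open>\<open>C\<close> gathers what the variation along w produces from the first curve alone;
  the coupling term with coefficient 1/4 comes from the squared mean curvature multiplied by the
  variation of the area. Both fields are treated at once, and setting \<phi> or \<psi> to zero
  separates them.\<close>

lemma first_variation:
  fixes \<psi> \<phi> :: "real \<Rightarrow> real"
  assumes W: "willmore_surface L Lh x" and psi: "smooth \<psi>" "\<And>s. \<psi> (s + Lh) = \<psi> s"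
    and phi: "smooth \<phi>" "\<And>s. \<phi> (s + L) = \<phi> s"
  defines "C \<equiv> \<lambda>s. (1/2) * (curv_vec g s \<bullet> vd (vd (curv_vec g)) s) - (1/2) * curv_sq g s + (3/4) * (curv_sq g s)\<^sup>2"
    and "Ch \<equiv> \<lambda>s. (1/2) * (curv_vec gh s \<bullet> vd (vd (curv_vec gh)) s) - (1/2) * curv_sq gh s + (3/4) * (curv_sq gh s)\<^sup>2"
  shows "integral {0..L} C * integral {0..Lh} \<psi> - (1/4) * integral {0..L} (curv_sq g) * integral {0..Lh} (\<lambda>s. \<psi> s * curv_sq gh s)
     + (integral {0..Lh} Ch * integral {0..L} \<phi> - (1/4) * integral {0..Lh} (curv_sq gh) * integral {0..L} (\<lambda>s. \<phi> s * curv_sq g s)) = 0"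
proof -
  let ?k = "curv_sq g" and ?kh = "curv_sq gh" and ?w = "curv_vec g" and ?wh = "curv_vec gh"
  \<comment> \<open>The weights are absorbed into the curves, so that \<open>V\<close> is a sum of
    two tensor tori and its partial derivatives reduce to derivatives of the factors.\<close>
  define a where "a = (\<lambda>s. \<phi> s *\<^sub>R g s)"
  define b where "b = (\<lambda>s. \<psi> s *\<^sub>R gh s)"
  define V where "V = (\<lambda>p. tensor_torus ?w b p + tensor_torus a ?wh p)"
  define E1 where "E1 = (\<lambda>p. ?k (fst p) * (- 2 * \<psi> (snd p)))"
  define G1 where "G1 = (\<lambda>p. (- 2 * \<phi> (fst p)) * ?kh (snd p))"
  have sa: "smooth a" and sb: "smooth b"
    unfolding a_def b_def by (intro smooth_scaleR psi phi smooths)+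
  have va: "vd a = (\<lambda>s. \<phi> s *\<^sub>R vd g s + vd \<phi> s *\<^sub>R g s)" and vb: "vd b = (\<lambda>s. \<psi> s *\<^sub>R vd gh s + vd \<psi> s *\<^sub>R gh s)"
    unfolding a_def b_def by (intro vd_scaleR psi phi smooths)+
  have vva: "vd (vd a) = (\<lambda>s. (\<phi> s *\<^sub>R vd (vd g) s + vd \<phi> s *\<^sub>R vd g s) + (vd \<phi> s *\<^sub>R vd g s + vd (vd \<phi>) s *\<^sub>R g s))"
    unfolding va by (subst vd_add, (intro smooth_scaleR smooth_vd psi phi smooths)+)
      (simp add: vd_scaleR smooth_vd psi phi smooths)
  have vvb: "vd (vd b) = (\<lambda>s. (\<psi> s *\<^sub>R vd (vd gh) s + vd \<psi> s *\<^sub>R vd gh s) + (vd \<psi> s *\<^sub>R vd gh s + vd (vd \<psi>) s *\<^sub>R gh s))"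
    unfolding vb by (subst vd_add, (intro smooth_scaleR smooth_vd psi phi smooths)+)
      (simp add: vd_scaleR smooth_vd psi phi smooths)
  have sV: "smooth V"
    unfolding V_def by (intro smooth_add smooth_tensor_torus sa sb smooths)
  have V1: "pd V e1 = (\<lambda>p. tensor_torus (vd ?w) b p + tensor_torus (vd a) ?wh p)"
    and V2: "pd V e2 = (\<lambda>p. tensor_torus ?w (vd b) p + tensor_torus a (vd ?wh) p)"
    unfolding V_def
    by (subst pd_add, (intro smooth_tensor_torus sa sb smooths)+, subst (1 2) pd_tensor_torus,
        (intro sa sb smooths refl)+)+
  have V11: "pd (pd V e1) e1 = (\<lambda>p. tensor_torus (vd (vd ?w)) b p + tensor_torus (vd (vd a)) ?wh p)"
    unfolding V1
    by (subst pd_add, (intro smooth_tensor_torus smooth_vd sa sb smooths)+, subst (1 2) pd_tensor_torus,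
        (intro sa sb smooths refl smooth_vd)+)
  have V22: "pd (pd V e2) e2 = (\<lambda>p. tensor_torus ?w (vd (vd b)) p + tensor_torus a (vd (vd ?wh)) p)"
    unfolding V2
    by (subst pd_add, (intro smooth_tensor_torus smooth_vd sa sb smooths)+, subst (1 2) pd_tensor_torus,
        (intro sa sb smooths refl smooth_vd)+)
  have m: "vd (\<lambda>s. - 2 * f s) = (\<lambda>s. - 2 * vd f s)" and sm: "smooth (\<lambda>s. - 2 * f s)"
    if "smooth f" for f :: "real \<Rightarrow> real"
    using bounded_bilinear.vd_prod[OF bounded_bilinear_mult smooth_const[of "-2"] that]
      smooth_mult[OF smooth_const that, of "-2"] by (simp_all add: vd_const)
  have E22: "pd (pd E1 e2) e2 = (\<lambda>p. ?k (fst p) * (- 2 * vd (vd \<psi>) (snd p)))"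
    using bounded_bilinear.pd_coordinates(2)[OF bounded_bilinear_mult c.smooth_k2 sm[OF psi(1)]]
      bounded_bilinear.pd_coordinates(2)[OF bounded_bilinear_mult c.smooth_k2 sm[OF smooth_vd[OF psi(1)]]]
    by (simp only: E1_def m psi smooth_vd)
  have G11: "pd (pd G1 e1) e1 = (\<lambda>p. (- 2 * vd (vd \<phi>) (fst p)) * ?kh (snd p))"
    using bounded_bilinear.pd_coordinates(1)[OF bounded_bilinear_mult sm[OF phi(1)] ch.smooth_k2]
      bounded_bilinear.pd_coordinates(1)[OF bounded_bilinear_mult sm[OF smooth_vd[OF phi(1)]] ch.smooth_k2]
    by (simp only: G1_def m phi smooth_vd)
  define N where "N = (\<lambda>p. pd (pd x e1) e1 p + pd (pd x e2) e2 p + 2 *\<^sub>R x p)"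
  have N: "N = (\<lambda>p. tensor (?w (fst p)) (gh (snd p)) + tensor (g (fst p)) (?wh (snd p)))"
    unfolding N_def pd_x by (auto simp: curv_vec_def tensor.add_left tensor.add_right scaleR_2)
  have "integral (cbox (0, 0) (L, Lh)) (\<lambda>p.
      (1/2) * (N p \<bullet> (pd (pd V e1) e1 p + pd (pd V e2) e2 p + 2 *\<^sub>R V p)
         - E1 p * (N p \<bullet> pd (pd x e1) e1 p) - G1 p * (N p \<bullet> pd (pd x e2) e2 p))
      + (1/2) * pd (pd E1 e2) e2 p + (1/2) * pd (pd G1 e1) e1 p
      + (1/2) * (E1 p + G1 p) * ((1/4) * (N p \<bullet> N p) + 1)) = 0" (is "integral _ ?J = 0")
  proof (rule first_variation_willmore[OF W _ sV])
    show "smooth x" by (intro smooth_tensor_torus smooths)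
    show "norm (x p) = 1" for p using c.gg[of "fst p"] ch.gg[of "snd p"] by (simp add: norm_tensor norm_eq_sqrt_inner)
    show "V p \<bullet> x p = 0" for p by (simp add: V_def inner_add_left orth)
    show "x (p + l) = x p" if "l \<in> lattice L Lh" for p l
      using periodic_lattice[of g L gh Lh, OF c.periodic ch.periodic that] by simp
    show "V (p + l) = V p" if "l \<in> lattice L Lh" for p l
      using periodic_lattice[of g L gh Lh, OF c.periodic ch.periodic that] periodic_lattice[of ?w L ?wh Lh, OF c.w_periodic ch.w_periodic that]
         periodic_lattice[of \<phi> L \<psi> Lh, OF phi(2) psi(2) that]
      by (simp add: V_def a_def b_def)
  qed (simp_all add: V1 V2 pd_x inner_add_left inner_add_right orth N_def va vb a_def b_def E1_def G1_def)
  moreover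
  have double: "a \<bullet> (2 * b) = 2 * (a \<bullet> b)" for a b :: "real^'i"
    by (simp only: mult_2 inner_add_right)
  have J: "?J p = C (fst p) * \<psi> (snd p) - (1/4) * (?k (fst p) * (\<psi> (snd p) * ?kh (snd p))) - (1/2) * (?k (fst p) * vd (vd \<psi>) (snd p))
     + (\<phi> (fst p) * Ch (snd p) - (1/4) * ((\<phi> (fst p) * ?k (fst p)) * ?kh (snd p)) - (1/2) * (vd (vd \<phi>) (fst p) * ?kh (snd p)))" for p
    unfolding N E22 G11 V11 V22
    by (simp add: V_def a_def b_def E1_def G1_def pd_x inner_add_left inner_add_right orth C_def Ch_def
       vva[unfolded a_def] vvb[unfolded b_def] double power2_eq_square algebra_simps)
  have cont: "continuous_on T C" "continuous_on T \<psi>" "continuous_on T ?k" "continuous_on T ?kh"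
      "continuous_on T Ch" "continuous_on T \<phi>" "continuous_on T (vd (vd \<phi>))" "continuous_on T (vd (vd \<psi>))" for T
    unfolding C_def Ch_def power2_eq_square
    by (intro smooth_continuous_on smooth_add smooth_diff smooth_mult smooth_inner smooth_const c.smooth_k2 ch.smooth_k2
        smooth_vd smooths psi phi)+
  \<comment> \<open>The second derivatives of the weights come from the Laplacian of
    \<open>V\<close> and from the Gauss curvature; by periodicity they contribute nothing.\<close>
  have z: "integral {0..Lh} (vd (vd \<psi>)) = 0" "integral {0..L} (vd (vd \<phi>)) = 0"
    using integral_vd[OF smooth_vd[OF psi(1)], of 0 Lh] vd_periodic[OF psi, of 0] ch.L_pos
     integral_vd[OF smooth_vd[OF phi(1)], of 0 L] vd_periodic[OF phi, of 0] c.L_pos by auto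
  have "(?J has_integral integral {0..L} C * integral {0..Lh} \<psi> - (1/4) * (integral {0..L} ?k * integral {0..Lh} (\<lambda>s. \<psi> s * ?kh s))
      - (1/2) * (integral {0..L} ?k * integral {0..Lh} (vd (vd \<psi>)))
     + (integral {0..L} \<phi> * integral {0..Lh} Ch - (1/4) * (integral {0..L} (\<lambda>s. \<phi> s * ?k s) * integral {0..Lh} ?kh)
      - (1/2) * (integral {0..L} (vd (vd \<phi>)) * integral {0..Lh} ?kh))) (cbox (0, 0) (L, Lh))"
    unfolding J
    by (intro has_integral_add has_integral_diff has_integral_mult_right integral_product_box continuous_on_mult cont)
  ultimately show ?thesis
    by (simp add: integral_unique z algebra_simps)
qed

end

section \<open>The elastic integral of a single curve\<close>

context sphere_curve begin

lemma k2_nonneg: "k2 s \<ge> 0"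
  by (simp add: curv_sq_def)

lemma integral_k2_nonneg: "integral {0..L} k2 \<ge> 0"
  by (intro integral_nonneg integrable_continuous_interval smooth_continuous_on smooth_k2) (simp add: k2_nonneg)

text \<open>The component of w' along the unit tangent is already minus the squared curvature, since
  w is orthogonal to \<gamma>' and has inner product \<open>k2\<close> with \<gamma>''.\<close>

lemma k2_sq_le: "(k2 s)\<^sup>2 \<le> vd w s \<bullet> vd w s"
proof -
  have "(vd g s \<bullet> vd w s)\<^sup>2 \<le> (vd g s \<bullet> vd g s) * (vd w s \<bullet> vd w s)"
    by (rule Cauchy_Schwarz_ineq)
  then show ?thesis by (simp add: g1w1 g1g1)
qed

text \<open>Integration by parts replaces \<open>w \<bullet> w''\<close> by minus the squared norm
  of w', and \<open>k2_sq_le\<close> then lowers the coefficient of the fourth power from 3/4 to 3/4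
  - 1/2 = 1/4.\<close>

lemma integral_elastic_le:
  "integral {0..L} (\<lambda>s. (1/2) * (w s \<bullet> vd (vd w) s) - (1/2) * k2 s + (3/4) * (k2 s)\<^sup>2)
     \<le> (1/4) * integral {0..L} (\<lambda>s. (k2 s)\<^sup>2) - (1/2) * integral {0..L} k2"
proof -
  have i: "f integrable_on {0..L}" if "smooth f" for f :: "real \<Rightarrow> real"
    by (intro integrable_continuous_interval smooth_continuous_on that)
  note sm = smooth_add smooth_diff smooth_mult smooth_inner smooth_const smooth_vd smooth_w smooth_k2
  \<comment> \<open>The integrand is the derivative of the periodic function
    \<open>w \<bullet> w'\<close>, so it may be added below at no cost.\<close>
  have 0: "integral {0..L} (\<lambda>s. w s \<bullet> vd (vd w) s + vd w s \<bullet> vd w s) = 0"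
  proof -
    have "vd (\<lambda>s. w s \<bullet> vd w s) = (\<lambda>s. w s \<bullet> vd (vd w) s + vd w s \<bullet> vd w s)"
      by (intro vd_inner sm)
    moreover have "integral {0..L} (vd (\<lambda>s. w s \<bullet> vd w s)) = 0"
      using integral_vd[of "\<lambda>s. w s \<bullet> vd w s" 0 L] L_pos w_periodic[of 0] vd_periodic[OF smooth_w w_periodic, of 0]
      by (simp add: sm)
    ultimately show ?thesis by simp
  qed
  have "integral {0..L} (\<lambda>s. (1/2) * (w s \<bullet> vd (vd w) s) - (1/2) * k2 s + (3/4) * (k2 s)\<^sup>2)
     \<le> integral {0..L} (\<lambda>s. (1/2) * (w s \<bullet> vd (vd w) s + vd w s \<bullet> vd w s) + ((1/4) * (k2 s)\<^sup>2 - (1/2) * k2 s))"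
  proof (intro integral_le i)
    fix s show "(1/2) * (w s \<bullet> vd (vd w) s) - (1/2) * k2 s + (3/4) * (k2 s)\<^sup>2
      \<le> (1/2) * (w s \<bullet> vd (vd w) s + vd w s \<bullet> vd w s) + ((1/4) * (k2 s)\<^sup>2 - (1/2) * k2 s)"
      using k2_sq_le[of s] by (simp add: algebra_simps)
  qed (unfold power2_eq_square, (intro sm)+)
  also have "\<dots> = (1/2) * integral {0..L} (\<lambda>s. w s \<bullet> vd (vd w) s + vd w s \<bullet> vd w s) + ((1/4) * integral {0..L} (\<lambda>s. (k2 s)\<^sup>2) - (1/2) * integral {0..L} k2)"
    unfolding power2_eq_square
    by (subst integral_add, (intro i sm)+, subst integral_diff, (intro i sm)+, simp)
  finally show ?thesis by (simp add: 0)
qed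

end

section \<open>A Willmore tensor torus has a geodesic factor\<close>

context tensor_pair begin

lemma curvature_gap:
  assumes W: "willmore_surface L Lh x" and "integral {0..L} (curv_sq g) > 0" and "integral {0..Lh} (curv_sq gh) > 0"
  shows "integral {0..L} (curv_sq g) / L \<ge> 2 + integral {0..Lh} (curv_sq gh) / Lh"
    and "integral {0..Lh} (curv_sq gh) / Lh \<ge> 2 + integral {0..L} (curv_sq g) / L"
proof -
  define C where "C = integral {0..L} (\<lambda>s. (1/2) * (curv_vec g s \<bullet> vd (vd (curv_vec g)) s) - (1/2) * curv_sq g s + (3/4) * (curv_sq g s)\<^sup>2)"
  define Ch where "Ch = integral {0..Lh} (\<lambda>s. (1/2) * (curv_vec gh s \<bullet> vd (vd (curv_vec gh)) s) - (1/2) * curv_sq gh s + (3/4) * (curv_sq gh s)\<^sup>2)"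
  define I where "I = integral {0..L} (curv_sq g)"
  define Ih where "Ih = integral {0..Lh} (curv_sq gh)"
  define M where "M = integral {0..L} (\<lambda>s. (curv_sq g s)\<^sup>2)"
  define Mh where "Mh = integral {0..Lh} (\<lambda>s. (curv_sq gh s)\<^sup>2)"
  note fv = first_variation[OF W, folded C_def Ch_def I_def Ih_def]
  \<comment> \<open>Four tests: each weight is either 1 or the squared curvature of the curve on
    which it depends, while the other weight is zero.\<close>
  have 1: "C * Lh = (1/4) * I * Ih" using fv[of "\<lambda>s. 1" "\<lambda>s. 0"] ch.L_pos by (simp add: Ih_def)
  have 2: "Ch * L = (1/4) * Ih * I" using fv[of "\<lambda>s. 0" "\<lambda>s. 1"] c.L_pos by (simp add: I_def)
  have 3: "C * Ih = (1/4) * I * Mh"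
    using fv[OF ch.smooth_k2 ch.k2_periodic, of "\<lambda>s. 0"] by (simp add: Ih_def Mh_def power2_eq_square)
  have 4: "Ch * I = (1/4) * Ih * M"
    using fv[of "\<lambda>s. 0", OF _ _ c.smooth_k2 c.k2_periodic] by (simp add: I_def M_def power2_eq_square)
  have pos: "I > 0" "Ih > 0" "L > 0" "Lh > 0" using assms c.L_pos ch.L_pos by (auto simp: I_def Ih_def)
  \<comment> \<open>Eliminating \<open>C\<close> from \<open>1\<close> and \<open>3\<close> gives
    equality in Cauchy-Schwarz between the squared curvature of \<open>gh\<close> and the constant
    1; the same happens for \<open>g\<close> with \<open>Ch\<close>.\<close>
  have "I * (Ih * Ih) = 4 * (C * Lh) * Ih" using 1 by simp
  also have "\<dots> = 4 * (C * Ih) * Lh" by simp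
  also have "\<dots> = I * (Mh * Lh)" using 3 by simp
  finally have Mh: "Mh = Ih * Ih / Lh" using pos by (simp add: field_simps)
  have "Ih * (I * I) = 4 * (Ch * L) * I" using 2 by simp
  also have "\<dots> = 4 * (Ch * I) * L" by simp
  also have "\<dots> = Ih * (M * L)" using 4 by simp
  finally have M: "M = I * I / L" using pos by (simp add: field_simps)
  \<comment> \<open>The value of \<open>C\<close> from \<open>1\<close> meets its upper bound from
    the elastic estimate; dividing by \<open>I > 0\<close> leaves the gap of 2 between the mean
    values.\<close>
  have "C \<le> (1/4) * M - (1/2) * I" unfolding C_def M_def I_def by (rule c.integral_elastic_le)
  moreover have "C = (1/4) * I * (Ih / Lh)" using 1 pos by (simp add: field_simps)
  ultimately have "I * (Ih / Lh + 2) \<le> I * (I / L)" unfolding M by (simp add: algebra_simps)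
  then show "integral {0..L} (curv_sq g) / L \<ge> 2 + integral {0..Lh} (curv_sq gh) / Lh"
    using pos unfolding I_def[symmetric] Ih_def[symmetric] mult_le_cancel_left_pos[OF pos(1)] mult_le_cancel_left_pos[OF pos(2)] by simp
  have "Ch \<le> (1/4) * Mh - (1/2) * Ih" unfolding Ch_def Mh_def Ih_def by (rule ch.integral_elastic_le)
  moreover have "Ch = (1/4) * Ih * (I / L)" using 2 pos by (simp add: field_simps)
  ultimately have "Ih * (I / L + 2) \<le> Ih * (Ih / Lh)" unfolding Mh by (simp add: algebra_simps)
  then show "integral {0..Lh} (curv_sq gh) / Lh \<ge> 2 + integral {0..L} (curv_sq g) / L"
    using pos unfolding I_def[symmetric] Ih_def[symmetric] mult_le_cancel_left_pos[OF pos(1)] mult_le_cancel_left_pos[OF pos(2)] by simp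
qed

lemma willmore_geodesic_factor:
  assumes "willmore_surface L Lh x"
  shows "integral {0..L} (curv_sq g) = 0 \<or> integral {0..Lh} (curv_sq gh) = 0"
  using curvature_gap[OF assms] c.integral_k2_nonneg ch.integral_k2_nonneg by linarith

end


section \<open>Wirtinger's inequality\<close>

text \<open>\<open>T\<close> solves the Riccati equation \<open>T' = \<omega> (1 + T^2)\<close>.
  Adding the derivative of \<open>\<omega> (f - m)^2 T\<close> to
  \<open>f'^2 - \<omega>^2 (f - m)^2\<close> therefore completes a square, and the added term
  integrates to zero because \<open>f = m\<close> at both ends.\<close>

lemma wirtinger_dirichlet:
  fixes f f' :: "real \<Rightarrow> real"
  assumes d: "\<And>t. (f has_real_derivative f' t) (at t)" and cont: "continuous_on UNIV f'"
    and ab: "a < b" and z: "f a = m" "f b = m"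
  shows "(pi / (b - a))\<^sup>2 * integral {a..b} (\<lambda>t. (f t - m)\<^sup>2) \<le> integral {a..b} (\<lambda>t. (f' t)\<^sup>2)"
proof -
  define c where "c = (a + b) / 2"
  have cf: "continuous_on T f" and cf': "continuous_on T f'" for T
    using d cont by (meson DERIV_continuous_on has_field_derivative_at_within continuous_on_subset top_greatest)+
  have ineq: "\<omega>\<^sup>2 * integral {a..b} (\<lambda>t. (f t - m)\<^sup>2) \<le> integral {a..b} (\<lambda>t. (f' t)\<^sup>2)"
    if w: "0 < \<omega>" "\<omega> < pi / (b - a)" for \<omega>
  proof -
    define T where "T = (\<lambda>t. tan (\<omega> * (t - c)))"
    \<comment> \<open>With \<omega> strictly below the critical value, the argument of the tangent
      stays inside the open interval of half-width \<pi>/2 even at the end points.\<close>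
    have cos: "cos (\<omega> * (t - c)) \<noteq> 0" if "t \<in> {a..b}" for t
    proof -
      have "\<bar>t - c\<bar> \<le> (b - a) / 2" using that by (auto simp: c_def abs_le_iff field_simps)
      then have "\<omega> * \<bar>t - c\<bar> \<le> \<omega> * ((b - a) / 2)" using w by (intro mult_left_mono) auto
      also have "\<dots> < pi / 2" using w ab by (simp add: field_simps)
      finally have "\<bar>\<omega> * (t - c)\<bar> < pi / 2" using w by (simp add: abs_mult)
      then have "- (pi / 2) < \<omega> * (t - c)" "\<omega> * (t - c) < pi / 2" by linarith+
      from cos_gt_zero_pi[OF this] show ?thesis by simp
    qed
    have cT: "continuous_on {a..b} T"
      unfolding T_def using cos by (intro continuous_intros) auto
    have dT: "(T has_real_derivative \<omega> * (1 + (T t)\<^sup>2)) (at t within {a..b})" if "t \<in> {a..b}" for t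
      unfolding T_def using cos[OF that]
      by (auto intro!: derivative_eq_intros simp: tan_sec divide_inverse power_inverse)
    let ?D = "\<lambda>t. 2 * \<omega> * (f t - m) * f' t * T t + \<omega>\<^sup>2 * (f t - m)\<^sup>2 * (1 + (T t)\<^sup>2)"
    have "(?D has_integral (\<omega> * (f b - m)\<^sup>2 * T b - \<omega> * (f a - m)\<^sup>2 * T a)) {a..b}"
    proof (rule fundamental_theorem_of_calculus)
      fix t assume "t \<in> {a..b}"
      then have "((\<lambda>t. \<omega> * (f t - m)\<^sup>2 * T t) has_real_derivative ?D t) (at t within {a..b})"
        by (auto intro!: derivative_eq_intros has_field_derivative_at_within[OF d] dT simp: power2_eq_square algebra_simps)
      then show "((\<lambda>t. \<omega> * (f t - m)\<^sup>2 * T t) has_vector_derivative ?D t) (at t within {a..b})"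
        by (simp add: has_real_derivative_iff_has_vector_derivative)
    qed (use ab in simp)
    then have D: "(?D has_integral 0) {a..b}" by (simp add: z)
    have i1: "(\<lambda>t. (f' t)\<^sup>2) integrable_on {a..b}" and i2: "(\<lambda>t. (f t - m)\<^sup>2) integrable_on {a..b}"
      and i3: "(\<lambda>t. (f' t + \<omega> * (f t - m) * T t)\<^sup>2) integrable_on {a..b}"
      by (intro integrable_continuous_interval continuous_intros cf cf' cT)+
    have "((\<lambda>t. (f' t)\<^sup>2 - \<omega>\<^sup>2 * (f t - m)\<^sup>2 + ?D t) has_integral
       integral {a..b} (\<lambda>t. (f' t)\<^sup>2) - \<omega>\<^sup>2 * integral {a..b} (\<lambda>t. (f t - m)\<^sup>2) + 0) {a..b}"
      by (intro has_integral_add has_integral_diff has_integral_mult_right D integrable_integral i1 i2)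
    moreover have "(f' t)\<^sup>2 - \<omega>\<^sup>2 * (f t - m)\<^sup>2 + ?D t = (f' t + \<omega> * (f t - m) * T t)\<^sup>2" for t
      by (simp add: power2_eq_square algebra_simps)
    ultimately have "integral {a..b} (\<lambda>t. (f' t)\<^sup>2) - \<omega>\<^sup>2 * integral {a..b} (\<lambda>t. (f t - m)\<^sup>2)
      = integral {a..b} (\<lambda>t. (f' t + \<omega> * (f t - m) * T t)\<^sup>2)"
      by (simp add: integral_unique)
    also have "\<dots> \<ge> 0" by (intro integral_nonneg i3) auto
    finally show ?thesis by simp
  qed
  \<comment> \<open>The sharp constant, at which the tangent has poles at both ends, is reached as a
    limit from the left.\<close>
  have "((\<lambda>\<omega>. \<omega>\<^sup>2 * integral {a..b} (\<lambda>t. (f t - m)\<^sup>2)) \<longlongrightarrow>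
     (pi / (b - a))\<^sup>2 * integral {a..b} (\<lambda>t. (f t - m)\<^sup>2)) (at_left (pi / (b - a)))"
    by (intro tendsto_intros)
  moreover have "\<forall>\<^sub>F \<omega> in at_left (pi / (b - a)). \<omega>\<^sup>2 * integral {a..b} (\<lambda>t. (f t - m)\<^sup>2) \<le> integral {a..b} (\<lambda>t. (f' t)\<^sup>2)"
    using eventually_at_left_real[of 0 "pi / (b - a)"] ab by (auto elim!: eventually_mono simp: ineq)
  ultimately show ?thesis
    by (rule tendsto_upperbound) simp
qed

lemma integral_periodic_shift:
  fixes f :: "real \<Rightarrow> real"
  assumes c: "continuous_on UNIV f" and p: "\<And>t. f (t + L) = f t" and L: "L > 0" and a: "0 \<le> a"
  shows "integral {a..a + L} f = integral {0..L} f"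
proof -
  have i: "f integrable_on {s..t}" for s t
    by (intro integrable_continuous_interval continuous_on_subset[OF c]) auto
  have "integral {0..a + L} f = integral {0..a} f + integral {a..a + L} f"
    using Henstock_Kurzweil_Integration.integral_combine[of 0 a "a + L" f] a L i by simp
  moreover have "integral {0..a + L} f = integral {0..L} f + integral {L..a + L} f"
    using Henstock_Kurzweil_Integration.integral_combine[of 0 L "a + L" f] a L i by simp
  moreover have "integral {L..a + L} f = integral {0..a} f"
    using integral_shift_Icc_real[of 0 a f L] p by (simp add: o_def add.commute)
  ultimately show ?thesis by simp
qed

text \<open>A proof without Fourier series: \<open>f\<close> takes one value \<open>m\<close> at two
  points half a period apart, and on each of the two half periods \<open>f - m\<close> satisfies the
  Dirichlet inequality with constant \<pi> / (L/2) = 2\<pi> / L.\<close>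

lemma wirtinger:
  fixes f f' :: "real \<Rightarrow> real"
  assumes d: "\<And>t. (f has_real_derivative f' t) (at t)" and cont: "continuous_on UNIV f'"
    and p: "\<And>t. f (t + L) = f t" "\<And>t. f' (t + L) = f' t" and L: "L > 0" and mean: "integral {0..L} f = 0"
  shows "(2 * pi / L)\<^sup>2 * integral {0..L} (\<lambda>t. (f t)\<^sup>2) \<le> integral {0..L} (\<lambda>t. (f' t)\<^sup>2)"
proof -
  have cf: "continuous_on T f" and cf': "continuous_on T f'" for T
    using d cont by (meson DERIV_continuous_on has_field_derivative_at_within continuous_on_subset top_greatest)+
  \<comment> \<open>Shifting by half a period changes the sign of this difference, so the
    intermediate value theorem gives a zero.\<close>
  let ?u = "\<lambda>t. f t - f (t + L / 2)"
  have "\<exists>t. 0 \<le> t \<and> t \<le> L / 2 \<and> ?u t = 0"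
  proof -
    have cu: "continuous_on T ?u" for T
      by (intro continuous_intros cf continuous_on_compose2[OF cf[of UNIV]]) auto
    have "?u (L / 2) = - ?u 0" using p(1)[of 0] by simp
    then consider "?u 0 \<le> 0" "0 \<le> ?u (L / 2)" | "?u (L / 2) \<le> 0" "0 \<le> ?u 0" by linarith
    then show ?thesis
      using IVT'[of ?u 0 0 "L / 2"] IVT2'[of ?u "L / 2" 0 0] cu L by cases auto
  qed
  then obtain a where a: "0 \<le> a" "f a = f (a + L / 2)" by auto
  define m where "m = f a"
  have mid: "f (a + L / 2) = m" "f (a + L) = m" using a(2) p(1)[of a] by (simp_all add: m_def)
  have 1: "(2 * pi / L)\<^sup>2 * integral {a..a + L / 2} (\<lambda>t. (f t - m)\<^sup>2) \<le> integral {a..a + L / 2} (\<lambda>t. (f' t)\<^sup>2)"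
    using wirtinger_dirichlet[OF d cont, of a "a + L / 2" m] L mid by (simp add: m_def mult.commute)
  have 2: "(2 * pi / L)\<^sup>2 * integral {a + L / 2..a + L} (\<lambda>t. (f t - m)\<^sup>2) \<le> integral {a + L / 2..a + L} (\<lambda>t. (f' t)\<^sup>2)"
  proof -
    have "pi / (a + L - (a + L / 2)) = 2 * pi / L" using L by (simp add: field_simps)
    then show ?thesis
      using wirtinger_dirichlet[OF d cont _ mid] L by (simp add: mult.commute)
  qed
  have i: "h integrable_on {s..t}" if "continuous_on UNIV h" for h :: "real \<Rightarrow> real" and s t
    by (intro integrable_continuous_interval continuous_on_subset[OF that]) auto
  have comb: "integral {a..a + L / 2} h + integral {a + L / 2..a + L} h = integral {0..L} h"
    if "continuous_on UNIV h" "\<And>t. h (t + L) = h t" for h :: "real \<Rightarrow> real"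
    using Henstock_Kurzweil_Integration.integral_combine[of a "a + L / 2" "a + L" h] i[OF that(1)] L
      integral_periodic_shift[OF that L a(1)] by simp
  \<comment> \<open>Because \<open>f\<close> has mean zero, subtracting \<open>m\<close> can only
    increase the square integral, so the inequality for \<open>f - m\<close> implies the one for
    \<open>f\<close>.\<close>
  have e1: "integral {0..L} (\<lambda>t. (f t - m)\<^sup>2) = integral {0..L} (\<lambda>t. (f t)\<^sup>2) + m\<^sup>2 * L"
  proof -
    have "integral {0..L} (\<lambda>t. (f t - m)\<^sup>2) = integral {0..L} (\<lambda>t. (f t)\<^sup>2 - 2 * m * f t + m\<^sup>2)"
      by (simp add: power2_eq_square algebra_simps)
    also have "\<dots> = integral {0..L} (\<lambda>t. (f t)\<^sup>2) - 2 * m * integral {0..L} f + m\<^sup>2 * L"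
      using L by (subst integral_add, (intro i continuous_intros cf)+, subst integral_diff, (intro i continuous_intros cf)+)
        (simp add: mult.commute)
    finally show ?thesis by (simp add: mean)
  qed
  have "(2 * pi / L)\<^sup>2 * integral {0..L} (\<lambda>t. (f t)\<^sup>2) \<le> (2 * pi / L)\<^sup>2 * integral {0..L} (\<lambda>t. (f t - m)\<^sup>2)"
    unfolding e1 using L by (intro mult_left_mono) auto
  also have "\<dots> \<le> integral {0..L} (\<lambda>t. (f' t)\<^sup>2)"
    using add_mono[OF 1 2] comb[of "\<lambda>t. (f t - m)\<^sup>2"] comb[of "\<lambda>t. (f' t)\<^sup>2"] p cf cf'
    by (simp add: continuous_intros ring_distribs[symmetric] del: power_divide)
  finally show ?thesis .
qed

section \<open>Equality in Wirtinger's inequality\<close>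

lemma integrable_smooth: "smooth f \<Longrightarrow> f integrable_on {a..b::real}" for f :: "real \<Rightarrow> 'b::euclidean_space"
  by (intro integrable_continuous_interval smooth_continuous_on)

lemma wirtinger_vec:
  fixes f :: "real \<Rightarrow> real^'n"
  assumes f: "smooth f" and p: "\<And>t. f (t + L) = f t" and L: "L > 0" and mean: "integral {0..L} f = 0"
  shows "(2 * pi / L)\<^sup>2 * integral {0..L} (\<lambda>t. f t \<bullet> f t) \<le> integral {0..L} (\<lambda>t. vd f t \<bullet> vd f t)"
proof -
  have bl: "bounded_linear (\<lambda>v::real^'n. v $ i)" for i by (rule bounded_linear_vec_nth)
  have s: "smooth (\<lambda>t. f t $ i)" "smooth (\<lambda>t. vd f t $ i)" for i
    by (intro bounded_linear.smooth_image[OF bl] f smooth_vd)+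
  have comp: "(2 * pi / L)\<^sup>2 * integral {0..L} (\<lambda>t. (f t $ i)\<^sup>2) \<le> integral {0..L} (\<lambda>t. (vd f t $ i)\<^sup>2)" for i
  proof (rule wirtinger)
    show "((\<lambda>t. f t $ i) has_real_derivative vd f t $ i) (at t)" for t
      unfolding has_real_derivative_iff_has_vector_derivative
      by (rule bounded_linear.has_vector_derivative[OF bl smooth_has_vd[OF f]])
    show "continuous_on UNIV (\<lambda>t. vd f t $ i)" by (rule smooth_continuous_on[OF s(2)])
    show "integral {0..L} (\<lambda>t. f t $ i) = 0"
      using integral_linear[OF integrable_smooth[OF f] bl, of 0 L i] mean by (simp add: o_def)
  qed (use p L vd_periodic[OF f p] in auto)
  have e: "integral {0..L} (\<lambda>t. h t \<bullet> h t) = (\<Sum>i\<in>UNIV. integral {0..L} (\<lambda>t. (h t $ i)\<^sup>2))" if "smooth h" for h :: "real \<Rightarrow> real^'n"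
    unfolding inner_vec_def inner_real_def power2_eq_square
    by (intro integral_sum integrable_smooth smooth_mult bounded_linear.smooth_image[OF bl] that) simp
  show ?thesis
    unfolding e[OF f] e[OF smooth_vd[OF f]] sum_distrib_left by (intro sum_mono comp)
qed

lemma periodic_zero_everywhere:
  fixes h :: "real \<Rightarrow> 'b::zero"
  assumes p: "\<And>t. h (t + L) = h t" and L: "L > 0" and z: "\<And>t. t \<in> {0..L} \<Longrightarrow> h t = 0"
  shows "h t = 0"
proof -
  interpret periodic_fun_simple h L using p by unfold_locales
  define n where "n = \<lfloor>t / L\<rfloor>"
  have n: "of_int n \<le> t / L" "t / L < of_int n + 1" unfolding n_def by linarith+
  then have "t - of_int n * L \<in> {0..L}" using L by (simp add: field_simps)
  then show ?thesis using z[of "t - of_int n * L"] minus_of_int[of t n] by simp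
qed

lemma integral_inner_zero_imp_zero:
  fixes h :: "real \<Rightarrow> 'b::euclidean_space"
  assumes h: "smooth h" and L: "L > 0" and z: "integral {0..L} (\<lambda>t. h t \<bullet> h t) = 0" and p: "\<And>t. h (t + L) = h t"
  shows "h t = 0"
proof (rule periodic_zero_everywhere[where h=h, OF p L])
  fix t assume t: "t \<in> {0..L}"
  have c: "continuous_on T (\<lambda>t. h t \<bullet> h t)" for T by (intro smooth_continuous_on smooth_inner h)
  have "((\<lambda>t. h t \<bullet> h t) has_integral 0) (cbox 0 L)"
    using integrable_integral[OF integrable_continuous_interval[OF c], of 0 L] z by simp
  from has_integral_0_cbox_imp_0[OF c _ this] t L show "h t = 0" by (simp add: box_real)
qed

text \<open>An extremal of the Wirtinger quotient is a critical point of it; testing against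
  the residual \<open>f'' + \<omega>\<^sup>2 f\<close> itself shows that the residual vanishes.\<close>

lemma wirtinger_vec_eq:
  fixes f :: "real \<Rightarrow> real^'n"
  assumes f: "smooth f" and p: "\<And>t. f (t + L) = f t" and L: "L > 0" and mean: "integral {0..L} f = 0"
    and eq: "(2 * pi / L)\<^sup>2 * integral {0..L} (\<lambda>t. f t \<bullet> f t) = integral {0..L} (\<lambda>t. vd f t \<bullet> vd f t)"
  shows "vd (vd f) t = - ((2 * pi / L)\<^sup>2) *\<^sub>R f t"
proof -
  define \<omega> where "\<omega> = (2 * pi / L)\<^sup>2"
  define h where "h = (\<lambda>t. vd (vd f) t + \<omega> *\<^sub>R f t)"
  have h: "smooth h" unfolding h_def by (intro smooth_add smooth_scaleR smooth_vd f smooth_const)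
  have p1: "vd f (t + L) = vd f t" for t by (rule vd_periodic[OF f p])
  have p2: "vd (vd f) (t + L) = vd (vd f) t" for t by (rule vd_periodic[OF smooth_vd[OF f] p1])
  have ph: "h (t + L) = h t" for t by (simp add: h_def p p2)
  have mh: "integral {0..L} h = 0"
  proof -
    have "integral {0..L} h = integral {0..L} (vd (vd f)) + \<omega> *\<^sub>R integral {0..L} f"
      unfolding h_def by (subst integral_add) (auto intro!: integrable_smooth smooth_scaleR smooth_vd f)
    then show ?thesis using integral_vd[OF smooth_vd[OF f], of 0 L] p1[of 0] L mean by simp
  qed
  define H where "H = integral {0..L} (\<lambda>t. h t \<bullet> h t)"
  define Q where "Q = integral {0..L} (\<lambda>t. vd h t \<bullet> vd h t) - \<omega> * H"
  note sm = smooth_inner smooth_scaleR smooth_const smooth_vd f h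
  note I = integrable_smooth[OF smooth_inner]
  have B: "integral {0..L} (\<lambda>t. vd f t \<bullet> vd h t) = - integral {0..L} (\<lambda>t. vd (vd f) t \<bullet> h t)"
  proof -
    have "vd (\<lambda>t. vd f t \<bullet> h t) = (\<lambda>t. vd f t \<bullet> vd h t + vd (vd f) t \<bullet> h t)"
      by (intro vd_inner sm)
    moreover have "integral {0..L} (vd (\<lambda>t. vd f t \<bullet> h t)) = 0"
      using integral_vd[of "\<lambda>t. vd f t \<bullet> h t" 0 L] L p1[of 0] ph[of 0] by (simp add: sm)
    ultimately have "integral {0..L} (\<lambda>t. vd f t \<bullet> vd h t + vd (vd f) t \<bullet> h t) = 0" by simp
    then show ?thesis
      by (subst (asm) integral_add) (auto intro!: I sm)
  qed
  have Hs: "H = integral {0..L} (\<lambda>t. vd (vd f) t \<bullet> h t) + \<omega> * integral {0..L} (\<lambda>t. f t \<bullet> h t)"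
  proof -
    have "H = integral {0..L} (\<lambda>t. vd (vd f) t \<bullet> h t + \<omega> *\<^sub>R (f t \<bullet> h t))"
      unfolding H_def by (rule integral_cong) (simp add: h_def inner_add_left)
    then show ?thesis
      using integral_add[OF I[OF smooth_vd[OF smooth_vd[OF f]] h] integrable_cmul[OF I[OF f h]], of 0 L \<omega>] by simp
  qed
  have exp: "integral {0..L} (\<lambda>t. (a t + \<epsilon> *\<^sub>R b t) \<bullet> (a t + \<epsilon> *\<^sub>R b t))
     = integral {0..L} (\<lambda>t. a t \<bullet> a t) + 2 * \<epsilon> * integral {0..L} (\<lambda>t. a t \<bullet> b t) + \<epsilon>\<^sup>2 * integral {0..L} (\<lambda>t. b t \<bullet> b t)"
    if "smooth a" "smooth b" for a b :: "real \<Rightarrow> real^'n" and \<epsilon>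
  proof -
    have "integral {0..L} (\<lambda>t. (a t + \<epsilon> *\<^sub>R b t) \<bullet> (a t + \<epsilon> *\<^sub>R b t))
      = integral {0..L} (\<lambda>t. a t \<bullet> a t + (2 * \<epsilon>) * (a t \<bullet> b t) + \<epsilon>\<^sup>2 * (b t \<bullet> b t))"
      by (rule integral_cong) (simp add: inner_add_left inner_add_right inner_commute power2_eq_square algebra_simps)
    also have "\<dots> = integral {0..L} (\<lambda>t. a t \<bullet> a t) + 2 * \<epsilon> * integral {0..L} (\<lambda>t. a t \<bullet> b t) + \<epsilon>\<^sup>2 * integral {0..L} (\<lambda>t. b t \<bullet> b t)"
      by (intro integral_unique has_integral_add has_integral_mult_right integrable_integral I that)
    finally show ?thesis .
  qed
  \<comment> \<open>Wirtinger's inequality for \<open>f + \<epsilon> h\<close>: the terms of order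
    zero cancel by \<open>eq\<close>, and by \<open>B\<close> and \<open>Hs\<close> the linear terms
    combine to \<open>2 \<epsilon> H\<close>.\<close>
  have ineq: "2 * \<epsilon> * H \<le> \<epsilon>\<^sup>2 * Q" for \<epsilon>
  proof -
    let ?u = "\<lambda>t. f t + \<epsilon> *\<^sub>R h t"
    have u: "smooth ?u" by (intro smooth_add sm)
    have vu: "vd ?u = (\<lambda>t. vd f t + \<epsilon> *\<^sub>R vd h t)"
      using vd_add[OF f smooth_scaleR[OF smooth_const h], of \<epsilon>] vd_scaleR[OF smooth_const h, of \<epsilon>] by (simp add: vd_const)
    have mu: "integral {0..L} ?u = 0"
      by (subst integral_add) (auto intro!: integrable_smooth sm simp: mean mh)
    have "\<omega> * integral {0..L} (\<lambda>t. ?u t \<bullet> ?u t) \<le> integral {0..L} (\<lambda>t. vd ?u t \<bullet> vd ?u t)"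
      unfolding \<omega>_def by (rule wirtinger_vec[OF u _ L mu]) (simp add: p ph)
    then have "\<omega> * (integral {0..L} (\<lambda>t. f t \<bullet> f t) + 2 * \<epsilon> * integral {0..L} (\<lambda>t. f t \<bullet> h t) + \<epsilon>\<^sup>2 * H)
      \<le> integral {0..L} (\<lambda>t. vd f t \<bullet> vd f t) + 2 * \<epsilon> * integral {0..L} (\<lambda>t. vd f t \<bullet> vd h t) + \<epsilon>\<^sup>2 * integral {0..L} (\<lambda>t. vd h t \<bullet> vd h t)"
      unfolding vu exp[OF f h] exp[OF smooth_vd[OF f] smooth_vd[OF h]] H_def .
    then show ?thesis
      unfolding B eq[folded \<omega>_def, symmetric] Hs Q_def
      by (simp add: algebra_simps Hs[symmetric])
  qed
  have "H \<ge> 0" unfolding H_def by (intro integral_nonneg I h) auto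
  have "H = 0"
  proof (rule ccontr)
    assume "H \<noteq> 0"
    with \<open>H \<ge> 0\<close> have "H > 0" by simp
    then have "Q > 0" using ineq[of 1] by simp
    \<comment> \<open>This \<epsilon> minimises \<open>\<epsilon>^2 Q - 2 \<epsilon> H\<close>; the
      minimum is \<open>- H^2 / Q\<close>.\<close>
    have "2 * (H / Q) * H \<le> (H / Q)\<^sup>2 * Q" by (rule ineq)
    also have "\<dots> = (H / Q) * H" using \<open>Q > 0\<close> by (simp add: power2_eq_square)
    finally have "(H / Q) * H \<le> 0" by simp
    then show False using \<open>H > 0\<close> \<open>Q > 0\<close> by (simp add: mult_le_0_iff divide_le_0_iff)
  qed
  from integral_inner_zero_imp_zero[OF h L this[unfolded H_def] ph, of t]
  show ?thesis by (simp add: h_def \<omega>_def add_eq_0_iff)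
qed

section \<open>Integrating the oscillator equation\<close>

lemma vector_derivative_zero_eq:
  fixes f :: "real \<Rightarrow> 'b::real_normed_vector"
  assumes "\<And>t. (f has_vector_derivative 0) (at t)"
  shows "f s = f t"
proof -
  obtain c where "\<And>t. t \<in> UNIV \<Longrightarrow> f t = c"
    by (rule has_vector_derivative_zero_constant[OF convex_UNIV, of f]) (use assms in auto)
  then show ?thesis by simp
qed

text \<open>Rotating the pair of \<open>f\<close> and its derivative back by the angle
  \<open>\<omega> t\<close> gives two conserved quantities \<open>A\<close> and \<open>B\<close>;
  rotating forward again expresses \<open>f\<close> through its initial data.\<close>

lemma harmonic_oscillator:
  fixes f :: "real \<Rightarrow> 'b::real_normed_vector"
  assumes f: "smooth f" and ode: "\<And>t. vd (vd f) t = - (\<omega>\<^sup>2) *\<^sub>R f t" and w: "\<omega> \<noteq> 0"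
  shows "f t = cos (\<omega> * t) *\<^sub>R f 0 + (sin (\<omega> * t) / \<omega>) *\<^sub>R vd f 0"
proof -
  define A where "A = (\<lambda>t. cos (\<omega> * t) *\<^sub>R f t - (sin (\<omega> * t) / \<omega>) *\<^sub>R vd f t)"
  define B where "B = (\<lambda>t. (\<omega> * sin (\<omega> * t)) *\<^sub>R f t + cos (\<omega> * t) *\<^sub>R vd f t)"
  have df: "(f has_vector_derivative vd f t) (at t)" and df': "(vd f has_vector_derivative vd (vd f) t) (at t)" for t
    by (intro smooth_has_vd f smooth_vd)+
  have dc: "((\<lambda>t. cos (\<omega> * t)) has_real_derivative - \<omega> * sin (\<omega> * t)) (at t)"
    and ds: "((\<lambda>t. sin (\<omega> * t) / \<omega>) has_real_derivative cos (\<omega> * t)) (at t)"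
    and ds': "((\<lambda>t. \<omega> * sin (\<omega> * t)) has_real_derivative \<omega>\<^sup>2 * cos (\<omega> * t)) (at t)" for t
    using w by (auto intro!: derivative_eq_intros simp: power2_eq_square)
  have "(A has_vector_derivative (cos (\<omega> * t) *\<^sub>R vd f t + (- \<omega> * sin (\<omega> * t)) *\<^sub>R f t)
      - ((sin (\<omega> * t) / \<omega>) *\<^sub>R vd (vd f) t + cos (\<omega> * t) *\<^sub>R vd f t)) (at t)" for t
    unfolding A_def
    by (rule has_vector_derivative_diff[OF has_vector_derivative_scaleR[OF dc df] has_vector_derivative_scaleR[OF ds df']])
  then have "(A has_vector_derivative 0) (at t)" for t
    unfolding ode using w by (simp add: power2_eq_square mult.commute)
  then have A: "A t = A 0" for t
    by (rule vector_derivative_zero_eq)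
  have "(B has_vector_derivative ((\<omega> * sin (\<omega> * t)) *\<^sub>R vd f t + (\<omega>\<^sup>2 * cos (\<omega> * t)) *\<^sub>R f t)
      + (cos (\<omega> * t) *\<^sub>R vd (vd f) t + (- \<omega> * sin (\<omega> * t)) *\<^sub>R vd f t)) (at t)" for t
    unfolding B_def
    by (rule has_vector_derivative_add[OF has_vector_derivative_scaleR[OF ds' df] has_vector_derivative_scaleR[OF dc df']])
  then have "(B has_vector_derivative 0) (at t)" for t
    unfolding ode by (simp add: mult.commute)
  then have B: "B t = B 0" for t
    by (rule vector_derivative_zero_eq)
  have "cos (\<omega> * t) *\<^sub>R A t + (sin (\<omega> * t) / \<omega>) *\<^sub>R B t
     = (cos (\<omega> * t) * cos (\<omega> * t) + sin (\<omega> * t) * sin (\<omega> * t)) *\<^sub>R f t"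
    using w by (simp add: A_def B_def algebra_simps del: sin_cos_squared_add3)
  also have "\<dots> = f t" by simp
  finally show ?thesis unfolding A[of t] B[of t] by (simp add: A_def B_def)
qed

section \<open>Length estimates and the extremal circles\<close>

context sphere_curve begin

lemma integral_g2g2: "integral {0..L} (\<lambda>s. vd (vd g) s \<bullet> vd (vd g) s) = L + integral {0..L} k2"
proof -
  have "integral {0..L} (\<lambda>s. vd (vd g) s \<bullet> vd (vd g) s) = integral {0..L} (\<lambda>s. 1 + k2 s)"
    by (rule integral_cong) (simp add: k2_eq)
  also have "\<dots> = L + integral {0..L} k2"
    by (subst integral_add) (use L_pos in \<open>auto intro!: integrable_smooth smooth_k2\<close>)
  finally show ?thesis .
qed

lemma integral_g1: "integral {0..L} (vd g) = 0"
  using integral_vd[OF smooth_g, of 0 L] periodic[of 0] L_pos by simp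

text \<open>The tangent has mean zero because the curve closes up, and \<gamma>'' has squared norm
  \<open>1 + k2\<close>. The bound serves both factors: for a geodesic it says that the length is at
  least 2\<pi>.\<close>

lemma length_bound: "4 * pi\<^sup>2 \<le> L * (L + integral {0..L} k2)"
proof -
  have "(2 * pi / L)\<^sup>2 * integral {0..L} (\<lambda>t. vd g t \<bullet> vd g t) \<le> integral {0..L} (\<lambda>t. vd (vd g) t \<bullet> vd (vd g) t)"
    by (intro wirtinger_vec smooth_g1 vd_periodic[OF smooth_g periodic] L_pos integral_g1)
  then have "(2 * pi / L)\<^sup>2 * L \<le> L + integral {0..L} k2"
    using L_pos by (simp add: g1g1 integral_g2g2)
  moreover have "(2 * pi / L)\<^sup>2 * L = 4 * pi\<^sup>2 / L" using L_pos by (simp add: power2_eq_square field_simps)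
  ultimately show ?thesis using L_pos by (simp add: pos_divide_le_eq mult.commute)
qed

lemma length_bound_eq:
  assumes "4 * pi\<^sup>2 = L * (L + integral {0..L} k2)"
  shows "vd (vd (vd g)) s = - ((2 * pi / L)\<^sup>2) *\<^sub>R vd g s"
proof (rule wirtinger_vec_eq[OF smooth_g1 vd_periodic[OF smooth_g periodic] L_pos integral_g1])
  have "(2 * pi / L)\<^sup>2 * L = 4 * pi\<^sup>2 / L" using L_pos by (simp add: power2_eq_square field_simps)
  also have "\<dots> = L + integral {0..L} k2" unfolding assms using L_pos by simp
  finally show "(2 * pi / L)\<^sup>2 * integral {0..L} (\<lambda>t. vd g t \<bullet> vd g t) = integral {0..L} (\<lambda>t. vd (vd g) t \<bullet> vd (vd g) t)"
    using L_pos by (simp add: g1g1 integral_g2g2)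
qed

lemma great_circle:
  assumes "integral {0..L} k2 = 0"
  obtains p q where "\<And>s. g s = cos s *\<^sub>R p + sin s *\<^sub>R q" "p \<bullet> p = 1" "q \<bullet> q = 1" "p \<bullet> q = 0"
proof
  have "w s = 0" for s
    by (rule integral_inner_zero_imp_zero[OF smooth_w L_pos _ w_periodic]) (use assms in \<open>simp add: curv_sq_def\<close>)
  then have "vd (vd g) s = - (1\<^sup>2) *\<^sub>R g s" for s
    by (simp add: curv_vec_def add_eq_0_iff)
  from harmonic_oscillator[OF smooth_g this one_neq_zero, unfolded mult_1 div_by_1]
  show "g s = cos s *\<^sub>R g 0 + sin s *\<^sub>R vd g 0" for s by blast
qed (simp_all add: gg g1g1 gg1)

lemma small_circle:
  assumes L: "L = 2 * pi / sqrt 3" and I: "integral {0..L} k2 = 2 * L"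
  obtains a b e where "\<And>s. g s = (1 / sqrt 3) *\<^sub>R (cos (sqrt 3 * s) *\<^sub>R a + sin (sqrt 3 * s) *\<^sub>R b + sqrt 2 *\<^sub>R e)"
    "a \<bullet> a = 1" "b \<bullet> b = 1" "e \<bullet> e = 1" "a \<bullet> b = 0" "a \<bullet> e = 0" "b \<bullet> e = 0"
proof -
  have "2 * pi / L = sqrt 3" by (simp add: L)
  moreover have "4 * pi\<^sup>2 = L * (L + integral {0..L} k2)"
    unfolding I by (simp add: L power2_eq_square)
  ultimately have ode: "vd (vd (vd g)) s = - ((sqrt 3)\<^sup>2) *\<^sub>R vd g s" for s
    using length_bound_eq[of s] by simp
  define f0 where "f0 = vd g 0"
  define f1 where "f1 = vd (vd g) 0"
  have sol: "vd g s = cos (sqrt 3 * s) *\<^sub>R f0 + (sin (sqrt 3 * s) / sqrt 3) *\<^sub>R f1" for s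
    unfolding f0_def f1_def by (rule harmonic_oscillator[OF smooth_g1 ode]) simp
  \<comment> \<open>\<open>\<gamma>\<close> minus the explicit antiderivative of \<open>sol\<close>;
    being constant, \<open>v\<close> is the centre of the circle.\<close>
  define v where "v = (\<lambda>s. g s - (sin (sqrt 3 * s) / sqrt 3) *\<^sub>R f0 + (cos (sqrt 3 * s) / 3) *\<^sub>R f1)"
  have dc: "((\<lambda>s. cos (sqrt 3 * s) / 3) has_real_derivative - (sin (sqrt 3 * s) / sqrt 3)) (at s)"
    and ds: "((\<lambda>s. sin (sqrt 3 * s) / sqrt 3) has_real_derivative cos (sqrt 3 * s)) (at s)" for s
    by (auto intro!: derivative_eq_intros simp: field_simps)
  have "(v has_vector_derivative vd g s - ((sin (sqrt 3 * s) / sqrt 3) *\<^sub>R 0 + cos (sqrt 3 * s) *\<^sub>R f0)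
     + ((cos (sqrt 3 * s) / 3) *\<^sub>R 0 + (- (sin (sqrt 3 * s) / sqrt 3)) *\<^sub>R f1)) (at s)" for s
    unfolding v_def
    by (rule has_vector_derivative_add[OF has_vector_derivative_diff[OF smooth_has_vd[OF smooth_g]
          has_vector_derivative_scaleR[OF ds has_vector_derivative_const]] has_vector_derivative_scaleR[OF dc has_vector_derivative_const]])
  then have "(v has_vector_derivative 0) (at s)" for s
    by (simp add: sol)
  then have v: "v s = v 0" for s
    by (rule vector_derivative_zero_eq)
  \<comment> \<open>After a quarter turn only \<open>f1 / sqrt 3\<close> is left of the tangent,
    which has unit length.\<close>
  have f11: "f1 \<bullet> f1 = 3"
    using g1g1[of "pi / 2 / sqrt 3"] by (simp add: sol)
  have f00: "f0 \<bullet> f0 = 1" and f01: "f0 \<bullet> f1 = 0" "f1 \<bullet> f0 = 0"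
    using g1g1[of 0] g1g2[of 0] by (simp_all add: f0_def f1_def inner_commute)
  have g0: "g 0 \<bullet> f0 = 0" "g 0 \<bullet> f1 = -1" "f1 \<bullet> g 0 = -1"
    using gg1[of 0] gg2[of 0] by (simp_all add: f0_def f1_def inner_commute)
  have v0: "v 0 = g 0 + (1/3) *\<^sub>R f1" by (simp add: v_def)
  \<comment> \<open>The value 2/3 is 1 - 2/3 + 1/3, from expanding \<open>g 0 + f1 / 3\<close>; it
    explains the \<open>sqrt 2 / sqrt 3\<close> in the Ejiri torus.\<close>
  have vv: "v 0 \<bullet> v 0 = 2/3" "v 0 \<bullet> f0 = 0" "v 0 \<bullet> f1 = 0" "f0 \<bullet> v 0 = 0" "f1 \<bullet> v 0 = 0"
    unfolding v0 by (simp_all add: inner_add_left inner_add_right gg g0 f11 f01 g0(1)[unfolded inner_commute[of "g 0"]])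
  show thesis
  proof
    show "g s = (1 / sqrt 3) *\<^sub>R (cos (sqrt 3 * s) *\<^sub>R (- (1 / sqrt 3) *\<^sub>R f1) + sin (sqrt 3 * s) *\<^sub>R f0
        + sqrt 2 *\<^sub>R ((sqrt 3 / sqrt 2) *\<^sub>R v 0))" for s
    proof -
      have "g s = v 0 + (sin (sqrt 3 * s) / sqrt 3) *\<^sub>R f0 - (cos (sqrt 3 * s) / 3) *\<^sub>R f1"
        unfolding v[of s, symmetric] by (simp add: v_def)
      then show ?thesis by (simp add: algebra_simps)
    qed
    show "(sqrt 3 / sqrt 2) *\<^sub>R v 0 \<bullet> (sqrt 3 / sqrt 2) *\<^sub>R v 0 = 1" 
      using arg_cong2[of "sqrt 3 * sqrt 3" 3 "sqrt 2 * sqrt 2" 2 "(/)"]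
      by (simp only: inner_scaleR_left inner_scaleR_right vv(1) times_divide_eq_left times_divide_eq_right) simp
  qed (simp_all add: f11 f00 f01 vv(2-))
qed

end

section \<open>The lower bound\<close>

text \<open>Write \<open>L + I/4\<close> as \<open>3L/4 + (L + I)/4\<close>. The AM-GM inequality
  for these summands, in the exact form \<open>X2\<close>, bounds its square below by
  \<open>(3/4) L (L + I)\<close>, hence by 3 \<pi>^2. The defect is the square of
  \<open>2 L - I\<close>, so equality forces \<open>I = 2 L\<close>.\<close>

lemma length_energy_bound:
  fixes L I M :: real
  assumes "L > 0" "I \<ge> 0" and LI: "4 * pi\<^sup>2 \<le> L * (L + I)" and M: "M \<ge> 2 * pi"
  shows "M * (L + I / 4) \<ge> 2 * pi\<^sup>2 * sqrt 3"
    and "M * (L + I / 4) = 2 * pi\<^sup>2 * sqrt 3 \<Longrightarrow> M = 2 * pi \<and> L = 2 * pi / sqrt 3 \<and> I = 2 * L"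
proof -
  define X where "X = L + I / 4"
  have X2: "16 * X\<^sup>2 = (2 * L - I)\<^sup>2 + 12 * (L * (L + I))"
    by (simp add: X_def power2_eq_square algebra_simps)
  have "(sqrt 3 * pi)\<^sup>2 \<le> X\<^sup>2"
    unfolding power_mult_distrib real_sqrt_pow2[OF zero_le_numeral]
    using X2 LI zero_le_power2[of "2 * L - I"] by linarith
  then have X: "sqrt 3 * pi \<le> X"
    by (rule power2_le_imp_le) (use assms in \<open>simp add: X_def\<close>)
  have e: "2 * pi\<^sup>2 * sqrt 3 = (2 * pi) * (sqrt 3 * pi)" by (simp add: power2_eq_square)
  show "M * (L + I / 4) \<ge> 2 * pi\<^sup>2 * sqrt 3"
    unfolding e X_def[symmetric]
    by (rule mult_mono[OF M X]) (use M pi_ge_zero in \<open>linarith, simp\<close>)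
  assume "M * (L + I / 4) = 2 * pi\<^sup>2 * sqrt 3"
  then have eq: "M * X = (2 * pi) * (sqrt 3 * pi)" unfolding e X_def .
  have "X > 0" using X by (meson less_le_trans mult_pos_pos pi_gt_zero real_sqrt_gt_zero zero_less_numeral)
  have M': "M = 2 * pi"
  proof (rule ccontr)
    assume "M \<noteq> 2 * pi"
    then have "(2 * pi) * X < M * X" using M \<open>X > 0\<close> by simp
    moreover have "(2 * pi) * (sqrt 3 * pi) \<le> (2 * pi) * X" using X by simp
    ultimately show False using eq by simp
  qed
  with eq have X': "X = sqrt 3 * pi" by simp
  have "48 * pi\<^sup>2 = (2 * L - I)\<^sup>2 + 12 * (L * (L + I))"
    using X2 unfolding X' power_mult_distrib by simp
  then have "(2 * L - I)\<^sup>2 \<le> 0" using LI by linarith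
  then have I: "I = 2 * L" by simp
  then have "3 * L = 2 * sqrt 3 * pi" using X' by (simp add: X_def)
  then have "L = 2 * pi * (sqrt 3 / 3)" by (simp add: mult_ac)
  also have "sqrt 3 / 3 = 1 / sqrt 3" by (simp add: field_simps)
  finally show "M = 2 * pi \<and> L = 2 * pi / sqrt 3 \<and> I = 2 * L" using M' I by simp
qed

section \<open>Orthonormal frames and coordinates of the Ejiri torus\<close>

lemma UNIV_6: "(UNIV :: 6 set) = {1, 2, 3, 4, 5, 6}"
proof -
  have "x \<in> {1, 2, 3, 4, 5, 6}" for x :: 6
  proof (induct x)
    case (of_int z)
    then have "z = 0 \<or> z = 1 \<or> z = 2 \<or> z = 3 \<or> z = 4 \<or> z = 5" by fastforce
    then show ?case by auto
  qed
  then show ?thesis by blast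
qed

lemma inner_6: "(v :: real^6) \<bullet> w = v $ 1 * w $ 1 + v $ 2 * w $ 2 + v $ 3 * w $ 3 + v $ 4 * w $ 4 + v $ 5 * w $ 5 + v $ 6 * w $ 6"
  unfolding inner_vec_def UNIV_6 by simp

lemma ejiri_nth:
  "ejiri p $ 1 = cos (snd p) * cos (sqrt 3 * fst p) / sqrt 3"
  "ejiri p $ 2 = sin (snd p) * cos (sqrt 3 * fst p) / sqrt 3"
  "ejiri p $ 3 = cos (snd p) * sin (sqrt 3 * fst p) / sqrt 3"
  "ejiri p $ 4 = sin (snd p) * sin (sqrt 3 * fst p) / sqrt 3"
  "ejiri p $ 5 = sqrt 2 * cos (snd p) / sqrt 3"
  "ejiri p $ 6 = sqrt 2 * sin (snd p) / sqrt 3"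
  by (simp_all add: ejiri_def vector_def case_prod_beta')

text \<open>The six products of frame vectors are orthonormal, and \<open>T\<close> sends the
  standard basis to them. The product is an arbitrary \<open>B\<close> that multiplies inner
  products, so that the flipped tensor product is covered as well.\<close>

lemma ejiri_frame:
  fixes B :: "'a::real_inner \<Rightarrow> 'b::real_inner \<Rightarrow> 'c::real_inner"
  assumes B: "bounded_bilinear B" and BB: "\<And>u u' v v'. B u v \<bullet> B u' v' = (u \<bullet> u') * (v \<bullet> v')"
    and g: "\<And>s. g s = (1 / sqrt 3) *\<^sub>R (cos (sqrt 3 * s) *\<^sub>R a + sin (sqrt 3 * s) *\<^sub>R b + sqrt 2 *\<^sub>R e)"
    and o: "a \<bullet> a = 1" "b \<bullet> b = 1" "e \<bullet> e = 1" "a \<bullet> b = 0" "a \<bullet> e = 0" "b \<bullet> e = 0"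
    and gh: "\<And>s. gh s = cos s *\<^sub>R p + sin s *\<^sub>R q" and o': "p \<bullet> p = 1" "q \<bullet> q = 1" "p \<bullet> q = 0"
  obtains T :: "real^6 \<Rightarrow> 'c" where "linear T" "\<And>v. norm (T v) = norm v" "\<And>z. B (g (fst z)) (gh (snd z)) = T (ejiri z)"
proof
  interpret bounded_bilinear B by (rule B)
  define T where "T = (\<lambda>v::real^6. v $ 1 *\<^sub>R B a p + v $ 2 *\<^sub>R B a q + v $ 3 *\<^sub>R B b p + v $ 4 *\<^sub>R B b q
     + v $ 5 *\<^sub>R B e p + v $ 6 *\<^sub>R B e q)"
  show "linear T"
    by (rule linearI) (simp_all add: T_def algebra_simps)
  show "norm (T v) = norm v" for v
  proof -
    have "T v \<bullet> T v = v \<bullet> v"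
      unfolding T_def inner_6 using o(4-)[THEN trans[OF inner_commute]] o'(3)[THEN trans[OF inner_commute]]
      by (simp only: inner_add_left inner_add_right inner_scaleR_left inner_scaleR_right BB o o') simp
    then show ?thesis by (simp add: norm_eq_sqrt_inner)
  qed
  show "B (g (fst z)) (gh (snd z)) = T (ejiri z)" for z
    unfolding g gh T_def ejiri_nth
    by (simp add: add_left add_right scaleR_left scaleR_right algebra_simps)
qed

lemma torus_reparam_id: "torus_reparam \<Lambda> \<Lambda> (\<lambda>p. p)"
proof -
  have "frechet_derivative (\<lambda>p. p) (at p) = (\<lambda>v. v)" for p :: "real \<times> real"
    by (rule frechet_derivative_at[symmetric]) simp
  then show ?thesis by (simp add: torus_reparam_def bij_def)
qed

text \<open>In the Ejiri torus the great circle is run through by the second variable; this exchange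
  serves the tori whose first factor is the great circle.\<close>

lemma torus_reparam_swap: "torus_reparam (lattice L Lh) (lattice Lh L) (\<lambda>p. (snd p, fst p))"
proof -
  have d: "frechet_derivative (\<lambda>p. (snd p, fst p)) (at p) = (\<lambda>v. (snd v, fst v))" for p :: "real \<times> real"
    by (rule frechet_derivative_at[symmetric]) (auto intro!: derivative_eq_intros)
  have "bij (\<lambda>v::real \<times> real. (snd v, fst v))"
    by (rule o_bij[where g="\<lambda>v. (snd v, fst v)"]) auto
  with d show ?thesis
    by (auto simp: torus_reparam_def smooth_swap lattice_def)
qed

section \<open>The bound when one factor is a great circle\<close>

context tensor_pair begin

lemma bound_of_great_circle_right:
  assumes "integral {0..Lh} (curv_sq gh) = 0"
  shows "willmore L Lh x \<ge> 2 * pi\<^sup>2 * sqrt 3"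
    and "willmore L Lh x = 2 * pi\<^sup>2 * sqrt 3 \<Longrightarrow> congruent_to_ejiri L Lh x"
proof -
  have W: "willmore L Lh x = Lh * (L + integral {0..L} (curv_sq g) / 4)"
    by (simp add: willmore_x assms algebra_simps)
  have "(2 * pi)\<^sup>2 \<le> Lh\<^sup>2" using ch.length_bound by (simp add: assms power2_eq_square)
  then have "2 * pi \<le> Lh" by (rule power2_le_imp_le) (use ch.L_pos in simp)
  note bd = length_energy_bound[OF c.L_pos c.integral_k2_nonneg c.length_bound this, folded W]
  show "willmore L Lh x \<ge> 2 * pi\<^sup>2 * sqrt 3" by (rule bd)
  assume "willmore L Lh x = 2 * pi\<^sup>2 * sqrt 3"
  from bd(2)[OF this] have eqs: "Lh = 2 * pi" "L = 2 * pi / sqrt 3" "integral {0..L} (curv_sq g) = 2 * L" by auto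
  obtain p q where pq: "\<And>s. gh s = cos s *\<^sub>R p + sin s *\<^sub>R q" "p \<bullet> p = 1" "q \<bullet> q = 1" "p \<bullet> q = 0"
    by (rule ch.great_circle[OF assms]) blast
  obtain a b e where abe: "\<And>s. g s = (1 / sqrt 3) *\<^sub>R (cos (sqrt 3 * s) *\<^sub>R a + sin (sqrt 3 * s) *\<^sub>R b + sqrt 2 *\<^sub>R e)"
    "a \<bullet> a = 1" "b \<bullet> b = 1" "e \<bullet> e = 1" "a \<bullet> b = 0" "a \<bullet> e = 0" "b \<bullet> e = 0"
    by (rule c.small_circle[OF eqs(2,3)]) blast
  obtain T :: "real^6 \<Rightarrow> real^('n \<times> 'm)" where T: "linear T" "\<And>v. norm (T v) = norm v"
      "\<And>z. tensor (g (fst z)) (gh (snd z)) = T (ejiri z)"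
    by (rule ejiri_frame[OF bounded_bilinear_tensor inner_tensor abe pq]) blast
  have "lattice L Lh = ejiri_lattice" by (simp add: eqs ejiri_lattice_def)
  then show "congruent_to_ejiri L Lh x"
    unfolding congruent_to_ejiri_def using T torus_reparam_id[of "lattice L Lh"] by auto
qed

lemma bound_of_great_circle_left:
  assumes "integral {0..L} (curv_sq g) = 0"
  shows "willmore L Lh x \<ge> 2 * pi\<^sup>2 * sqrt 3"
    and "willmore L Lh x = 2 * pi\<^sup>2 * sqrt 3 \<Longrightarrow> congruent_to_ejiri L Lh x"
proof -
  have W: "willmore L Lh x = L * (Lh + integral {0..Lh} (curv_sq gh) / 4)"
    by (simp add: willmore_x assms algebra_simps)
  have "(2 * pi)\<^sup>2 \<le> L\<^sup>2" using c.length_bound by (simp add: assms power2_eq_square)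
  then have "2 * pi \<le> L" by (rule power2_le_imp_le) (use c.L_pos in simp)
  note bd = length_energy_bound[OF ch.L_pos ch.integral_k2_nonneg ch.length_bound this, folded W]
  show "willmore L Lh x \<ge> 2 * pi\<^sup>2 * sqrt 3" by (rule bd)
  assume "willmore L Lh x = 2 * pi\<^sup>2 * sqrt 3"
  from bd(2)[OF this] have eqs: "L = 2 * pi" "Lh = 2 * pi / sqrt 3" "integral {0..Lh} (curv_sq gh) = 2 * Lh" by auto
  obtain p q where pq: "\<And>s. g s = cos s *\<^sub>R p + sin s *\<^sub>R q" "p \<bullet> p = 1" "q \<bullet> q = 1" "p \<bullet> q = 0"
    by (rule c.great_circle[OF assms]) blast
  obtain a b e where abe: "\<And>s. gh s = (1 / sqrt 3) *\<^sub>R (cos (sqrt 3 * s) *\<^sub>R a + sin (sqrt 3 * s) *\<^sub>R b + sqrt 2 *\<^sub>R e)"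
    "a \<bullet> a = 1" "b \<bullet> b = 1" "e \<bullet> e = 1" "a \<bullet> b = 0" "a \<bullet> e = 0" "b \<bullet> e = 0"
    by (rule ch.small_circle[OF eqs(2,3)]) blast
  \<comment> \<open>The great circle is now on the left, so the frame is built for the product with
    its arguments exchanged, and the reparametrisation exchanges the variables.\<close>
  have flip: "tensor v u \<bullet> tensor v' u' = (u \<bullet> u') * (v \<bullet> v')" for u u' :: "real^'m" and v v' :: "real^'n"
    by (simp add: mult.commute)
  obtain T :: "real^6 \<Rightarrow> real^('n \<times> 'm)" where T: "linear T" "\<And>v. norm (T v) = norm v"
      "\<And>z. tensor (g (snd z)) (gh (fst z)) = T (ejiri z)"
    by (rule ejiri_frame[OF tensor.flip flip abe pq]) blast
  have "lattice Lh L = ejiri_lattice" by (simp add: eqs ejiri_lattice_def)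
  then show "congruent_to_ejiri L Lh x"
    unfolding congruent_to_ejiri_def using T(1,2) T(3)[of "(snd _, fst _)"] torus_reparam_swap[of L Lh]
    by (auto intro!: exI[of _ T] exI[of _ "\<lambda>p. (snd p, fst p)"])
qed

end

section \<open>Isometric reparametrisations\<close>

lemma partial_vector_derivative:
  assumes "smooth f"
  shows "((\<lambda>u. f (u, v)) has_vector_derivative pd f e1 (u, v)) (at u)"
    and "((\<lambda>v. f (u, v)) has_vector_derivative pd f e2 (u, v)) (at v)"
proof -
  note d = smooth_has_derivative[OF assms, of "(u, v)"]
  interpret bounded_linear "frechet_derivative f (at (u, v))" by (rule has_derivative_bounded_linear[OF d])
  have 1: "((\<lambda>u. (u, v)) has_derivative (\<lambda>h. h *\<^sub>R e1)) (at u)"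
    and 2: "((\<lambda>v. (u, v)) has_derivative (\<lambda>h. h *\<^sub>R e2)) (at v)"
    by (auto intro!: derivative_eq_intros)
  show "((\<lambda>u. f (u, v)) has_vector_derivative pd f e1 (u, v)) (at u)"
    using has_derivative_compose[OF 1 d] unfolding has_vector_derivative_def pd_def scaleR .
  show "((\<lambda>v. f (u, v)) has_vector_derivative pd f e2 (u, v)) (at v)"
    using has_derivative_compose[OF 2 d] unfolding has_vector_derivative_def pd_def scaleR .
qed

text \<open>\<open>f\<close> is written as the integral of its second partial derivative along
  vertical segments. Differentiating under the integral in the first variable and then using the
  fundamental theorem in the second gives symmetry. Starting the segments at \<open>v - 1\<close>
  makes \<open>v\<close> an interior point, so the derivative at \<open>v\<close> is
  two-sided.\<close>

lemma pd_commute: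
  fixes f :: "real \<times> real \<Rightarrow> 'b::euclidean_space"
  assumes f: "smooth f"
  shows "pd (pd f e1) e2 p = pd (pd f e2) e1 p"
proof -
  obtain u v where p: "p = (u, v)" by (cases p)
  let ?f21 = "pd (pd f e2) e1"
  note s1 = smooth_pd[OF f e1_in_Basis] and s2 = smooth_pd[OF f e2_in_Basis]
  note s21 = smooth_pd[OF s2 e1_in_Basis]
  have c: "continuous_on S (\<lambda>\<tau>. h (x, \<tau>))" if "smooth h" for h :: "real \<times> real \<Rightarrow> 'b" and x S
    by (intro continuous_on_compose2[OF smooth_continuous_on[OF that, of UNIV]] continuous_intros subset_UNIV)
  have ftc: "f (x, t) = f (x, v - 1) + integral (cbox (v - 1) t) (\<lambda>\<tau>. pd f e2 (x, \<tau>))" if "v - 1 \<le> t" for x t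
  proof -
    have "((\<lambda>\<tau>. pd f e2 (x, \<tau>)) has_integral f (x, t) - f (x, v - 1)) {v - 1..t}"
      by (rule fundamental_theorem_of_calculus[OF that])
         (rule has_vector_derivative_at_within[OF partial_vector_derivative(2)[OF f]])
    then show ?thesis by (simp add: integral_unique)
  qed
  have f1: "pd f e1 (u, t) = pd f e1 (u, v - 1) + integral {v - 1..t} (\<lambda>\<tau>. ?f21 (u, \<tau>))" if "v - 1 \<le> t" for t
  proof -
    have "((\<lambda>x. integral (cbox (v - 1) t) (\<lambda>\<tau>. pd f e2 (x, \<tau>))) has_vector_derivative
        integral (cbox (v - 1) t) (\<lambda>\<tau>. ?f21 (u, \<tau>))) (at u within UNIV)"
    proof (rule leibniz_rule_vector_derivative)
      show "((\<lambda>x. pd f e2 (x, \<tau>)) has_vector_derivative ?f21 (x, \<tau>)) (at x within UNIV)" for x \<tau>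
        using partial_vector_derivative(1)[OF s2] by simp
      show "(\<lambda>\<tau>. pd f e2 (x, \<tau>)) integrable_on cbox (v - 1) t" for x
        by (intro integrable_continuous c s2)
      show "continuous_on (UNIV \<times> cbox (v - 1) t) (\<lambda>(x, \<tau>). ?f21 (x, \<tau>))"
        using smooth_continuous_on[OF s21] by simp
    qed auto
    from has_vector_derivative_add[OF partial_vector_derivative(1)[OF f] this[simplified]]
    have "((\<lambda>x. f (x, t)) has_vector_derivative pd f e1 (u, v - 1) + integral {v - 1..t} (\<lambda>\<tau>. ?f21 (u, \<tau>))) (at u)"
      using ftc[OF that] by simp
    then show ?thesis
      using partial_vector_derivative(1)[OF f] vector_derivative_unique_at by blast
  qed
  have "((\<lambda>t. integral {v - 1..t} (\<lambda>\<tau>. ?f21 (u, \<tau>))) has_vector_derivative ?f21 (u, v)) (at v within {v - 1..v + 1})"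
    by (rule integral_has_vector_derivative) (auto intro: c s21)
  then have "((\<lambda>t. pd f e1 (u, v - 1) + integral {v - 1..t} (\<lambda>\<tau>. ?f21 (u, \<tau>))) has_vector_derivative 0 + ?f21 (u, v)) (at v within {v - 1..v + 1})"
    by (intro has_vector_derivative_add has_vector_derivative_const)
  then have "((\<lambda>t. pd f e1 (u, t)) has_vector_derivative 0 + ?f21 (u, v)) (at v within {v - 1..v + 1})"
    by (rule has_vector_derivative_transform[rotated 2]) (auto intro!: f1)
  then have "((\<lambda>t. pd f e1 (u, t)) has_vector_derivative ?f21 (u, v)) (at v)"
    by (simp add: at_within_Icc_at)
  then show ?thesis
    unfolding p using partial_vector_derivative(2)[OF s1] vector_derivative_unique_at by blast
qed

lemma pd_inner_const:
  assumes "smooth f" "smooth h" "\<And>p. f p \<bullet> h p = c" "e \<in> Basis"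
  shows "f p \<bullet> pd h e p = - (pd f e p \<bullet> h p)"
proof -
  have "pd (\<lambda>p. f p \<bullet> h p) e p = f p \<bullet> pd h e p + pd f e p \<bullet> h p"
    by (rule bounded_bilinear.pd_prod[OF bounded_bilinear_inner assms(1,2)])
  then show ?thesis by (simp add: assms(3))
qed

lemma orthonormal_pair_zero:
  fixes a b z :: "real \<times> real"
  assumes "a \<bullet> a = 1" "b \<bullet> b = 1" "a \<bullet> b = 0" "a \<bullet> z = 0" "b \<bullet> z = 0"
  shows "z = 0"
proof -
  obtain a1 a2 b1 b2 z1 z2 where e: "a = (a1, a2)" "b = (b1, b2)" "z = (z1, z2)" by (cases a, cases b, cases z) blast
  have h: "a1 * a1 + a2 * a2 = 1" "b1 * b1 + b2 * b2 = 1" "a1 * b1 + a2 * b2 = 0" "a1 * z1 + a2 * z2 = 0" "b1 * z1 + b2 * z2 = 0"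
    using assms by (simp_all add: e)
  have D: "(a1 * b2 - a2 * b1)\<^sup>2 = 1" using h(1-3) by algebra
  have "(a1 * b2 - a2 * b1) * z1 = 0" "(a1 * b2 - a2 * b1) * z2 = 0" using h by algebra+
  with D show ?thesis by (auto simp: e zero_prod_def)
qed

text \<open>A smooth map of the plane with orthonormal partial derivatives is affine:
  differentiating the relations \<open>\<phi>\<^sub>i \<bullet> \<phi>\<^sub>j = \<delta>\<^sub>i\<^sub>j\<close> and using the symmetry of second derivatives
  shows that all second derivatives are orthogonal to \<open>\<phi>\<^sub>1\<close> and \<open>\<phi>\<^sub>2\<close>.\<close>

lemma local_isometry_affine:
  fixes \<phi> :: "real \<times> real \<Rightarrow> real \<times> real"
  assumes s: "smooth \<phi>" and 11: "\<And>p. pd \<phi> e1 p \<bullet> pd \<phi> e1 p = 1" and 12: "\<And>p. pd \<phi> e1 p \<bullet> pd \<phi> e2 p = 0"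
    and 22: "\<And>p. pd \<phi> e2 p \<bullet> pd \<phi> e2 p = 1"
  obtains a b where "a \<bullet> a = 1" "b \<bullet> b = 1" "a \<bullet> b = 0" "\<And>p. \<phi> p = \<phi> 0 + fst p *\<^sub>R a + snd p *\<^sub>R b"
    "\<And>p. pd \<phi> e1 p = a" "\<And>p. pd \<phi> e2 p = b"
proof -
  note s1 = smooth_pd[OF s e1_in_Basis] and s2 = smooth_pd[OF s e2_in_Basis]
  note sym = pd_commute[OF s]
  let ?a = "pd \<phi> e1" and ?b = "pd \<phi> e2"
  have a1: "?a p \<bullet> pd ?a e1 p = 0" and a2: "?a p \<bullet> pd ?a e2 p = 0" and b1: "?b p \<bullet> pd ?b e1 p = 0" and b2: "?b p \<bullet> pd ?b e2 p = 0" for p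
    using pd_inner_const[OF s1 s1 11 e1_in_Basis, of p] pd_inner_const[OF s1 s1 11 e2_in_Basis, of p]
      pd_inner_const[OF s2 s2 22 e1_in_Basis, of p] pd_inner_const[OF s2 s2 22 e2_in_Basis, of p]
    by (simp_all add: inner_commute)
  have ab1: "?a p \<bullet> pd ?b e1 p = - (pd ?a e1 p \<bullet> ?b p)" and ab2: "?a p \<bullet> pd ?b e2 p = - (pd ?a e2 p \<bullet> ?b p)" for p
    using pd_inner_const[OF s1 s2 12 e1_in_Basis, of p] pd_inner_const[OF s1 s2 12 e2_in_Basis, of p] by simp_all
  \<comment> \<open>Against \<open>?b\<close>: by \<open>ab1\<close> and symmetry the product is
    minus that of \<open>?a\<close> with \<open>pd ?a e2\<close>, which is zero by
    \<open>a2\<close>.\<close>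
  have z11: "pd ?a e1 p = 0" for p
    by (rule orthonormal_pair_zero[OF 11 22 12 a1]) (use ab1[of p] a2[of p] sym[of p] in \<open>simp add: inner_commute\<close>)
  have z12: "pd ?a e2 p = 0" for p
    by (rule orthonormal_pair_zero[OF 11 22 12 a2]) (use b1[of p] sym[of p] in simp)
  have z22: "pd ?b e2 p = 0" for p
    by (rule orthonormal_pair_zero[OF 11 22 12 _ b2]) (use ab2[of p] z12[of p] in simp)
  have z21: "pd ?b e1 p = 0" for p using z12 sym by simp
  have const: "h p = h 0" if "smooth h" "\<And>p. pd h e1 p = 0" "\<And>p. pd h e2 p = 0" for h :: "real \<times> real \<Rightarrow> real \<times> real" and p
  proof -
    have "h (u, v) = h (0, v)" "h (0, v) = h (0, 0)" for u v
      using vector_derivative_zero_eq[of "\<lambda>u. h (u, v)" u 0] vector_derivative_zero_eq[of "\<lambda>v. h (0, v)" v 0]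
        partial_vector_derivative[OF that(1)] that(2,3) by metis+
    then show ?thesis by (metis prod.collapse zero_prod_def)
  qed
  have ca: "?a p = ?a 0" and cb: "?b p = ?b 0" for p
    using const[OF s1 z11 z12] const[OF s2 z21 z22] by blast+
  \<comment> \<open>Subtracting the linear map with the constant partial derivatives leaves a map
    whose partial derivatives vanish.\<close>
  have "\<phi> p - (fst p *\<^sub>R ?a 0 + snd p *\<^sub>R ?b 0) = \<phi> 0" for p
  proof -
    let ?l = "\<lambda>p. fst p *\<^sub>R ?a 0 + snd p *\<^sub>R ?b 0"
    have l: "(?l has_derivative ?l) (at p)" for p
      by (auto intro!: derivative_eq_intros)
    have sl: "smooth ?l"
      by (rule smoothI[OF l]) simp
    have "pd (\<lambda>p. \<phi> p - ?l p) e p = pd \<phi> e p - ?l e" for e p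
      by (rule pd_eqI[OF has_derivative_diff[OF smooth_has_derivative[OF s] l], folded pd_def])
    then have "pd (\<lambda>p. \<phi> p - ?l p) e1 p = 0" "pd (\<lambda>p. \<phi> p - ?l p) e2 p = 0" for p
      using ca[of p] cb[of p] by simp_all
    from const[OF smooth_diff[OF s sl] this, of p] show ?thesis by simp
  qed
  then have "\<phi> p = \<phi> 0 + fst p *\<^sub>R ?a 0 + snd p *\<^sub>R ?b 0" for p
    unfolding diff_eq_eq add.assoc .
  then show thesis by (rule that[of "?a 0" "?b 0", OF 11 22 12 _ ca cb])
qed

text \<open>Each function differentiates to a multiple of the other, hence the simultaneous
  induction.\<close>

lemma smooth_trig: "smooth (\<lambda>u. cos (\<omega> * u))" "smooth (\<lambda>u. sin (\<omega> * u))" for \<omega> :: real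
proof -
  have "Ck k (\<lambda>u. cos (\<omega> * u)) \<and> Ck k (\<lambda>u. sin (\<omega> * u))" for k
  proof (induction k)
    case 0
    show ?case by (auto intro!: continuous_intros)
  next
    case (Suc k)
    have c: "((\<lambda>u. cos (\<omega> * u)) has_derivative (\<lambda>v. (- \<omega> * v) * sin (\<omega> * u))) (at u)"
      and s: "((\<lambda>u. sin (\<omega> * u)) has_derivative (\<lambda>v. (\<omega> * v) * cos (\<omega> * u))) (at u)" for u
      by (auto intro!: derivative_eq_intros)
    show ?case
      using Suc by (auto intro!: Ck_SucI[OF c] Ck_SucI[OF s] bounded_bilinear.Ck_prod[OF bounded_bilinear_mult] Ck_const
          simp del: Ck.simps)
  qed
  then show "smooth (\<lambda>u. cos (\<omega> * u))" "smooth (\<lambda>u. sin (\<omega> * u))" by (auto simp: smooth_def)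
qed

section \<open>The Willmore energy of the Ejiri torus\<close>

text \<open>\<open>m\<close> is the centre, \<open>r\<close> the radius and \<omega> the angular
  speed; \<open>r * \<omega> = 1\<close> is unit speed, and the condition on \<open>m\<close> puts
  the circle on the sphere. It is used with \<omega> = \<open>sqrt 3\<close> for the small circle
  and with \<omega> = 1, \<open>m = 0\<close> for the great circle.\<close>

lemma circle_curve:
  fixes a b m :: "real^'n"
  assumes o: "a \<bullet> a = 1" "b \<bullet> b = 1" "a \<bullet> b = 0" "a \<bullet> m = 0" "b \<bullet> m = 0"
    and r: "r * \<omega> = 1" "r\<^sup>2 + m \<bullet> m = 1" "\<omega> > 0"
    and f_def: "f = (\<lambda>u. cos (\<omega> * u) *\<^sub>R (r *\<^sub>R a) + sin (\<omega> * u) *\<^sub>R (r *\<^sub>R b) + m)"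
  shows "closed_sphere_curve f (2 * pi / \<omega>)" and "curv_sq f u = r\<^sup>2 * (1 - \<omega>\<^sup>2)\<^sup>2 + m \<bullet> m"
proof -
  note o' = o(3-5)[THEN trans[OF inner_commute]]
  have f: "smooth f"
    unfolding f_def by (intro smooth_add smooth_scaleR smooth_trig smooth_const)
  have dc: "((\<lambda>t. cos (\<omega> * t)) has_real_derivative - \<omega> * sin (\<omega> * t)) (at t)"
    and ds: "((\<lambda>t. sin (\<omega> * t)) has_real_derivative \<omega> * cos (\<omega> * t)) (at t)" for t
    by (auto intro!: derivative_eq_intros)
  have v1: "vd f = (\<lambda>u. cos (\<omega> * u) *\<^sub>R b + sin (\<omega> * u) *\<^sub>R (- a))"
  proof (rule vd_eqI)
    fix s
    have "(f has_vector_derivative (cos (\<omega> * s) *\<^sub>R 0 + (- \<omega> * sin (\<omega> * s)) *\<^sub>R (r *\<^sub>R a))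
       + (sin (\<omega> * s) *\<^sub>R 0 + (\<omega> * cos (\<omega> * s)) *\<^sub>R (r *\<^sub>R b)) + 0) (at s)"
      unfolding f_def
      by (rule has_vector_derivative_add[OF has_vector_derivative_add[OF has_vector_derivative_scaleR[OF dc has_vector_derivative_const]
            has_vector_derivative_scaleR[OF ds has_vector_derivative_const]] has_vector_derivative_const])
    also have "(cos (\<omega> * s) *\<^sub>R 0 + (- \<omega> * sin (\<omega> * s)) *\<^sub>R (r *\<^sub>R a))
       + (sin (\<omega> * s) *\<^sub>R 0 + (\<omega> * cos (\<omega> * s)) *\<^sub>R (r *\<^sub>R b)) + 0
       = (r * \<omega>) *\<^sub>R (cos (\<omega> * s) *\<^sub>R b + sin (\<omega> * s) *\<^sub>R (- a))"
      by (simp add: algebra_simps)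
    finally show "(f has_vector_derivative cos (\<omega> * s) *\<^sub>R b + sin (\<omega> * s) *\<^sub>R (- a)) (at s)"
      by (simp only: r scaleR_one)
  qed
  have v2: "vd (vd f) = (\<lambda>u. (- \<omega> * sin (\<omega> * u)) *\<^sub>R b + (\<omega> * cos (\<omega> * u)) *\<^sub>R (- a))"
    unfolding v1
  proof (rule vd_eqI)
    fix s
    have "((\<lambda>u. cos (\<omega> * u) *\<^sub>R b + sin (\<omega> * u) *\<^sub>R (- a)) has_vector_derivative
       (cos (\<omega> * s) *\<^sub>R 0 + (- \<omega> * sin (\<omega> * s)) *\<^sub>R b) + (sin (\<omega> * s) *\<^sub>R 0 + (\<omega> * cos (\<omega> * s)) *\<^sub>R (- a))) (at s)"
      by (rule has_vector_derivative_add[OF has_vector_derivative_scaleR[OF dc has_vector_derivative_const]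
          has_vector_derivative_scaleR[OF ds has_vector_derivative_const]])
    then show "((\<lambda>u. cos (\<omega> * u) *\<^sub>R b + sin (\<omega> * u) *\<^sub>R (- a)) has_vector_derivative
       (- \<omega> * sin (\<omega> * s)) *\<^sub>R b + (\<omega> * cos (\<omega> * s)) *\<^sub>R (- a)) (at s)"
      by (simp only: scaleR_zero_right add_0_left)
  qed
  have cs: "x * cos t * cos t + x * sin t * sin t = x" for x t :: real
    by (metis distrib_left mult.assoc mult.right_neutral sin_cos_squared_add3)
  have "f u \<bullet> f u = r * r * cos (\<omega> * u) * cos (\<omega> * u) + r * r * sin (\<omega> * u) * sin (\<omega> * u) + m \<bullet> m" for u
    by (simp add: f_def inner_add_left inner_add_right o o' mult_ac)
  then have ff: "f u \<bullet> f u = 1" for u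
    unfolding cs using r(2) by (simp add: power2_eq_square)
  have "vd f u \<bullet> vd f u = 1 * cos (\<omega> * u) * cos (\<omega> * u) + 1 * sin (\<omega> * u) * sin (\<omega> * u)" for u
    by (simp only: v1 inner_add_left inner_add_right o o' inner_scaleR_left inner_scaleR_right inner_minus_left inner_minus_right) simp
  then have f1: "vd f u \<bullet> vd f u = 1" for u unfolding cs .
  have per: "\<omega> * (s + 2 * pi / \<omega>) = \<omega> * s + 2 * pi" for s using r(3) by (simp add: field_simps)
  show "closed_sphere_curve f (2 * pi / \<omega>)"
    unfolding closed_sphere_curve_def
  proof (intro conjI allI f)
    show "norm (f s) = 1" for s using ff[of s] by (simp add: norm_eq_sqrt_inner)
    show "norm (vector_derivative f (at s)) = 1" for s
      using f1[of s] unfolding vd_def by (simp add: norm_eq_sqrt_inner)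
    show "f (s + 2 * pi / \<omega>) = f s" for s unfolding f_def per by simp
  qed (use r in simp)
  have w: "curv_vec f u = (cos (\<omega> * u) * (r - \<omega>)) *\<^sub>R a + (sin (\<omega> * u) * (r - \<omega>)) *\<^sub>R b + m"
    unfolding curv_vec_def v2 by (simp add: f_def algebra_simps)
  have "curv_sq f u = (r - \<omega>)\<^sup>2 * cos (\<omega> * u) * cos (\<omega> * u) + (r - \<omega>)\<^sup>2 * sin (\<omega> * u) * sin (\<omega> * u) + m \<bullet> m"
    unfolding curv_sq_def w by (simp add: inner_add_left inner_add_right o o' power2_eq_square mult_ac)
  moreover have "r * (1 - \<omega>\<^sup>2) = r - \<omega>" using r(1) by (simp add: power2_eq_square algebra_simps)
  ultimately show "curv_sq f u = r\<^sup>2 * (1 - \<omega>\<^sup>2)\<^sup>2 + m \<bullet> m"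
    unfolding cs power_mult_distrib[symmetric] by simp
qed

text \<open>\<open>T\<close> only renumbers the coordinates from pairs to 1 to 6. The factors 1 and
  the summand 0 in \<open>d\<close> keep it in the shape of \<open>circle_curve\<close>.\<close>

lemma ejiri_tensor_torus:
  defines "c \<equiv> \<lambda>u. cos (sqrt 3 * u) *\<^sub>R ((1 / sqrt 3) *\<^sub>R axis 1 1) + sin (sqrt 3 * u) *\<^sub>R ((1 / sqrt 3) *\<^sub>R axis 2 1)
      + (sqrt 2 / sqrt 3) *\<^sub>R axis 3 1 :: real^3"
    and "d \<equiv> \<lambda>v. cos (1 * v) *\<^sub>R (1 *\<^sub>R axis 1 1) + sin (1 * v) *\<^sub>R (1 *\<^sub>R axis 2 1) + 0 :: real^2"
  obtains T :: "real^(3 \<times> 2) \<Rightarrow> real^6" where "linear T" "\<And>w. norm (T w) = norm w"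
    "\<And>z. ejiri z = T (tensor_torus c d z)"
proof
  define T where "T = (\<lambda>w :: real^(3 \<times> 2). w $ (1, 1) *\<^sub>R axis 1 1 + w $ (1, 2) *\<^sub>R axis 2 1 + w $ (2, 1) *\<^sub>R axis 3 1
     + w $ (2, 2) *\<^sub>R axis 4 1 + w $ (3, 1) *\<^sub>R axis 5 1 + w $ (3, 2) *\<^sub>R axis 6 (1::real) :: real^6)"
  show "linear T" by (rule linearI) (simp_all add: T_def algebra_simps)
  have T: "T w $ 1 = w $ (1, 1)" "T w $ 2 = w $ (1, 2)" "T w $ 3 = w $ (2, 1)" "T w $ 4 = w $ (2, 2)"
    "T w $ 5 = w $ (3, 1)" "T w $ 6 = w $ (3, 2)" for w
    by (simp_all add: T_def axis_def)
  have "w \<bullet> w = (\<Sum>i\<in>UNIV. \<Sum>j\<in>UNIV. w $ (i, j) * w $ (i, j))" for w :: "real^(3 \<times> 2)"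
    by (simp add: inner_vec_def sum.cartesian_product case_prod_beta')
  then have "T w \<bullet> T w = w \<bullet> w" for w
    unfolding inner_6 T by (simp add: sum_3 sum_2)
  then show "norm (T w) = norm w" for w by (simp add: norm_eq_sqrt_inner)
  show "ejiri z = T (tensor_torus c d z)" for z
  proof -
    have "ejiri z $ i = T (tensor_torus c d z) $ i" if "i \<in> {1, 2, 3, 4, 5, 6}" for i
      using that by (auto simp: ejiri_nth T tensor_def c_def d_def axis_def)
    then show ?thesis unfolding vec_eq_iff UNIV_6[symmetric] by simp
  qed
qed

lemma linear_isometry_inner:
  fixes M :: "'a::real_inner \<Rightarrow> 'b::real_inner"
  assumes "linear M" "\<And>v. norm (M v) = norm v"
  shows "M v \<bullet> M w = v \<bullet> w"
  unfolding dot_norm linear_add[OF assms(1), symmetric] assms(2) ..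

section \<open>Chain rule for reparametrised surfaces, and covolumes of lattices\<close>

lemma pd_linear:
  assumes "smooth f"
  shows "pd f v q = fst v *\<^sub>R pd f e1 q + snd v *\<^sub>R pd f e2 q"
proof -
  interpret bounded_linear "frechet_derivative f (at q)"
    by (rule has_derivative_bounded_linear[OF smooth_has_derivative[OF assms]])
  have "v = fst v *\<^sub>R e1 + snd v *\<^sub>R e2" by (cases v) simp
  then have "frechet_derivative f (at q) v = frechet_derivative f (at q) (fst v *\<^sub>R e1 + snd v *\<^sub>R e2)" by simp
  then show ?thesis unfolding add scaleR pd_def .
qed

lemma pd_chain:
  assumes M: "bounded_linear M" and f: "smooth f" and \<phi>: "smooth \<phi>"
  shows "pd (\<lambda>p. M (f (\<phi> p))) e p = M (fst (pd \<phi> e p) *\<^sub>R pd f e1 (\<phi> p) + snd (pd \<phi> e p) *\<^sub>R pd f e2 (\<phi> p))"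
  unfolding pd_linear[OF f, symmetric]
  by (rule pd_eqI[OF bounded_linear.has_derivative[OF M has_derivative_compose[OF smooth_has_derivative[OF \<phi>]
        smooth_has_derivative[OF f]]], folded pd_def])

text \<open>The orthogonal map with columns \<open>a\<close>, \<open>b\<close> and its inverse both
  send lattice vectors to lattice vectors, so in the lattice bases both have integer matrices. As
  the determinant \<open>D\<close> is 1 or -1, each covolume is a positive integer multiple of the
  other.\<close>

lemma lattice_isometry_covolume:
  fixes a b :: "real \<times> real"
  assumes pos: "L > 0" "Lh > 0" "m > 0" "n > 0" and o: "a \<bullet> a = 1" "b \<bullet> b = 1" "a \<bullet> b = 0"
    and iff: "\<And>v. fst v *\<^sub>R a + snd v *\<^sub>R b \<in> lattice m n \<longleftrightarrow> v \<in> lattice L Lh"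
  shows "L * Lh = m * n"
proof -
  obtain a1 a2 b1 b2 where ab: "a = (a1, a2)" "b = (b1, b2)" by (cases a, cases b) blast
  have h: "a1 * a1 + a2 * a2 = 1" "b1 * b1 + b2 * b2 = 1" "a1 * b1 + a2 * b2 = 0" using o by (simp_all add: ab)
  \<comment> \<open>The rows are orthonormal too; this identifies the inverse with the transpose,
    which supplies the preimages of the second lattice below.\<close>
  have col: "a1 * a1 + b1 * b1 = 1" "a2 * a2 + b2 * b2 = 1" "a1 * a2 + b1 * b2 = 0" using h by algebra+
  define D where "D = a1 * b2 - a2 * b1"
  have "D\<^sup>2 = 1" unfolding D_def using h by algebra
  then have D: "\<bar>D\<bar> = 1" by (simp add: abs_square_eq_1)
  have in1: "(L, 0) \<in> lattice L Lh" "(0, Lh) \<in> lattice L Lh"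
    unfolding lattice_def by (auto intro: exI[of _ "1::int"] exI[of _ "0::int"])
  have in2: "(m, 0) \<in> lattice m n" "(0, n) \<in> lattice m n"
    unfolding lattice_def by (auto intro: exI[of _ "1::int"] exI[of _ "0::int"])
  have "(L * a1, L * a2) \<in> lattice m n" "(Lh * b1, Lh * b2) \<in> lattice m n"
    using iff[of "(L, 0)"] iff[of "(0, Lh)"] in1 by (simp_all add: ab)
  then obtain i j k l :: int where 1: "L * a1 = i * m" "L * a2 = j * n" "Lh * b1 = k * m" "Lh * b2 = l * n"
    unfolding lattice_def by auto
  have "(m * a1, m * b1) \<in> lattice L Lh" "(n * a2, n * b2) \<in> lattice L Lh"
  proof -
    have "(m * a1) *\<^sub>R a + (m * b1) *\<^sub>R b = (m * (a1 * a1 + b1 * b1), m * (a1 * a2 + b1 * b2))"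
      "(n * a2) *\<^sub>R a + (n * b2) *\<^sub>R b = (n * (a1 * a2 + b1 * b2), n * (a2 * a2 + b2 * b2))"
      by (simp_all add: ab algebra_simps)
    then show "(m * a1, m * b1) \<in> lattice L Lh" "(n * a2, n * b2) \<in> lattice L Lh"
      using iff[of "(m * a1, m * b1)"] iff[of "(n * a2, n * b2)"] in2 by (simp_all add: col)
  qed
  then obtain i' j' k' l' :: int where 2: "m * a1 = i' * L" "m * b1 = j' * Lh" "n * a2 = k' * L" "n * b2 = l' * Lh"
    unfolding lattice_def by auto
  have "L * Lh * D = (L * a1) * (Lh * b2) - (L * a2) * (Lh * b1)" by (simp add: D_def algebra_simps)
  also have "\<dots> = m * n * of_int (i * l - j * k)" unfolding 1 by (simp add: algebra_simps)
  finally have "\<bar>L * Lh * D\<bar> = \<bar>m * n * of_int (i * l - j * k)\<bar>" by simp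
  then have e1: "L * Lh = m * n * of_int \<bar>i * l - j * k\<bar>" using pos D by (simp add: abs_mult)
  have "m * n * D = (m * a1) * (n * b2) - (n * a2) * (m * b1)" by (simp add: D_def algebra_simps)
  also have "\<dots> = L * Lh * of_int (i' * l' - k' * j')" unfolding 2 by (simp add: algebra_simps)
  finally have "\<bar>m * n * D\<bar> = \<bar>L * Lh * of_int (i' * l' - k' * j')\<bar>" by simp
  then have e2: "m * n = L * Lh * of_int \<bar>i' * l' - k' * j'\<bar>" using pos D by (simp add: abs_mult)
  \<comment> \<open>The integer factor cannot be zero because the areas are positive, so its
    absolute value is at least 1.\<close>
  have ge: "y \<le> x" if "x = y * of_int \<bar>z\<bar>" "x > 0" "y > 0" for x y :: real and z :: int
  proof -
    have "z \<noteq> 0" using that by auto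
    then have "1 \<le> \<bar>z\<bar>" by simp
    then have "(1::real) \<le> of_int \<bar>z\<bar>" by linarith
    then show ?thesis using that(1,3) by simp
  qed
  show ?thesis using ge[OF e1] ge[OF e2] pos by simp
qed

section \<open>Energy of a tensor torus congruent to the Ejiri torus\<close>

context tensor_pair begin

text \<open>\<open>N\<close> is twice the mean curvature vector, written through the coordinate
  Laplacian because the metric is flat. This form can be compared under an orthogonal change of
  coordinates.\<close>

lemma laplacian_sq:
  assumes "N = pd (pd x e1) e1 p + pd (pd x e2) e2 p + 2 *\<^sub>R x p"
  shows "N \<bullet> N = curv_sq g (fst p) + curv_sq gh (snd p)"
proof -
  have "N = tensor (curv_vec g (fst p)) (gh (snd p)) + tensor (g (fst p)) (curv_vec gh (snd p))"
    unfolding assms pd_x by (simp add: curv_vec_def tensor.add_left tensor.add_right scaleR_2)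
  then show ?thesis by (simp add: inner_add_left inner_add_right orth)
qed

lemma pd_commute_x: "pd (pd x e1) e2 = pd (pd x e2) e1"
  by (simp add: pd_tensor_torus smooths)

lemma smooth_x: "smooth x"
  by (intro smooth_tensor_torus smooths)

lemma metric_x: "pd x e1 p \<bullet> pd x e1 p = 1" "pd x e1 p \<bullet> pd x e2 p = 0" "pd x e2 p \<bullet> pd x e2 p = 1"
  by (simp_all add: pd_x orth)

lemma willmore_of_congruent:
  assumes "congruent_to_ejiri L Lh x"
  shows "willmore L Lh x = 2 * pi\<^sup>2 * sqrt 3"
proof -
  obtain T :: "real^6 \<Rightarrow> real^('n \<times> 'm)" and \<phi> where T: "linear T" "\<And>v. norm (T v) = norm v"
    and \<phi>: "torus_reparam (lattice L Lh) ejiri_lattice \<phi>" and y: "\<And>p. x p = T (ejiri (\<phi> p))"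
    using assms unfolding congruent_to_ejiri_def by blast
  have s\<phi>: "smooth \<phi>" using \<phi> unfolding torus_reparam_def by blast
  define c where "c = (\<lambda>u. cos (sqrt 3 * u) *\<^sub>R ((1 / sqrt 3) *\<^sub>R axis 1 1) + sin (sqrt 3 * u) *\<^sub>R ((1 / sqrt 3) *\<^sub>R axis 2 1)
      + (sqrt 2 / sqrt 3) *\<^sub>R axis 3 1 :: real^3)"
  define d where "d = (\<lambda>v. cos (1 * v) *\<^sub>R (1 *\<^sub>R axis 1 1) + sin (1 * v) *\<^sub>R (1 *\<^sub>R axis 2 1) + 0 :: real^2)"
  have c: "closed_sphere_curve c (2 * pi / sqrt 3)" and kc: "curv_sq c u = 2" for u
    using circle_curve[of "axis 1 1 :: real^3" "axis 2 1" "(sqrt 2 / sqrt 3) *\<^sub>R axis 3 1" "1 / sqrt 3" "sqrt 3" c]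
    by (simp_all add: c_def inner_axis_axis power2_eq_square)
  have d: "closed_sphere_curve d (2 * pi)" and kd: "curv_sq d u = 0" for u
    using circle_curve[of "axis 1 1 :: real^2" "axis 2 1" 0 1 1 d]
    by (simp_all add: d_def inner_axis_axis)
  interpret E: tensor_pair c "2 * pi / sqrt 3" d "2 * pi"
    by unfold_locales (rule c, rule d)
  obtain T1 :: "real^(3 \<times> 2) \<Rightarrow> real^6" where T1: "linear T1" "\<And>w. norm (T1 w) = norm w"
    "\<And>z. ejiri z = T1 (E.x z)"
    by (rule ejiri_tensor_torus[folded c_def d_def]) blast
  define M where "M = (\<lambda>w. T (T1 w))"
  have lM: "linear M" unfolding M_def using linear_compose[OF T1(1) T(1)] by (simp add: o_def)
  have M: "bounded_linear M" by (rule linear_conv_bounded_linear[THEN iffD1, OF lM])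
  have MM: "M v \<bullet> M w = v \<bullet> w" for v w
    by (rule linear_isometry_inner[OF lM]) (simp add: M_def T T1)
  have x: "x = (\<lambda>p. M (E.x (\<phi> p)))" using y T1(3) by (simp add: M_def fun_eq_iff)
  have pdx: "pd x e p = M (fst (pd \<phi> e p) *\<^sub>R pd E.x e1 (\<phi> p) + snd (pd \<phi> e p) *\<^sub>R pd E.x e2 (\<phi> p))" for e p
    unfolding x by (rule pd_chain[OF M E.smooth_x s\<phi>])
  \<comment> \<open>Both tori have the identity as metric matrix and \<open>M\<close> preserves
    inner products, so the derivative of \<phi> preserves them as well.\<close>
  have met: "pd \<phi> e p \<bullet> pd \<phi> e' p = pd x e p \<bullet> pd x e' p" for e e' p
    unfolding pdx MM
    by (simp add: inner_add_left inner_add_right E.metric_x E.metric_x(2)[THEN trans[OF inner_commute]] inner_prod_def)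
  have m: "pd \<phi> e1 p \<bullet> pd \<phi> e1 p = 1" "pd \<phi> e1 p \<bullet> pd \<phi> e2 p = 0" "pd \<phi> e2 p \<bullet> pd \<phi> e2 p = 1" for p
    unfolding met by (rule metric_x)+
  obtain a b where o: "a \<bullet> a = 1" "b \<bullet> b = 1" "a \<bullet> b = 0" and aff: "\<And>p. \<phi> p = \<phi> 0 + fst p *\<^sub>R a + snd p *\<^sub>R b"
    and p1: "\<And>p. pd \<phi> e1 p = a" and p2: "\<And>p. pd \<phi> e2 p = b"
    by (rule local_isometry_affine[OF s\<phi> m]) blast
  have area: "L * Lh = (2 * pi / sqrt 3) * (2 * pi)"
  proof (rule lattice_isometry_covolume[OF c.L_pos ch.L_pos E.c.L_pos E.ch.L_pos o])
    fix v :: "real \<times> real"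
    \<comment> \<open>Only differences from the value at the origin enter, which removes the
      translation part of the affine map \<phi>.\<close>
    have "\<phi> v - \<phi> 0 \<in> ejiri_lattice \<longleftrightarrow> v - 0 \<in> lattice L Lh"
      using \<phi> unfolding torus_reparam_def by blast
    moreover have "\<phi> v - \<phi> 0 = fst v *\<^sub>R a + snd v *\<^sub>R b" using aff[of v] by (simp add: algebra_simps)
    ultimately show "fst v *\<^sub>R a + snd v *\<^sub>R b \<in> lattice (2 * pi / sqrt 3) (2 * pi) \<longleftrightarrow> v \<in> lattice L Lh"
      by (simp add: ejiri_lattice_def)
  qed
  have col: "fst a * fst a + fst b * fst b = 1" "snd a * snd a + snd b * snd b = 1" "fst a * snd a + fst b * snd b = 0"
  proof -
    have h: "fst a * fst a + snd a * snd a = 1" "fst b * fst b + snd b * snd b = 1" "fst a * fst b + snd a * snd b = 0"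
      using o by (simp_all add: inner_prod_def)
    show "fst a * fst a + fst b * fst b = 1" "snd a * snd a + snd b * snd b = 1" "fst a * snd a + fst b * snd b = 0"
      using h by algebra+
  qed
  have k: "curv_sq g (fst p) + curv_sq gh (snd p) = 2" for p
  proof -
    let ?X11 = "pd (pd E.x e1) e1 (\<phi> p)" and ?X22 = "pd (pd E.x e2) e2 (\<phi> p)" and ?X12 = "pd (pd E.x e2) e1 (\<phi> p)"
    note s1 = smooth_pd[OF E.smooth_x e1_in_Basis] and s2 = smooth_pd[OF E.smooth_x e2_in_Basis]
    have second: "pd (\<lambda>p. M (v1 *\<^sub>R pd E.x e1 (\<phi> p) + v2 *\<^sub>R pd E.x e2 (\<phi> p))) e p
      = M (fst (pd \<phi> e p) *\<^sub>R (v1 *\<^sub>R ?X11 + v2 *\<^sub>R ?X12) + snd (pd \<phi> e p) *\<^sub>R (v1 *\<^sub>R ?X12 + v2 *\<^sub>R ?X22))" for v1 v2 e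
    proof -
      let ?f = "\<lambda>q. v1 *\<^sub>R pd E.x e1 q + v2 *\<^sub>R pd E.x e2 q"
      have "smooth ?f" by (intro smooth_add smooth_scaleR smooth_const s1 s2)
      moreover have "pd ?f e q = v1 *\<^sub>R pd (pd E.x e1) e q + v2 *\<^sub>R pd (pd E.x e2) e q" for e q
        by (rule pd_eqI[OF has_derivative_add[OF has_derivative_scaleR_right[OF smooth_has_derivative[OF s1]]
              has_derivative_scaleR_right[OF smooth_has_derivative[OF s2]]], folded pd_def])
      ultimately show ?thesis using pd_chain[OF M _ s\<phi>, of ?f] by (simp add: E.pd_commute_x)
    qed
    have px1: "pd x e1 = (\<lambda>p. M (fst a *\<^sub>R pd E.x e1 (\<phi> p) + snd a *\<^sub>R pd E.x e2 (\<phi> p)))"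
      and px2: "pd x e2 = (\<lambda>p. M (fst b *\<^sub>R pd E.x e1 (\<phi> p) + snd b *\<^sub>R pd E.x e2 (\<phi> p)))"
      using pdx by (simp_all add: fun_eq_iff p1 p2)
    have "pd (pd x e1) e1 p + pd (pd x e2) e2 p + 2 *\<^sub>R x p
      = M ((fst a *\<^sub>R (fst a *\<^sub>R ?X11 + snd a *\<^sub>R ?X12) + snd a *\<^sub>R (fst a *\<^sub>R ?X12 + snd a *\<^sub>R ?X22))
        + (fst b *\<^sub>R (fst b *\<^sub>R ?X11 + snd b *\<^sub>R ?X12) + snd b *\<^sub>R (fst b *\<^sub>R ?X12 + snd b *\<^sub>R ?X22)) + 2 *\<^sub>R E.x (\<phi> p))"
    proof -
      have "pd (pd x e1) e1 p = M (fst a *\<^sub>R (fst a *\<^sub>R ?X11 + snd a *\<^sub>R ?X12) + snd a *\<^sub>R (fst a *\<^sub>R ?X12 + snd a *\<^sub>R ?X22))"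
        "pd (pd x e2) e2 p = M (fst b *\<^sub>R (fst b *\<^sub>R ?X11 + snd b *\<^sub>R ?X12) + snd b *\<^sub>R (fst b *\<^sub>R ?X12 + snd b *\<^sub>R ?X22))"
        "x p = M (E.x (\<phi> p))"
        unfolding px1 px2 second p1 p2 by (simp_all add: x del: tensor_torus_apply)
      then show ?thesis by (simp only: linear_add[OF lM] linear_scale[OF lM])
    qed
    \<comment> \<open>Invariance of the Laplacian: by \<open>col\<close> the rows of the matrix of
      \<phi> are orthonormal, so the pure second derivatives get coefficient 1 and the mixed ones
      cancel.\<close>
    also have "(fst a *\<^sub>R (fst a *\<^sub>R ?X11 + snd a *\<^sub>R ?X12) + snd a *\<^sub>R (fst a *\<^sub>R ?X12 + snd a *\<^sub>R ?X22))
        + (fst b *\<^sub>R (fst b *\<^sub>R ?X11 + snd b *\<^sub>R ?X12) + snd b *\<^sub>R (fst b *\<^sub>R ?X12 + snd b *\<^sub>R ?X22))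
      = (fst a * fst a + fst b * fst b) *\<^sub>R ?X11 + (snd a * snd a + snd b * snd b) *\<^sub>R ?X22
        + ((fst a * snd a + fst b * snd b) *\<^sub>R ?X12 + (fst a * snd a + fst b * snd b) *\<^sub>R ?X12)"
      by (simp only: scaleR_add_left scaleR_add_right scaleR_scaleR mult.commute add.commute add.left_commute add.assoc)
    also have "\<dots> = ?X11 + ?X22" by (simp add: col)
    finally have "pd (pd x e1) e1 p + pd (pd x e2) e2 p + 2 *\<^sub>R x p = M (?X11 + ?X22 + 2 *\<^sub>R E.x (\<phi> p))" .
    from laplacian_sq[OF this[symmetric]] E.laplacian_sq[OF refl, of "\<phi> p"]
    show ?thesis by (simp add: MM kc kd)
  qed
  \<comment> \<open>The density is 2/4 + 1, since the small circle has squared curvature 2 and the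
    great circle 0; the area is 4 \<pi>^2 / \<open>sqrt 3\<close>.\<close>
  have "willmore L Lh x = integral (cbox (0, 0) (L, Lh)) (\<lambda>p. (3/2) * 1)"
    unfolding willmore_def willmore_density k by simp
  also have "\<dots> = integral {0..L} (\<lambda>s. 3/2) * integral {0..Lh} (\<lambda>s. 1)"
    by (intro integral_unique integral_product_box) auto
  also have "\<dots> = (3/2) * (L * Lh)" using c.L_pos ch.L_pos by simp
  also have "\<dots> = 2 * pi\<^sup>2 * sqrt 3" unfolding area by (simp add: power2_eq_square field_simps)
  finally show ?thesis .
qed

end

theorem theorem3p2:
  fixes g :: "real \<Rightarrow> real^'n" and gh :: "real \<Rightarrow> real^'m" and L Lh :: real
  assumes "closed_sphere_curve g L"
    and "closed_sphere_curve gh Lh"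
    and "willmore_surface L Lh (tensor_torus g gh)"
  shows "willmore L Lh (tensor_torus g gh) \<ge> 2 * pi\<^sup>2 * sqrt 3
         \<and> (willmore L Lh (tensor_torus g gh) = 2 * pi\<^sup>2 * sqrt 3
              \<longleftrightarrow> congruent_to_ejiri L Lh (tensor_torus g gh))"
proof -
  interpret tensor_pair g L gh Lh
    by unfold_locales (rule assms)+
  from willmore_geodesic_factor[OF assms(3)] show ?thesis
    using bound_of_great_circle_left bound_of_great_circle_right willmore_of_congruent by blast
qed

end
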